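(* Let $R$ be a commutative noetherian local ring that is complete (with respect to its maximal ideal). Then the set $\mathfrak{S}_0(R)$ of isomorphism classes of semidualizing $R$-modules is in bijection with the set $\mathfrak{Q}_0(R)$ of isomorphism classes of quasidualizing $R$-modules by Matlis duality; that is, the maps $\mathfrak{S}_0(R)\to\mathfrak{Q}_0(R)$, $C\mapsto C^\vee$, and $\mathfrak{Q}_0(R)\to\mathfrak{S}_0(R)$, $T\mapsto T^\vee$, are well defined and are inverse bijections.
   Context: Let $R$ be a commutative noetherian local ring with maximal ideal $\mathfrak{m}$, residue field $k=R/\mathfrak{m}$, $\mathfrak{m}$-adic completion $\widehat{R}$, injective hull $E=E_R(k)$, and Matlis duality functor $(-)^\vee=\operatorname{Hom}_R(-,E)$. An $R$-module $C$ is semidualizing if (i) $C$ is finitely generated; (ii) the homothety map $R\to\operatorname{Hom}_R(C,C)$, $r\mapsto[c\mapsto rc]$, is an isomorphism; (iii) $\operatorname{Ext}^i_R(C,C)=0$ for all $i>0$. An $R$-module $T$ is quasidualizing if (i) $T$ is artinian; (ii) the homothety map $\widehat{R}\to\operatorname{Hom}_R(T,T)$, $r\mapsto[t\mapsto rt]$, is an isomorphism (an artinian $R$-module is $\mathfrak m$-torsion and so has a natural $\widehat{R}$-module structure); (iii) $\operatorname{Ext}^i_R(T,T)=0$ for all $i>0$. *)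

theory Defs
  imports "HOL-Library.FSet" "HOL-Algebra.Module" "HOL-Algebra.Ideal_Product"
    "HOL-Algebra.Ring_Divisibility"
begin

hide_const (open) Multiset.mult

section \<open>Modules over a commutative ring\<close>

text \<open>The \<open>mult\<close> and \<open>one\<close> fields of a module record carry no meaning; in the constructions
  below they are \<^const>\<open>undefined\<close>.  Homomorphisms are extensional functions, so that
  they are determined by their values on the carrier.\<close>

definition module_hom ::
  "('a, 'r) ring_scheme \<Rightarrow> ('a, 'm) module \<Rightarrow> ('a, 'n) module \<Rightarrow> ('m \<Rightarrow> 'n) set" where
  "module_hom R M N = {f \<in> carrier M \<rightarrow>\<^sub>E carrier N.
     (\<forall>x \<in> carrier M. \<forall>y \<in> carrier M. f (x \<oplus>\<^bsub>M\<^esub> y) = f x \<oplus>\<^bsub>N\<^esub> f y) \<and>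
     (\<forall>r \<in> carrier R. \<forall>x \<in> carrier M. f (r \<odot>\<^bsub>M\<^esub> x) = r \<odot>\<^bsub>N\<^esub> f x)}"

definition module_iso ::
  "('a, 'r) ring_scheme \<Rightarrow> ('a, 'm) module \<Rightarrow> ('a, 'n) module \<Rightarrow> ('m \<Rightarrow> 'n) set" where
  "module_iso R M N = {f \<in> module_hom R M N. bij_betw f (carrier M) (carrier N)}"

definition module_isomorphic ::
  "('a, 'r) ring_scheme \<Rightarrow> ('a, 'm) module \<Rightarrow> ('a, 'n) module \<Rightarrow> bool" where
  "module_isomorphic R M N \<longleftrightarrow> module_iso R M N \<noteq> {}"

definition regular_module :: "('a, 'r) ring_scheme \<Rightarrow> ('a, 'a) module" where
  "regular_module R = \<lparr>carrier = carrier R, mult = undefined, one = undefined,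
     zero = \<zero>\<^bsub>R\<^esub>, add = add R, smult = mult R\<rparr>"

lemma regular_module_is_module: assumes "cring R" shows "module R (regular_module R)"
proof -
  interpret cring R by fact
  show ?thesis
  proof (rule moduleI)
    show "abelian_group (regular_module R)"
    proof (rule abelian_groupI)
      fix x assume "x \<in> carrier (regular_module R)"
      then show "\<exists>y\<in>carrier (regular_module R). y \<oplus>\<^bsub>regular_module R\<^esub> x = \<zero>\<^bsub>regular_module R\<^esub>"
        by (intro bexI[of _ "\<ominus>\<^bsub>R\<^esub> x"]) (auto simp: regular_module_def l_neg)
    qed (auto simp: regular_module_def a_ac)
  qed (use assms in \<open>auto simp: regular_module_def l_distr r_distr m_assoc\<close>)
qed

definition quotient_module :: "('a, 'm) module \<Rightarrow> 'm set \<Rightarrow> ('a, 'm set) module" where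
  "quotient_module M N = \<lparr>carrier = a_rcosets\<^bsub>M\<^esub> N, mult = undefined, one = undefined,
     zero = N, add = set_add M, smult = (\<lambda>r X. \<Union>x \<in> X. N +>\<^bsub>M\<^esub> (r \<odot>\<^bsub>M\<^esub> x))\<rparr>"

text \<open>\<open>Hom\<^sub>R(M, N)\<close>, where a possibly different ring acts on values in \<open>N\<close> through \<open>act\<close>.\<close>

definition hom_module_via ::
  "('a, 'r) ring_scheme \<Rightarrow> ('a, 'm) module \<Rightarrow> ('a, 'n) module \<Rightarrow> ('s \<Rightarrow> 'n \<Rightarrow> 'n)
     \<Rightarrow> ('s, 'm \<Rightarrow> 'n) module" where
  "hom_module_via R M N act = \<lparr>carrier = module_hom R M N, mult = undefined, one = undefined,
     zero = (\<lambda>x \<in> carrier M. \<zero>\<^bsub>N\<^esub>),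
     add = (\<lambda>f g. \<lambda>x \<in> carrier M. f x \<oplus>\<^bsub>N\<^esub> g x),
     smult = (\<lambda>s f. \<lambda>x \<in> carrier M. act s (f x))\<rparr>"

definition hom_module ::
  "('a, 'r) ring_scheme \<Rightarrow> ('a, 'm) module \<Rightarrow> ('a, 'n) module \<Rightarrow> ('a, 'm \<Rightarrow> 'n) module" where
  "hom_module R M N = hom_module_via R M N (smult N)"

lemma hom_module_is_module: assumes "module R M" "module R N"
  shows "module R (hom_module R M N)"
proof -
  interpret M: module R M by fact
  interpret N: module R N by fact
  show ?thesis
  proof (rule moduleI)
    show "cring R" ..
    show "abelian_group (hom_module R M N)"
    proof (rule abelian_groupI)
      fix f assume "f \<in> carrier (hom_module R M N)"
      then show "\<exists>g\<in>carrier (hom_module R M N). g \<oplus>\<^bsub>hom_module R M N\<^esub> f = \<zero>\<^bsub>hom_module R M N\<^esub>"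
        by (intro bexI[of _ "\<lambda>x \<in> carrier M. \<ominus>\<^bsub>N\<^esub> f x"])
          (auto simp: hom_module_def hom_module_via_def module_hom_def N.l_neg N.M.minus_add
           N.smult_r_minus PiE_def Pi_def intro!: restrict_ext)
    qed (auto simp: hom_module_def hom_module_via_def module_hom_def fun_eq_iff
        N.a_ac PiE_def Pi_def extensional_def N.smult_r_distr)
  qed (auto simp: hom_module_def hom_module_via_def module_hom_def fun_eq_iff
        PiE_def Pi_def extensional_def N.smult_r_distr
        N.smult_l_distr N.smult_assoc1[symmetric] M.R.m_comm)
qed

definition homothety ::
  "('s, 'q) ring_scheme \<Rightarrow> ('s \<Rightarrow> 'm \<Rightarrow> 'm) \<Rightarrow> ('a, 'm) module \<Rightarrow> 's \<Rightarrow> 'm \<Rightarrow> 'm" where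
  "homothety S act M = (\<lambda>s \<in> carrier S. \<lambda>x \<in> carrier M. act s x)"

definition finitely_generated :: "('a, 'r) ring_scheme \<Rightarrow> ('a, 'm) module \<Rightarrow> bool" where
  "finitely_generated R M \<longleftrightarrow> (\<exists>A. finite A \<and> A \<subseteq> carrier M \<and>
     (\<forall>N. submodule N R M \<and> A \<subseteq> N \<longrightarrow> N = carrier M))"

definition artinian :: "('a, 'r) ring_scheme \<Rightarrow> ('a, 'm) module \<Rightarrow> bool" where
  "artinian R M \<longleftrightarrow> (\<forall>N :: nat \<Rightarrow> 'm set.
     (\<forall>i. submodule (N i) R M) \<and> (\<forall>i. N (Suc i) \<subseteq> N i) \<longrightarrow> (\<exists>n. \<forall>i \<ge> n. N i = N n))"


section \<open>Injective hulls\<close>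

text \<open>HOL cannot quantify over all types inside a definition, so the test modules \<open>A\<close> and
  \<open>B\<close> live on the type of ring elements.  These include the inclusions of ideals into \<open>R\<close>,
  hence by Baer's criterion the extension property holds for test modules of every type; this
  is \<open>injective_module_extension\<close> below.\<close>

definition injective_module :: "('a, 'r) ring_scheme \<Rightarrow> ('a, 'e) module \<Rightarrow> bool" where
  "injective_module R E \<longleftrightarrow> module R E \<and>
     (\<forall>(A :: ('a, 'a) module) (B :: ('a, 'a) module). module R A \<and> module R B \<longrightarrow>
       (\<forall>i \<in> module_hom R A B. inj_on i (carrier A) \<longrightarrow>
         (\<forall>f \<in> module_hom R A E. \<exists>g \<in> module_hom R B E. \<forall>x \<in> carrier A. g (i x) = f x)))"

theorem injective_module_extension:
  fixes R :: "('a, 'r) ring_scheme" and E :: "('a, 'e) module" and B :: "('a, 'b) module"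
  assumes inj: "injective_module R E" and B: "module R B" and A: "submodule A R B"
    and f: "f \<in> module_hom R (B\<lparr>carrier := A\<rparr>) E"
  shows "\<exists>g \<in> module_hom R B E. \<forall>x \<in> A. g x = f x"
proof -
  interpret B: module R B by fact
  interpret E: module R E using inj by (simp add: injective_module_def)
  define P where "P = (\<lambda>G. G \<subseteq> carrier B \<times> carrier E \<and>
     (\<forall>x y x' y'. (x, y) \<in> G \<longrightarrow> (x', y') \<in> G \<longrightarrow> (x \<oplus>\<^bsub>B\<^esub> x', y \<oplus>\<^bsub>E\<^esub> y') \<in> G) \<and>
     (\<forall>r x y. r \<in> carrier R \<longrightarrow> (x, y) \<in> G \<longrightarrow> (r \<odot>\<^bsub>B\<^esub> x, r \<odot>\<^bsub>E\<^esub> y) \<in> G) \<and>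
     (\<forall>y. (\<zero>\<^bsub>B\<^esub>, y) \<in> G \<longrightarrow> y = \<zero>\<^bsub>E\<^esub>))"
  have PC: "x \<in> carrier B" "y \<in> carrier E" if "P G" "(x, y) \<in> G" for G x y
    using that by (auto simp: P_def)
  have Padd: "(x \<oplus>\<^bsub>B\<^esub> x', y \<oplus>\<^bsub>E\<^esub> y') \<in> G" if "P G" "(x, y) \<in> G" "(x', y') \<in> G" for G x y x' y'
    using that by (auto simp: P_def)
  have Psm: "(r \<odot>\<^bsub>B\<^esub> x, r \<odot>\<^bsub>E\<^esub> y) \<in> G" if "P G" "r \<in> carrier R" "(x, y) \<in> G" for G r x y
    using that by (auto simp: P_def)
  have P0: "y = \<zero>\<^bsub>E\<^esub>" if "P G" "(\<zero>\<^bsub>B\<^esub>, y) \<in> G" for G y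
    using that by (auto simp: P_def)
  have Pmin: "(\<ominus>\<^bsub>B\<^esub> x, \<ominus>\<^bsub>E\<^esub> y) \<in> G" if "P G" "(x, y) \<in> G" for G x y
    using Psm[OF that(1) _ that(2), of "\<ominus>\<^bsub>R\<^esub> \<one>\<^bsub>R\<^esub>"] PC[OF that]
    by (simp add: B.smult_l_minus E.smult_l_minus)
  have Puniq: "y = y'" if "P G" "(x, y) \<in> G" "(x, y') \<in> G" for G x y y'
  proof -
    note c = PC[OF that(1,2)] PC[OF that(1,3)]
    have "(x \<oplus>\<^bsub>B\<^esub> \<ominus>\<^bsub>B\<^esub> x, y \<oplus>\<^bsub>E\<^esub> \<ominus>\<^bsub>E\<^esub> y') \<in> G"
      using Padd[OF that(1,2) Pmin[OF that(1,3)]] .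
    then have "y \<oplus>\<^bsub>E\<^esub> \<ominus>\<^bsub>E\<^esub> y' = \<zero>\<^bsub>E\<^esub>" using P0[OF that(1)] c by (simp add: B.M.r_neg)
    then show ?thesis using c E.minus_equality[of y "\<ominus>\<^bsub>E\<^esub> y'"] by simp
  qed
  define G0 where "G0 = (\<lambda>x. (x, f x)) ` A"
  have Asub: "A \<subseteq> carrier B" using B.submoduleE(1)[OF A] .
  have zA: "\<zero>\<^bsub>B\<^esub> \<in> A" using subgroup.one_closed[OF submodule.axioms(1)[OF A]] by simp
  have fE: "f x \<in> carrier E" if "x \<in> A" for x using f that by (auto simp: module_hom_def)
  have fadd: "f (x \<oplus>\<^bsub>B\<^esub> y) = f x \<oplus>\<^bsub>E\<^esub> f y" if "x \<in> A" "y \<in> A" for x y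
    using f that by (auto simp: module_hom_def)
  have fsm: "f (r \<odot>\<^bsub>B\<^esub> x) = r \<odot>\<^bsub>E\<^esub> f x" if "r \<in> carrier R" "x \<in> A" for r x
    using f that by (auto simp: module_hom_def)
  have f0: "f \<zero>\<^bsub>B\<^esub> = \<zero>\<^bsub>E\<^esub>" using fsm[OF B.R.zero_closed zA] fE[OF zA] by simp
  have PG0: "P G0"
    unfolding P_def
  proof (intro conjI allI impI)
    show "G0 \<subseteq> carrier B \<times> carrier E" using Asub fE by (auto simp: G0_def)
    show "(x \<oplus>\<^bsub>B\<^esub> x', y \<oplus>\<^bsub>E\<^esub> y') \<in> G0" if "(x, y) \<in> G0" "(x', y') \<in> G0" for x y x' y'
      using that fadd[of x x'] B.submoduleE(5)[OF A, of x x'] by (auto simp: G0_def)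
    show "(r \<odot>\<^bsub>B\<^esub> x, r \<odot>\<^bsub>E\<^esub> y) \<in> G0" if "r \<in> carrier R" "(x, y) \<in> G0" for r x y
      using that fsm[of r x] B.submoduleE(4)[OF A, of r x] by (auto simp: G0_def)
    show "y = \<zero>\<^bsub>E\<^esub>" if "(\<zero>\<^bsub>B\<^esub>, y) \<in> G0" for y
      using that f0 by (auto simp: G0_def)
  qed
  have "\<exists>M\<in>{G. P G \<and> G0 \<subseteq> G}. \<forall>X\<in>{G. P G \<and> G0 \<subseteq> G}. M \<subseteq> X \<longrightarrow> X = M"
  proof (rule subset_Zorn_nonempty)
    show "{G. P G \<and> G0 \<subseteq> G} \<noteq> {}" using PG0 by auto
    fix C assume "C \<noteq> {}" and C: "subset.chain {G. P G \<and> G0 \<subseteq> G} C"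
    have CP: "P G" "G0 \<subseteq> G" if "G \<in> C" for G using C that by (auto simp: subset.chain_def)
    have tot: "\<exists>G \<in> C. p \<in> G \<and> q \<in> G" if "p \<in> \<Union>C" "q \<in> \<Union>C" for p q
    proof -
      from that obtain G H where GH: "G \<in> C" "H \<in> C" "p \<in> G" "q \<in> H" by auto
      have "G \<subseteq> H \<or> H \<subseteq> G" using C GH(1,2) by (auto simp: subset_chain_def)
      then show ?thesis using GH by (elim disjE) (auto dest: subsetD)
    qed
    have "P (\<Union>C)"
      unfolding P_def
    proof (intro conjI allI impI)
      show "\<Union>C \<subseteq> carrier B \<times> carrier E"
        by (rule Union_least) (use CP(1) in \<open>simp add: P_def\<close>)
      fix x y x' y' assume "(x, y) \<in> \<Union>C" "(x', y') \<in> \<Union>C"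
      from tot[OF this] obtain H where H: "H \<in> C" "(x, y) \<in> H" "(x', y') \<in> H" by auto
      show "(x \<oplus>\<^bsub>B\<^esub> x', y \<oplus>\<^bsub>E\<^esub> y') \<in> \<Union>C"
        by (rule UnionI[OF H(1) Padd[OF CP(1)[OF H(1)] H(2,3)]])
    next
      fix r x y assume r: "r \<in> carrier R" and "(x, y) \<in> \<Union>C"
      then obtain H where H: "H \<in> C" "(x, y) \<in> H" by auto
      show "(r \<odot>\<^bsub>B\<^esub> x, r \<odot>\<^bsub>E\<^esub> y) \<in> \<Union>C"
        by (rule UnionI[OF H(1) Psm[OF CP(1)[OF H(1)] r H(2)]])
    next
      fix y assume "(\<zero>\<^bsub>B\<^esub>, y) \<in> \<Union>C"
      then obtain H where H: "H \<in> C" "(\<zero>\<^bsub>B\<^esub>, y) \<in> H" by auto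
      show "y = \<zero>\<^bsub>E\<^esub>" by (rule P0[OF CP(1)[OF H(1)] H(2)])
    qed
    moreover from \<open>C \<noteq> {}\<close> obtain H where "H \<in> C" by auto
    then have "G0 \<subseteq> \<Union>C" using CP(2)[of H] by auto
    ultimately show "\<Union>C \<in> {G. P G \<and> G0 \<subseteq> G}" by simp
  qed
  then obtain G where G: "P G" "G0 \<subseteq> G"
    and max: "\<And>X. P X \<Longrightarrow> G \<subseteq> X \<Longrightarrow> X = G" by auto
  have z: "(\<zero>\<^bsub>B\<^esub>, \<zero>\<^bsub>E\<^esub>) \<in> G" using G(2) zA f0 by (force simp: G0_def)
  have dom: "\<exists>y. (b, y) \<in> G" if b: "b \<in> carrier B" for b
  proof -
    define I where "I = {r \<in> carrier R. \<exists>y. (r \<odot>\<^bsub>B\<^esub> b, y) \<in> G}"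
    define h where "h = (\<lambda>r \<in> I. THE y. (r \<odot>\<^bsub>B\<^esub> b, y) \<in> G)"
    have hG: "(r \<odot>\<^bsub>B\<^esub> b, h r) \<in> G" if "r \<in> I" for r
      using theI'[of "\<lambda>y. (r \<odot>\<^bsub>B\<^esub> b, y) \<in> G"] that Puniq[OF G(1)] by (auto simp: I_def h_def)
    have hI: "r \<in> I" "h r = y" if "r \<in> carrier R" "(r \<odot>\<^bsub>B\<^esub> b, y) \<in> G" for r y
    proof -
      show "r \<in> I" using that by (auto simp: I_def)
      from Puniq[OF G(1) hG[OF this] that(2)] show "h r = y" .
    qed
    let ?R = "regular_module R" and ?A = "(regular_module R)\<lparr>carrier := I\<rparr>"
    interpret R': module R ?R by (rule regular_module_is_module) (rule B.R.is_cring)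
    have Ic: "r \<in> carrier R" if "r \<in> I" for r using that by (auto simp: I_def)
    have add: "r \<oplus>\<^bsub>R\<^esub> s \<in> I \<and> h (r \<oplus>\<^bsub>R\<^esub> s) = h r \<oplus>\<^bsub>E\<^esub> h s" if "r \<in> I" "s \<in> I" for r s
      using hI[of "r \<oplus>\<^bsub>R\<^esub> s" "h r \<oplus>\<^bsub>E\<^esub> h s"] Padd[OF G(1) hG[OF that(1)] hG[OF that(2)]]
        that Ic b by (simp add: B.smult_l_distr)
    have sm: "r \<otimes>\<^bsub>R\<^esub> s \<in> I \<and> h (r \<otimes>\<^bsub>R\<^esub> s) = r \<odot>\<^bsub>E\<^esub> h s" if "r \<in> carrier R" "s \<in> I" for r s
      using hI[of "r \<otimes>\<^bsub>R\<^esub> s" "r \<odot>\<^bsub>E\<^esub> h s"] Psm[OF G(1) that(1) hG[OF that(2)]]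
        that Ic b by (simp add: B.smult_assoc1)
    have zI: "\<zero>\<^bsub>R\<^esub> \<in> I" using hI(1)[of "\<zero>\<^bsub>R\<^esub>"] z b by simp
    have neg: "\<ominus>\<^bsub>R\<^esub> r \<in> I" if "r \<in> I" for r
      using sm[of "\<ominus>\<^bsub>R\<^esub> \<one>\<^bsub>R\<^esub>" r] that Ic by (simp add: B.R.l_minus)
    have "submodule I R ?R"
    proof (rule R'.submoduleI)
      fix a assume "a \<in> I"
      then have "\<ominus>\<^bsub>?R\<^esub> a = \<ominus>\<^bsub>R\<^esub> a"
        by (intro R'.minus_equality) (auto simp: regular_module_def Ic B.R.l_neg)
      then show "\<ominus>\<^bsub>?R\<^esub> a \<in> I" using neg[OF \<open>a \<in> I\<close>] by simp
    qed (use Ic add sm zI in \<open>auto simp: regular_module_def\<close>)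
    then have mA: "module R ?A"
      by (rule submodule.submodule_is_module) (rule R'.module_axioms)
    have hcl: "h r \<in> carrier E" if "r \<in> I" for r using PC(2)[OF G(1) hG[OF that]] .
    have hext: "h \<in> extensional I" by (simp add: h_def)
    have hE: "h \<in> module_hom R ?A E"
      by (simp add: module_hom_def regular_module_def PiE_iff hcl hext add sm)
    have iA: "(\<lambda>x \<in> I. x) \<in> module_hom R ?A ?R" "inj_on (\<lambda>x \<in> I. x) (carrier ?A)"
      using Ic add sm by (auto simp: module_hom_def regular_module_def inj_on_def)
    have ext: "\<forall>(A :: ('a, 'a) module) (B :: ('a, 'a) module). module R A \<and> module R B \<longrightarrow>
       (\<forall>i \<in> module_hom R A B. inj_on i (carrier A) \<longrightarrow>
         (\<forall>f \<in> module_hom R A E. \<exists>g \<in> module_hom R B E. \<forall>x \<in> carrier A. g (i x) = f x))"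
      using inj unfolding injective_module_def by (rule conjunct2)
    have "\<exists>g \<in> module_hom R ?R E. \<forall>x \<in> carrier ?A. g ((\<lambda>x \<in> I. x) x) = h x"
      by (rule ext[rule_format, of ?A ?R, OF conjI[OF mA R'.module_axioms] iA hE])
    then obtain k where k: "k \<in> module_hom R ?R E" and kh: "\<And>x. x \<in> I \<Longrightarrow> k x = h x"
      by auto
    define e where "e = k \<one>\<^bsub>R\<^esub>"
    have e: "e \<in> carrier E" using k by (auto simp: e_def module_hom_def regular_module_def)
    have he: "h r = r \<odot>\<^bsub>E\<^esub> e" if "r \<in> I" for r
    proof -
      have "k (r \<otimes>\<^bsub>R\<^esub> \<one>\<^bsub>R\<^esub>) = r \<odot>\<^bsub>E\<^esub> k \<one>\<^bsub>R\<^esub>"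
        using k Ic[OF that] B.R.one_closed
        by (simp add: module_hom_def regular_module_def del: B.R.r_one)
      then show ?thesis using kh[OF that] Ic[OF that] by (simp add: e_def)
    qed
    define G' where "G' = {(x \<oplus>\<^bsub>B\<^esub> r \<odot>\<^bsub>B\<^esub> b, y \<oplus>\<^bsub>E\<^esub> r \<odot>\<^bsub>E\<^esub> e) |x y r. (x, y) \<in> G \<and> r \<in> carrier R}"
    have G'I: "(x', y') \<in> G'" if "(x, y) \<in> G" "r \<in> carrier R"
      "x' = x \<oplus>\<^bsub>B\<^esub> r \<odot>\<^bsub>B\<^esub> b" "y' = y \<oplus>\<^bsub>E\<^esub> r \<odot>\<^bsub>E\<^esub> e" for x y r x' y'
      using that by (auto simp: G'_def)
    have "P G'"
      unfolding P_def
    proof (intro conjI allI impI)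
      show "G' \<subseteq> carrier B \<times> carrier E"
        using b e PC[OF G(1)] by (auto simp: G'_def)
      fix x y x' y' assume "(x, y) \<in> G'" "(x', y') \<in> G'"
      then obtain u v r u' v' r' where *: "(u, v) \<in> G" "(u', v') \<in> G" "r \<in> carrier R" "r' \<in> carrier R"
        "x = u \<oplus>\<^bsub>B\<^esub> r \<odot>\<^bsub>B\<^esub> b" "y = v \<oplus>\<^bsub>E\<^esub> r \<odot>\<^bsub>E\<^esub> e"
        "x' = u' \<oplus>\<^bsub>B\<^esub> r' \<odot>\<^bsub>B\<^esub> b" "y' = v' \<oplus>\<^bsub>E\<^esub> r' \<odot>\<^bsub>E\<^esub> e"
        by (auto simp: G'_def)
      show "(x \<oplus>\<^bsub>B\<^esub> x', y \<oplus>\<^bsub>E\<^esub> y') \<in> G'"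
        by (rule G'I[OF Padd[OF G(1) *(1,2)], of "r \<oplus>\<^bsub>R\<^esub> r'"])
          (use * b e PC[OF G(1) *(1)] PC[OF G(1) *(2)] in
            \<open>simp_all add: B.smult_l_distr E.smult_l_distr B.M.a_ac E.M.a_ac\<close>)
    next
      fix s x y assume s: "s \<in> carrier R" and "(x, y) \<in> G'"
      then obtain u v r where *: "(u, v) \<in> G" "r \<in> carrier R"
        "x = u \<oplus>\<^bsub>B\<^esub> r \<odot>\<^bsub>B\<^esub> b" "y = v \<oplus>\<^bsub>E\<^esub> r \<odot>\<^bsub>E\<^esub> e"
        by (auto simp: G'_def)
      show "(s \<odot>\<^bsub>B\<^esub> x, s \<odot>\<^bsub>E\<^esub> y) \<in> G'"
        by (rule G'I[OF Psm[OF G(1) s *(1)], of "s \<otimes>\<^bsub>R\<^esub> r"])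
          (use * s b e PC[OF G(1) *(1)] in
            \<open>simp_all add: B.smult_r_distr E.smult_r_distr B.smult_assoc1 E.smult_assoc1\<close>)
    next
      fix y assume "(\<zero>\<^bsub>B\<^esub>, y) \<in> G'"
      then obtain u v r where *: "(u, v) \<in> G" "r \<in> carrier R"
        "\<zero>\<^bsub>B\<^esub> = u \<oplus>\<^bsub>B\<^esub> r \<odot>\<^bsub>B\<^esub> b" "y = v \<oplus>\<^bsub>E\<^esub> r \<odot>\<^bsub>E\<^esub> e"
        by (auto simp: G'_def)
      note c = PC[OF G(1) *(1)]
      have "\<ominus>\<^bsub>B\<^esub> u = r \<odot>\<^bsub>B\<^esub> b"
        using c b * by (intro B.minus_equality) (auto simp: B.M.a_comm)
      then have "(r \<odot>\<^bsub>B\<^esub> b, \<ominus>\<^bsub>E\<^esub> v) \<in> G" using Pmin[OF G(1) *(1)] by simp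
      from hI[OF *(2) this] he[of r] have "r \<odot>\<^bsub>E\<^esub> e = \<ominus>\<^bsub>E\<^esub> v" by simp
      then show "y = \<zero>\<^bsub>E\<^esub>" using c * by (simp add: E.M.r_neg)
    qed
    moreover have "G \<subseteq> G'"
    proof (rule subrelI)
      fix x y assume xy: "(x, y) \<in> G"
      show "(x, y) \<in> G'" by (rule G'I[OF xy B.R.zero_closed]) (use PC[OF G(1) xy] b e in auto)
    qed
    ultimately have "G' = G" by (rule max)
    moreover have "(b, e) \<in> G'" by (rule G'I[OF z B.R.one_closed]) (use b e in auto)
    ultimately show ?thesis by blast
  qed
  define g where "g = (\<lambda>x \<in> carrier B. THE y. (x, y) \<in> G)"
  have gG: "(x, g x) \<in> G" if "x \<in> carrier B" for x
    using theI'[of "\<lambda>y. (x, y) \<in> G"] dom[OF that] Puniq[OF G(1)] that by (auto simp: g_def)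
  have geq: "g x = y" if "(x, y) \<in> G" for x y
    using Puniq[OF G(1) gG[OF PC(1)[OF G(1) that]] that] .
  have gE: "g x \<in> carrier E" if "x \<in> carrier B" for x using PC(2)[OF G(1) gG[OF that]] .
  have gadd: "g (x \<oplus>\<^bsub>B\<^esub> y) = g x \<oplus>\<^bsub>E\<^esub> g y" if "x \<in> carrier B" "y \<in> carrier B" for x y
    using geq[OF Padd[OF G(1) gG[OF that(1)] gG[OF that(2)]]] .
  have gsm: "g (r \<odot>\<^bsub>B\<^esub> x) = r \<odot>\<^bsub>E\<^esub> g x" if "r \<in> carrier R" "x \<in> carrier B" for r x
    using geq[OF Psm[OF G(1) that(1) gG[OF that(2)]]] .
  have gext: "g \<in> extensional (carrier B)" by (simp add: g_def)
  have "g \<in> module_hom R B E"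
    by (simp add: module_hom_def PiE_iff gE gadd gsm gext)
  moreover have "\<forall>x \<in> A. g x = f x" using G(2) geq by (auto simp: G0_def)
  ultimately show ?thesis by blast
qed

text \<open>\<open>E\<close> is injective and an essential extension of an embedded copy of \<open>M\<close>.\<close>

definition injective_hull ::
  "('a, 'r) ring_scheme \<Rightarrow> ('a, 'm) module \<Rightarrow> ('a, 'e) module \<Rightarrow> bool" where
  "injective_hull R M E \<longleftrightarrow> injective_module R E \<and>
     (\<exists>j \<in> module_hom R M E. inj_on j (carrier M) \<and>
       (\<forall>N. submodule N R E \<and> N \<noteq> {\<zero>\<^bsub>E\<^esub>} \<longrightarrow> N \<inter> j ` carrier M \<noteq> {\<zero>\<^bsub>E\<^esub>}))"


section \<open>Local rings and completion\<close>

definition local_ring :: "('a, 'r) ring_scheme \<Rightarrow> bool" where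
  "local_ring R \<longleftrightarrow> cring R \<and> (\<exists>!m. maximalideal m R)"

definition max_ideal :: "('a, 'r) ring_scheme \<Rightarrow> 'a set" where
  "max_ideal R = (THE m. maximalideal m R)"

definition residue_field_module :: "('a, 'r) ring_scheme \<Rightarrow> ('a, 'a set) module" where
  "residue_field_module R = quotient_module (regular_module R) (max_ideal R)"

primrec ideal_power :: "('a, 'r) ring_scheme \<Rightarrow> 'a set \<Rightarrow> nat \<Rightarrow> 'a set" where
  "ideal_power R I 0 = carrier R"
| "ideal_power R I (Suc n) = ideal_prod R I (ideal_power R I n)"

text \<open>The inverse limit of the rings \<open>R/m\<^sup>n\<close>.  The projection from \<open>R/m\<^sup>n\<^sup>+\<^sup>1\<close> to
  \<open>R/m\<^sup>n\<close> sends a coset to the unique coset containing it.\<close>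

definition completion :: "('a, 'r) ring_scheme \<Rightarrow> (nat \<Rightarrow> 'a set) ring" where
  "completion R = (let Q = (\<lambda>n. R Quot ideal_power R (max_ideal R) n) in
     \<lparr>carrier = {\<xi>. \<forall>n. \<xi> n \<in> carrier (Q n) \<and> \<xi> (Suc n) \<subseteq> \<xi> n},
      mult = (\<lambda>\<xi> \<eta> n. \<xi> n \<otimes>\<^bsub>Q n\<^esub> \<eta> n), one = (\<lambda>n. \<one>\<^bsub>Q n\<^esub>),
      zero = (\<lambda>n. \<zero>\<^bsub>Q n\<^esub>), add = (\<lambda>\<xi> \<eta> n. \<xi> n \<oplus>\<^bsub>Q n\<^esub> \<eta> n)\<rparr>)"

definition max_ideal_complete :: "('a, 'r) ring_scheme \<Rightarrow> bool" where
  "max_ideal_complete R \<longleftrightarrow>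
     (\<lambda>r n. ideal_power R (max_ideal R) n +>\<^bsub>R\<^esub> r) \<in> ring_iso R (completion R)"

text \<open>The action of the completion on a torsion module: if \<open>m\<^sup>n\<close> kills \<open>t\<close>, then \<open>\<xi>\<close> acts on \<open>t\<close>
  as any representative of its \<open>n\<close>-th component.\<close>

definition completion_smult ::
  "('a, 'r) ring_scheme \<Rightarrow> ('a, 't) module \<Rightarrow> (nat \<Rightarrow> 'a set) \<Rightarrow> 't \<Rightarrow> 't" where
  "completion_smult R T \<xi> t = (THE s. \<exists>n. \<exists>r \<in> \<xi> n.
     (\<forall>a \<in> ideal_power R (max_ideal R) n. a \<odot>\<^bsub>T\<^esub> t = \<zero>\<^bsub>T\<^esub>) \<and> s = r \<odot>\<^bsub>T\<^esub> t)"


section \<open>Ext\<close>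

text \<open>\<open>Ext\<close> is computed from the canonical free resolution in which \<open>F\<^sub>0\<close> is free on the
  elements of \<open>M\<close> and \<open>F\<^sub>n\<^sub>+\<^sub>1\<close> is free on the elements of the \<open>n\<close>-th syzygy module.\<close>

definition free_module :: "('a, 'r) ring_scheme \<Rightarrow> 'b set \<Rightarrow> ('a, 'b \<Rightarrow> 'a) module" where
  "free_module R X = \<lparr>carrier = {f. (\<forall>x. f x \<in> carrier R) \<and> finite {x. f x \<noteq> \<zero>\<^bsub>R\<^esub>} \<and>
       (\<forall>x. x \<notin> X \<longrightarrow> f x = \<zero>\<^bsub>R\<^esub>)}, mult = undefined, one = undefined,
     zero = (\<lambda>x. \<zero>\<^bsub>R\<^esub>), add = (\<lambda>f g x. f x \<oplus>\<^bsub>R\<^esub> g x), smult = (\<lambda>r f x. r \<otimes>\<^bsub>R\<^esub> f x)\<rparr>"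

lemma free_module_is_module: assumes "cring R" shows "module R (free_module R X)"
proof -
  interpret cring R by fact
  have fin: "finite {x. f x \<oplus>\<^bsub>R\<^esub> g x \<noteq> \<zero>\<^bsub>R\<^esub>}"
    if "finite {x. f x \<noteq> \<zero>\<^bsub>R\<^esub>}" "finite {x. g x \<noteq> \<zero>\<^bsub>R\<^esub>}" for f g :: "'c \<Rightarrow> 'a"
    by (rule finite_subset[of _ "{x. f x \<noteq> \<zero>\<^bsub>R\<^esub>} \<union> {x. g x \<noteq> \<zero>\<^bsub>R\<^esub>}"]) (use that in auto)
  show ?thesis
  proof (rule moduleI)
    show "abelian_group (free_module R X)"
    proof (rule abelian_groupI)
      fix f assume "f \<in> carrier (free_module R X)"
      then show "\<exists>g\<in>carrier (free_module R X). g \<oplus>\<^bsub>free_module R X\<^esub> f = \<zero>\<^bsub>free_module R X\<^esub>"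
        by (intro bexI[of _ "\<lambda>x. \<ominus>\<^bsub>R\<^esub> f x"])
          (auto simp: free_module_def l_neg elim: rev_finite_subset)
    qed (auto simp: free_module_def fin a_ac fun_eq_iff)
  next
    show "a \<odot>\<^bsub>free_module R X\<^esub> f \<in> carrier (free_module R X)"
      if "a \<in> carrier R" "f \<in> carrier (free_module R X)" for a f
      using that by (auto simp: free_module_def elim: rev_finite_subset)
  qed (use assms in \<open>auto simp: free_module_def fun_eq_iff l_distr r_distr m_assoc\<close>)
qed

definition lin_ext ::
  "('a, 'r) ring_scheme \<Rightarrow> ('a, 'm) module \<Rightarrow> ('b \<Rightarrow> 'm) \<Rightarrow> ('b \<Rightarrow> 'a) \<Rightarrow> 'm" where
  "lin_ext R M v f = (\<Oplus>\<^bsub>M\<^esub> x \<in> {x. f x \<noteq> \<zero>\<^bsub>R\<^esub>}. f x \<odot>\<^bsub>M\<^esub> v x)"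

text \<open>A single type for the basis elements of all \<open>F\<^sub>n\<close>: \<open>Elt x\<close> for an element \<open>x\<close> of \<open>M\<close>, and
  \<open>Syz G\<close> for the syzygy whose nonzero coefficients have the finite graph \<open>G\<close>.\<close>

datatype ('a, 'm) res_gen = Elt (elt: 'm) | Syz (graph: "(('a, 'm) res_gen \<times> 'a) fset")

definition syz_gen ::
  "('a, 'r) ring_scheme \<Rightarrow> (('a, 'm) res_gen \<Rightarrow> 'a) \<Rightarrow> ('a, 'm) res_gen" where
  "syz_gen R f = Syz (Abs_fset {(x, f x) |x. f x \<noteq> \<zero>\<^bsub>R\<^esub>})"

definition syz_chain ::
  "('a, 'r) ring_scheme \<Rightarrow> ('a, 'm) res_gen \<Rightarrow> ('a, 'm) res_gen \<Rightarrow> 'a" where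
  "syz_chain R g = (\<lambda>x. if \<exists>a. (x, a) |\<in>| graph g then THE a. (x, a) |\<in>| graph g else \<zero>\<^bsub>R\<^esub>)"

definition res_augmentation ::
  "('a, 'r) ring_scheme \<Rightarrow> ('a, 'm) module \<Rightarrow> (('a, 'm) res_gen \<Rightarrow> 'a) \<Rightarrow> 'm" where
  "res_augmentation R M = lin_ext R M elt"

definition res_boundary ::
  "('a, 'r) ring_scheme \<Rightarrow> (('a, 'm) res_gen \<Rightarrow> 'a) \<Rightarrow> ('a, 'm) res_gen \<Rightarrow> 'a" where
  "res_boundary R = lin_ext R (free_module R UNIV) (syz_chain R)"

definition res_kernel :: "('a, 'r) ring_scheme \<Rightarrow> ('a, 'm) module \<Rightarrow> nat
     \<Rightarrow> ('a, 'm) res_gen set \<Rightarrow> (('a, 'm) res_gen \<Rightarrow> 'a) set" where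
  "res_kernel R M n X = {f \<in> carrier (free_module R X).
     if n = 0 then res_augmentation R M f = \<zero>\<^bsub>M\<^esub> else res_boundary R f = (\<lambda>x. \<zero>\<^bsub>R\<^esub>)}"

primrec res_basis ::
  "('a, 'r) ring_scheme \<Rightarrow> ('a, 'm) module \<Rightarrow> nat \<Rightarrow> ('a, 'm) res_gen set" where
  "res_basis R M 0 = Elt ` carrier M"
| "res_basis R M (Suc n) = syz_gen R ` res_kernel R M n (res_basis R M n)"

definition res_module :: "('a, 'r) ring_scheme \<Rightarrow> ('a, 'm) module \<Rightarrow> nat
     \<Rightarrow> ('a, ('a, 'm) res_gen \<Rightarrow> 'a) module" where
  "res_module R M n = free_module R (res_basis R M n)"

locale plain_module = module R M
  for R :: "('a, 'r) ring_scheme" (structure) and M :: "('a, 'm) module" (structure)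
begin

lemma lin_ext_superset:
  assumes "f \<in> carrier (free_module R X)" "v \<in> X \<rightarrow> carrier M"
    "finite A" "{x. f x \<noteq> \<zero>} \<subseteq> A" "A \<subseteq> X"
  shows "lin_ext R M v f = (\<Oplus>\<^bsub>M\<^esub> x \<in> A. f x \<odot>\<^bsub>M\<^esub> v x)"
  unfolding lin_ext_def
  by (rule M.add.finprod_mono_neutral_cong_left)
    (use assms in \<open>auto simp: free_module_def Pi_def subset_iff\<close>)

lemma supp_free:
  assumes "f \<in> carrier (free_module R X)"
  shows "finite {x. f x \<noteq> \<zero>}" "{x. f x \<noteq> \<zero>} \<subseteq> X" "f x \<in> carrier R"
  using assms by (auto simp: free_module_def)

lemma lin_ext_closed:
  assumes "f \<in> carrier (free_module R X)" "v \<in> X \<rightarrow> carrier M"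
  shows "lin_ext R M v f \<in> carrier M"
  unfolding lin_ext_def
  by (rule M.finsum_closed) (use supp_free[OF assms(1)] assms(2) in \<open>auto simp: Pi_def subset_iff\<close>)

lemma lin_ext_add:
  assumes "f \<in> carrier (free_module R X)" "g \<in> carrier (free_module R X)" "v \<in> X \<rightarrow> carrier M"
  shows "lin_ext R M v (f \<oplus>\<^bsub>free_module R X\<^esub> g) = lin_ext R M v f \<oplus>\<^bsub>M\<^esub> lin_ext R M v g"
proof -
  let ?A = "{x. f x \<noteq> \<zero>} \<union> {x. g x \<noteq> \<zero>}"
  let ?h = "f \<oplus>\<^bsub>free_module R X\<^esub> g"
  interpret F: module R "free_module R X" by (rule free_module_is_module) (rule R.is_cring)
  note s = supp_free[OF assms(1)] supp_free[OF assms(2)]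
  have A: "finite ?A" "?A \<subseteq> X" using s by auto
  have h: "?h \<in> carrier (free_module R X)" using assms by auto
  have hx: "?h x = f x \<oplus> g x" for x by (simp add: free_module_def)
  have vA: "v x \<in> carrier M" if "x \<in> ?A" for x using that A assms(3) by blast
  have "lin_ext R M v ?h = (\<Oplus>\<^bsub>M\<^esub> x \<in> ?A. ?h x \<odot>\<^bsub>M\<^esub> v x)"
    by (rule lin_ext_superset[OF h assms(3) A(1) _ A(2)]) (auto simp: hx)
  also have "\<dots> = (\<Oplus>\<^bsub>M\<^esub> x \<in> ?A. f x \<odot>\<^bsub>M\<^esub> v x \<oplus>\<^bsub>M\<^esub> g x \<odot>\<^bsub>M\<^esub> v x)"
    by (rule M.finsum_cong') (use vA s in \<open>auto simp: hx smult_l_distr\<close>)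
  also have "\<dots> = (\<Oplus>\<^bsub>M\<^esub> x \<in> ?A. f x \<odot>\<^bsub>M\<^esub> v x) \<oplus>\<^bsub>M\<^esub> (\<Oplus>\<^bsub>M\<^esub> x \<in> ?A. g x \<odot>\<^bsub>M\<^esub> v x)"
    by (rule M.finsum_addf) (use vA s in auto)
  also have "\<dots> = lin_ext R M v f \<oplus>\<^bsub>M\<^esub> lin_ext R M v g"
    using lin_ext_superset[OF assms(1,3) A(1) _ A(2)] lin_ext_superset[OF assms(2,3) A(1) _ A(2)] by auto
  finally show ?thesis .
qed

lemma lin_ext_smult:
  assumes "r \<in> carrier R" "f \<in> carrier (free_module R X)" "v \<in> X \<rightarrow> carrier M"
  shows "lin_ext R M v (r \<odot>\<^bsub>free_module R X\<^esub> f) = r \<odot>\<^bsub>M\<^esub> lin_ext R M v f"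
proof -
  let ?A = "{x. f x \<noteq> \<zero>}"
  let ?h = "r \<odot>\<^bsub>free_module R X\<^esub> f"
  interpret F: module R "free_module R X" by (rule free_module_is_module) (rule R.is_cring)
  note s = supp_free[OF assms(2)]
  have h: "?h \<in> carrier (free_module R X)" using assms by auto
  have hx: "?h x = r \<otimes> f x" for x by (simp add: free_module_def)
  have vA: "v x \<in> carrier M" if "x \<in> ?A" for x using that s assms(3) by blast
  have "lin_ext R M v ?h = (\<Oplus>\<^bsub>M\<^esub> x \<in> ?A. ?h x \<odot>\<^bsub>M\<^esub> v x)"
    by (rule lin_ext_superset[OF h assms(3) s(1) _ s(2)]) (use assms in \<open>auto simp: hx\<close>)
  also have "\<dots> = (\<Oplus>\<^bsub>M\<^esub> x \<in> ?A. r \<odot>\<^bsub>M\<^esub> (f x \<odot>\<^bsub>M\<^esub> v x))"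
    by (rule M.finsum_cong') (use vA s assms in \<open>auto simp: hx smult_assoc1\<close>)
  also have "\<dots> = r \<odot>\<^bsub>M\<^esub> lin_ext R M v f"
    unfolding lin_ext_def by (rule finsum_smult_ldistr[symmetric]) (use vA s assms in auto)
  finally show ?thesis .
qed

lemma lin_ext_delta:
  assumes "b \<in> X" "v \<in> X \<rightarrow> carrier M"
  defines "d \<equiv> (\<lambda>x. if x = b then \<one> else \<zero>)"
  shows "d \<in> carrier (free_module R X)" "lin_ext R M v d = v b"
proof -
  have sub: "{x. d x \<noteq> \<zero>} \<subseteq> {b}" by (auto simp: d_def)
  then show d: "d \<in> carrier (free_module R X)"
    using assms(1) finite_subset[OF sub] by (auto simp: free_module_def d_def)
  have "lin_ext R M v d = (\<Oplus>\<^bsub>M\<^esub> x \<in> {b}. d x \<odot>\<^bsub>M\<^esub> v x)"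
    by (rule lin_ext_superset[OF d assms(2) _ sub]) (use assms in auto)
  also have "\<dots> = v b" using assms by (auto simp: Pi_def)
  finally show "lin_ext R M v d = v b" .
qed

lemma submodule_finsum:
  assumes "submodule N R M" "finite A" "\<And>x. x \<in> A \<Longrightarrow> h x \<in> N"
  shows "(\<Oplus>\<^bsub>M\<^esub> x \<in> A. h x) \<in> N"
  using assms(2,3)
proof (induction A)
  case empty
  show ?case using subgroup.one_closed[OF submodule.axioms(1)[OF assms(1)]] by simp
next
  case (insert a A)
  then show ?case using submoduleE[OF assms(1)]
    by (subst M.finsum_insert) (auto simp: subset_iff)
qed

end

lemma syz_chain_syz_gen:
  assumes "finite {x. f x \<noteq> \<zero>\<^bsub>R\<^esub>}"
  shows "syz_chain R (syz_gen R f) = f"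
proof -
  have "{(x, f x) |x. f x \<noteq> \<zero>\<^bsub>R\<^esub>} = (\<lambda>x. (x, f x)) ` {x. f x \<noteq> \<zero>\<^bsub>R\<^esub>}" by auto
  then have "finite {(x, f x) |x. f x \<noteq> \<zero>\<^bsub>R\<^esub>}" using assms by simp
  then have "(y, a) |\<in>| graph (syz_gen R f) \<longleftrightarrow> a = f y \<and> f y \<noteq> \<zero>\<^bsub>R\<^esub>" for y a
    by (auto simp: syz_gen_def Abs_fset_inverse)
  then show ?thesis by (auto simp: syz_chain_def fun_eq_iff)
qed

lemma free_module_subset:
  "X \<subseteq> Y \<Longrightarrow> carrier (free_module R X) \<subseteq> carrier (free_module R Y)"
  by (auto simp: free_module_def)

context plain_module
begin

lemma syz_chain_res_basis:
  "syz_chain R \<in> res_basis R M (Suc n) \<rightarrow> res_kernel R M n (res_basis R M n)"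
  by (auto simp: res_kernel_def syz_chain_syz_gen[OF supp_free(1)])

lemma submodule_res_kernel:
  "submodule (res_kernel R M n (res_basis R M n)) R (free_module R UNIV)"
proof -
  let ?X = "res_basis R M n"
  let ?F = "free_module R (UNIV :: ('a, 'm) res_gen set)"
  interpret U: plain_module R ?F by (intro plain_module.intro free_module_is_module) (rule R.is_cring)
  interpret F: plain_module R "free_module R ?X" by (intro plain_module.intro free_module_is_module) (rule R.is_cring)
  have ops: "zero ?F = zero (free_module R ?X)" "add ?F = add (free_module R ?X)"
      "smult ?F = smult (free_module R ?X)"
    by (simp_all add: free_module_def)
  have sub: "submodule {f \<in> carrier (free_module R ?X). \<phi> f = \<zero>\<^bsub>N\<^esub>} R ?F"
    if N: "module R N" and v: "v \<in> ?X \<rightarrow> carrier N" and \<phi>: "\<phi> = lin_ext R N v"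
    for \<phi> v and N :: "('a, 'z) module"
  proof -
    interpret N: plain_module R N using N by (rule plain_module.intro)
    show ?thesis
    proof (rule U.module_incl_imp_submodule)
      let ?K = "{f \<in> carrier (free_module R ?X). \<phi> f = \<zero>\<^bsub>N\<^esub>}"
      show "?K \<subseteq> carrier ?F" using free_module_subset[of ?X UNIV R] by auto
      have "submodule ?K R (free_module R ?X)"
      proof (rule F.submoduleI)
        show smult: "a \<odot>\<^bsub>free_module R ?X\<^esub> x \<in> ?K" if "a \<in> carrier R" "x \<in> ?K" for a x
          using that N.lin_ext_smult[OF that(1) _ v] by (auto simp: \<phi>)
        show "\<zero>\<^bsub>free_module R ?X\<^esub> \<in> ?K"
          using N.lin_ext_smult[of \<zero> "\<zero>\<^bsub>free_module R ?X\<^esub>", OF _ _ v]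
            N.lin_ext_closed[OF _ v] by (auto simp: \<phi>)
        show "\<ominus>\<^bsub>free_module R ?X\<^esub> x \<in> ?K" if "x \<in> ?K" for x
          using smult[of "\<ominus> \<one>" x] that F.smult_l_minus[of \<one> x] by auto
        show "a \<oplus>\<^bsub>free_module R ?X\<^esub> b \<in> ?K" if "a \<in> ?K" "b \<in> ?K" for a b
          using that N.lin_ext_add[OF _ _ v] by (auto simp: \<phi>)
      qed auto
      then have "module R ((free_module R ?X)\<lparr>carrier := ?K\<rparr>)"
        by (rule submodule.submodule_is_module) (rule F.module_axioms)
      then show "module R (?F\<lparr>carrier := ?K\<rparr>)" by (simp add: free_module_def)
    qed
  qed
  show ?thesis
  proof (cases n)
    case 0
    have "elt \<in> ?X \<rightarrow> carrier M" by (auto simp: 0)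
    from sub[OF module_axioms this refl] show ?thesis
      by (simp add: res_kernel_def res_augmentation_def 0)
  next
    case (Suc m)
    have "syz_chain R \<in> ?X \<rightarrow> carrier ?F"
      using syz_chain_res_basis[of m] free_module_subset[of "res_basis R M m" UNIV R]
      by (auto simp: Suc res_kernel_def Pi_def)
    from sub[OF U.module_axioms this refl] show ?thesis
      by (simp add: res_kernel_def res_boundary_def Suc free_module_def)
  qed
qed

text \<open>Exactness of the resolution.\<close>

theorem res_augmentation_image:
  "res_augmentation R M ` carrier (res_module R M 0) = carrier M"
proof -
  have v: "elt \<in> res_basis R M 0 \<rightarrow> carrier M" by auto
  show ?thesis
  proof (intro equalityI subsetI)
    fix y assume "y \<in> res_augmentation R M ` carrier (res_module R M 0)"
    then show "y \<in> carrier M"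
      using lin_ext_closed[OF _ v] by (auto simp: res_augmentation_def res_module_def simp del: res_basis.simps)
  next
    fix y assume y: "y \<in> carrier M"
    then have b: "Elt y \<in> res_basis R M 0" by simp
    note d = lin_ext_delta[OF b v]
    have "y = lin_ext R M elt (\<lambda>x :: ('a, 'm) res_gen. if x = Elt y then \<one> else \<zero>)"
      unfolding d(2) by simp
    then show "y \<in> res_augmentation R M ` carrier (res_module R M 0)"
      unfolding res_augmentation_def res_module_def by (rule image_eqI[OF _ d(1)])
  qed
qed

theorem res_boundary_image:
  "res_boundary R ` carrier (res_module R M (Suc n)) = res_kernel R M n (res_basis R M n)"
proof -
  let ?K = "res_kernel R M n (res_basis R M n)"
  let ?F = "free_module R (UNIV :: ('a, 'm) res_gen set)"
  interpret U: plain_module R ?F by (intro plain_module.intro free_module_is_module) (rule R.is_cring)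
  note K = submodule_res_kernel[of n]
  have v: "syz_chain R \<in> res_basis R M (Suc n) \<rightarrow> carrier ?F"
    using syz_chain_res_basis[of n] U.submoduleE(1)[OF K] by blast
  show ?thesis
  proof (intro equalityI subsetI)
    fix y assume "y \<in> res_boundary R ` carrier (res_module R M (Suc n))"
    then obtain f where f: "f \<in> carrier (free_module R (res_basis R M (Suc n)))"
      and y: "y = res_boundary R f" by (auto simp: res_module_def simp del: res_basis.simps)
    show "y \<in> ?K"
      unfolding y res_boundary_def lin_ext_def
    proof (rule U.submodule_finsum[OF K])
      show "finite {x. f x \<noteq> \<zero>}" by (rule supp_free(1)[OF f])
      fix x assume "x \<in> {x. f x \<noteq> \<zero>}"
      then have "x \<in> res_basis R M (Suc n)" using supp_free(2)[OF f] by (rule rev_subsetD)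
      then have "syz_chain R x \<in> ?K" by (rule funcset_mem[OF syz_chain_res_basis])
      then show "f x \<odot>\<^bsub>?F\<^esub> syz_chain R x \<in> ?K"
        by (rule U.submoduleE(4)[OF K supp_free(3)[OF f]])
    qed
  next
    fix y assume y: "y \<in> ?K"
    then have fin: "finite {x. y x \<noteq> \<zero>}" by (auto simp: res_kernel_def free_module_def)
    have b: "syz_gen R y \<in> res_basis R M (Suc n)" using y by simp
    note d = U.lin_ext_delta[OF b v]
    have "y = lin_ext R ?F (syz_chain R) (\<lambda>x. if x = syz_gen R y then \<one> else \<zero>)"
      unfolding d(2) syz_chain_syz_gen[OF fin] ..
    then show "y \<in> res_boundary R ` carrier (res_module R M (Suc n))"
      unfolding res_boundary_def res_module_def by (rule image_eqI[OF _ d(1)])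
  qed
qed

end

definition ext_cochains ::
  "('a, 'r) ring_scheme \<Rightarrow> ('a, 'm) module \<Rightarrow> ('a, 'n) module \<Rightarrow> nat
     \<Rightarrow> ('a, (('a, 'm) res_gen \<Rightarrow> 'a) \<Rightarrow> 'n) module" where
  "ext_cochains R M N n = hom_module R (res_module R M n) N"

definition ext_coboundary ::
  "('a, 'r) ring_scheme \<Rightarrow> ('a, 'm) module \<Rightarrow> nat
     \<Rightarrow> ((('a, 'm) res_gen \<Rightarrow> 'a) \<Rightarrow> 'n) \<Rightarrow> (('a, 'm) res_gen \<Rightarrow> 'a) \<Rightarrow> 'n" where
  "ext_coboundary R M n f = (\<lambda>c \<in> carrier (res_module R M (Suc n)). f (res_boundary R c))"

definition ext_cocycles ::
  "('a, 'r) ring_scheme \<Rightarrow> ('a, 'm) module \<Rightarrow> ('a, 'n) module \<Rightarrow> nat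
     \<Rightarrow> ((('a, 'm) res_gen \<Rightarrow> 'a) \<Rightarrow> 'n) set" where
  "ext_cocycles R M N n = {f \<in> carrier (ext_cochains R M N n).
     ext_coboundary R M n f = \<zero>\<^bsub>ext_cochains R M N (Suc n)\<^esub>}"

primrec ext_coboundaries ::
  "('a, 'r) ring_scheme \<Rightarrow> ('a, 'm) module \<Rightarrow> ('a, 'n) module \<Rightarrow> nat
     \<Rightarrow> ((('a, 'm) res_gen \<Rightarrow> 'a) \<Rightarrow> 'n) set" where
  "ext_coboundaries R M N 0 = {\<zero>\<^bsub>ext_cochains R M N 0\<^esub>}"
| "ext_coboundaries R M N (Suc n) = ext_coboundary R M n ` carrier (ext_cochains R M N n)"

definition Ext ::
  "('a, 'r) ring_scheme \<Rightarrow> nat \<Rightarrow> ('a, 'm) module \<Rightarrow> ('a, 'n) module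
     \<Rightarrow> ('a, ((('a, 'm) res_gen \<Rightarrow> 'a) \<Rightarrow> 'n) set) module" where
  "Ext R n M N = quotient_module ((ext_cochains R M N n)\<lparr>carrier := ext_cocycles R M N n\<rparr>)
     (ext_coboundaries R M N n)"


section \<open>Semidualizing and quasidualizing modules\<close>

definition semidualizing :: "('a, 'r) ring_scheme \<Rightarrow> ('a, 'c) module \<Rightarrow> bool" where
  "semidualizing R C \<longleftrightarrow> module R C \<and> finitely_generated R C \<and>
     homothety R (smult C) C \<in> module_iso R (regular_module R) (hom_module R C C) \<and>
     (\<forall>i > 0. carrier (Ext R i C C) = {\<zero>\<^bsub>Ext R i C C\<^esub>})"

definition quasidualizing :: "('a, 'r) ring_scheme \<Rightarrow> ('a, 't) module \<Rightarrow> bool" where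
  "quasidualizing R T \<longleftrightarrow> module R T \<and> artinian R T \<and>
     homothety (completion R) (completion_smult R T) T \<in>
       module_iso (completion R) (regular_module (completion R))
         (hom_module_via R T T (completion_smult R T)) \<and>
     (\<forall>i > 0. carrier (Ext R i T T) = {\<zero>\<^bsub>Ext R i T T\<^esub>})"

definition matlis_dual ::
  "('a, 'r) ring_scheme \<Rightarrow> ('a, 'e) module \<Rightarrow> ('a, 'm) module \<Rightarrow> ('a, 'm \<Rightarrow> 'e) module" where
  "matlis_dual R E M = hom_module R M E"


section \<open>Isomorphism classes\<close>

text \<open>Isomorphism classes are taken among the modules on a fixed type \<open>'u\<close>; the module \<open>M\<close>
  itself may live on another type.  The type \<^typ>\<open>(nat \<Rightarrow> 'a) set\<close> carries a copy of every
  finitely generated module (as a quotient of some \<open>R\<^sup>n\<close>), and if \<open>E\<close> lives on \<open>'e\<close>, the type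
  \<^typ>\<open>nat \<Rightarrow> 'e\<close> carries a copy of every artinian module (as a submodule of some \<open>E\<^sup>n\<close>).\<close>

definition iso_class :: "('a, 'r) ring_scheme \<Rightarrow> ('a, 'm) module \<Rightarrow> ('a, 'u) module set" where
  "iso_class R M = {N. module R N \<and> module_isomorphic R M N}"

definition semidualizing_classes :: "('a, 'r) ring_scheme \<Rightarrow> ('a, 'u) module set set" where
  "semidualizing_classes R = {iso_class R C |C :: ('a, 'u) module. semidualizing R C}"

definition quasidualizing_classes :: "('a, 'r) ring_scheme \<Rightarrow> ('a, 'u) module set set" where
  "quasidualizing_classes R = {iso_class R T |T :: ('a, 'u) module. quasidualizing R T}"

text \<open>The class of the Matlis duals of the members of an isomorphism class.\<close>

definition matlis_class :: "('a, 'r) ring_scheme \<Rightarrow> ('a, 'e) module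
     \<Rightarrow> ('a, 'u) module set \<Rightarrow> ('a, 'v) module set" where
  "matlis_class R E X = (\<Union>M \<in> X. iso_class R (matlis_dual R E M))"

end

(* Over a complete local ring Hom(E, E) = R: an endomorphism of E is a scalar on each m^n-torsion part,
   by induction on n, and the scalars converge.  Together with injectivity of E this gives that finitely
   generated modules have artinian duals, artinian modules have finitely generated duals, and both kinds
   are reflexive.  Reflexivity transports the homothety condition from M to its dual.  For Ext, the groups
   Ext^i(M, Hom(N, E)) and Ext^i(N, Hom(M, E)) are both dual to Tor_i(M, N); working with bilinear maps on
   free resolutions instead of tensor products, dimension shifting shows that they vanish together.
   Taking N to be the dual of a reflexive M turns Ext^i(M, M) = 0 into Ext^i(N, N) = 0. *)

theory Submission
  imports Defs
begin

section \<open>Linear maps\<close>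

text \<open>One lemma, \<open>joint_kernel\<close>, carries the duality: a functional into
  \<open>E\<close> that vanishes on the common kernel of finitely many others is a combination of
  them, provided endomorphisms of \<open>E\<close> act as scalars on the values that occur. Before
  Hom(E, E) = R is known, the values are kept in the socle, where this is clear; afterwards it holds
  everywhere. Multiplications by generators of m^n give the scalar correction in each induction
  step, evaluations at generators give reflexivity of finitely generated modules, and a finite
  separating family of functionals generates the dual of an artinian module. The obstacle on the Ext
  side is that \<open>Ext\<close> is tied to one canonical resolution, built from the elements of
  its first argument. Once vanishing is restated as extendability of maps from syzygies, bilinear
  maps into \<open>E\<close> replace the dual of a tensor product, and freeness of one factor
  together with injectivity of \<open>E\<close> replaces exactness. The same symmetry yields
  invariance under isomorphism in the first argument, so resolutions of isomorphic modules are never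
  compared.\<close>

text \<open>In contrast to \<open>module_hom\<close> nothing is fixed outside the carrier, so
  compositions, sums and lambda terms are linear as they stand; \<open>restrict_module_hom\<close>
  cuts a map down where an element of a Hom module is wanted.\<close>

definition linear_map ::
  "('a, 'r) ring_scheme \<Rightarrow> ('a, 'm) module \<Rightarrow> ('a, 'n) module \<Rightarrow> ('m \<Rightarrow> 'n) \<Rightarrow> bool" where
  "linear_map R M N f \<longleftrightarrow> (\<forall>x \<in> carrier M. f x \<in> carrier N) \<and>
     (\<forall>x \<in> carrier M. \<forall>y \<in> carrier M. f (x \<oplus>\<^bsub>M\<^esub> y) = f x \<oplus>\<^bsub>N\<^esub> f y) \<and>
     (\<forall>r \<in> carrier R. \<forall>x \<in> carrier M. f (r \<odot>\<^bsub>M\<^esub> x) = r \<odot>\<^bsub>N\<^esub> f x)"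

lemma linear_mapI:
  assumes "\<And>x. x \<in> carrier M \<Longrightarrow> f x \<in> carrier N"
    and "\<And>x y. x \<in> carrier M \<Longrightarrow> y \<in> carrier M \<Longrightarrow> f (x \<oplus>\<^bsub>M\<^esub> y) = f x \<oplus>\<^bsub>N\<^esub> f y"
    and "\<And>r x. r \<in> carrier R \<Longrightarrow> x \<in> carrier M \<Longrightarrow> f (r \<odot>\<^bsub>M\<^esub> x) = r \<odot>\<^bsub>N\<^esub> f x"
  shows "linear_map R M N f"
  using assms by (simp add: linear_map_def)

lemma linear_mapD:
  assumes "linear_map R M N f"
  shows "\<And>x. x \<in> carrier M \<Longrightarrow> f x \<in> carrier N"
    and "\<And>x y. x \<in> carrier M \<Longrightarrow> y \<in> carrier M \<Longrightarrow> f (x \<oplus>\<^bsub>M\<^esub> y) = f x \<oplus>\<^bsub>N\<^esub> f y"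
    and "\<And>r x. r \<in> carrier R \<Longrightarrow> x \<in> carrier M \<Longrightarrow> f (r \<odot>\<^bsub>M\<^esub> x) = r \<odot>\<^bsub>N\<^esub> f x"
  using assms by (simp_all add: linear_map_def)

lemma module_hom_iff:
  "f \<in> module_hom R M N \<longleftrightarrow> linear_map R M N f \<and> f \<in> extensional (carrier M)"
  by (auto simp: module_hom_def linear_map_def PiE_iff)

lemma linear_map_cong:
  assumes "module R M" "\<And>x. x \<in> carrier M \<Longrightarrow> f x = g x"
  shows "linear_map R M N f \<longleftrightarrow> linear_map R M N g"
proof -
  interpret M: module R M by fact
  show ?thesis using assms(2) by (simp add: linear_map_def)
qed

lemma restrict_module_hom:
  assumes "module R M" "linear_map R M N f"
  shows "restrict f (carrier M) \<in> module_hom R M N"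
  using linear_map_cong[OF assms(1), of "restrict f (carrier M)" f] assms(2)
  by (simp add: module_hom_iff)

lemma linear_map_zero:
  assumes "module R M" "module R N" "linear_map R M N f"
  shows "f \<zero>\<^bsub>M\<^esub> = \<zero>\<^bsub>N\<^esub>"
proof -
  interpret M: module R M by fact
  interpret N: module R N by fact
  have "f (\<zero>\<^bsub>R\<^esub> \<odot>\<^bsub>M\<^esub> \<zero>\<^bsub>M\<^esub>) = \<zero>\<^bsub>R\<^esub> \<odot>\<^bsub>N\<^esub> f \<zero>\<^bsub>M\<^esub>"
    using linear_mapD(3)[OF assms(3)] by blast
  then show ?thesis using linear_mapD(1)[OF assms(3)] by simp
qed

lemma linear_map_uminus:
  assumes "module R M" "module R N" "linear_map R M N f" "x \<in> carrier M"
  shows "f (\<ominus>\<^bsub>M\<^esub> x) = \<ominus>\<^bsub>N\<^esub> f x"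
proof -
  interpret M: module R M by fact
  interpret N: module R N by fact
  have "f ((\<ominus>\<^bsub>R\<^esub> \<one>\<^bsub>R\<^esub>) \<odot>\<^bsub>M\<^esub> x) = (\<ominus>\<^bsub>R\<^esub> \<one>\<^bsub>R\<^esub>) \<odot>\<^bsub>N\<^esub> f x"
    using linear_mapD(3)[OF assms(3)] assms(4) by blast
  then show ?thesis
    using linear_mapD(1)[OF assms(3)] assms(4) by (simp add: M.smult_l_minus N.smult_l_minus)
qed

lemma linear_map_minus:
  assumes "module R M" "module R N" "linear_map R M N f" "x \<in> carrier M" "y \<in> carrier M"
  shows "f (x \<ominus>\<^bsub>M\<^esub> y) = f x \<ominus>\<^bsub>N\<^esub> f y"
proof -
  interpret M: module R M by fact
  interpret N: module R N by fact
  show ?thesis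
    using linear_mapD(2)[OF assms(3)] linear_map_uminus[OF assms(1-3)] assms(4,5)
    by (simp add: M.minus_eq N.minus_eq)
qed

lemma linear_map_comp:
  assumes "linear_map R M N f" "linear_map R N L g"
  shows "linear_map R M L (\<lambda>x. g (f x))"
  using assms by (simp add: linear_map_def)

lemma linear_map_add:
  assumes "module R N" "linear_map R M N f" "linear_map R M N g"
  shows "linear_map R M N (\<lambda>x. f x \<oplus>\<^bsub>N\<^esub> g x)"
proof -
  interpret N: module R N by fact
  show ?thesis using assms(2,3) by (auto simp: linear_map_def N.a_ac N.smult_r_distr)
qed

lemma linear_map_smult:
  assumes "module R N" "linear_map R M N f" "r \<in> carrier R"
  shows "linear_map R M N (\<lambda>x. r \<odot>\<^bsub>N\<^esub> f x)"
proof -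
  interpret N: module R N by fact
  show ?thesis using assms(2,3)
    by (auto simp: linear_map_def N.smult_r_distr N.smult_assoc1[symmetric] N.R.m_comm)
qed

lemma linear_map_diff:
  assumes "module R M" "module R N" "linear_map R M N f" "linear_map R M N g"
  shows "linear_map R M N (\<lambda>x. f x \<ominus>\<^bsub>N\<^esub> g x)"
proof -
  interpret M: module R M by fact
  interpret N: module R N by fact
  have "linear_map R M N (\<lambda>x. f x \<oplus>\<^bsub>N\<^esub> (\<ominus>\<^bsub>R\<^esub> \<one>\<^bsub>R\<^esub>) \<odot>\<^bsub>N\<^esub> g x)"
    by (intro linear_map_add linear_map_smult assms) simp
  then show ?thesis
    by (subst (asm) linear_map_cong[OF assms(1), of _ "\<lambda>x. f x \<ominus>\<^bsub>N\<^esub> g x"])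
      (use linear_mapD(1)[OF assms(4)] in \<open>simp_all add: N.minus_eq N.smult_l_minus\<close>)
qed

lemma linear_map_null:
  assumes "module R N"
  shows "linear_map R M N (\<lambda>x. \<zero>\<^bsub>N\<^esub>)"
proof -
  interpret N: module R N by fact
  show ?thesis by (simp add: linear_map_def)
qed

lemma linear_map_id: "linear_map R M M (\<lambda>x. x)"
  by (simp add: linear_map_def)

lemma linear_map_homothety:
  assumes "module R M" "r \<in> carrier R"
  shows "linear_map R M M (\<lambda>x. r \<odot>\<^bsub>M\<^esub> x)"
  using linear_map_smult[OF assms(1) linear_map_id assms(2)] .

lemma linear_map_restrict:
  assumes "linear_map R M N f" "Z \<subseteq> carrier M"
  shows "linear_map R (M\<lparr>carrier := Z\<rparr>) N f"
  using assms by (auto simp: linear_map_def subset_iff)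

lemma linear_map_corestrict:
  assumes "linear_map R M N f" "f ` carrier M \<subseteq> Z"
  shows "linear_map R M (N\<lparr>carrier := Z\<rparr>) f"
  using assms by (auto simp: linear_map_def subset_iff)

section \<open>Submodules, images and kernels\<close>

lemma submodule_module:
  assumes "module R M" "submodule Z R M"
  shows "module R (M\<lparr>carrier := Z\<rparr>)"
  using submodule.submodule_is_module[OF assms(2,1)] .

lemma submodule_zero:
  assumes "submodule Z R M" shows "\<zero>\<^bsub>M\<^esub> \<in> Z"
  using subgroup.one_closed[OF submodule.axioms(1)[OF assms]] by simp

lemma submoduleI_smult:
  assumes "module R M" "Z \<subseteq> carrier M" "\<zero>\<^bsub>M\<^esub> \<in> Z"
    "\<And>x y. x \<in> Z \<Longrightarrow> y \<in> Z \<Longrightarrow> x \<oplus>\<^bsub>M\<^esub> y \<in> Z"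
    "\<And>r x. r \<in> carrier R \<Longrightarrow> x \<in> Z \<Longrightarrow> r \<odot>\<^bsub>M\<^esub> x \<in> Z"
  shows "submodule Z R M"
proof -
  interpret M: module R M by fact
  have "\<ominus>\<^bsub>M\<^esub> x \<in> Z" if "x \<in> Z" for x
  proof -
    have "x \<in> carrier M" using that assms(2) by blast
    then show ?thesis using assms(5)[of "\<ominus>\<^bsub>R\<^esub> \<one>\<^bsub>R\<^esub>" x] that by (simp add: M.smult_l_minus)
  qed
  then show ?thesis by (intro M.submoduleI) (use assms in auto)
qed

lemma submodule_Int:
  assumes "module R M" "submodule A R M" "submodule B R M"
  shows "submodule (A \<inter> B) R M"
proof -
  interpret M: module R M by fact
  show ?thesis
    using M.submoduleE[OF assms(2)] M.submoduleE[OF assms(3)]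
      submodule_zero[OF assms(2)] submodule_zero[OF assms(3)]
    by (intro submoduleI_smult assms) auto
qed

lemma submodule_image:
  assumes "module R M" "module R N" "linear_map R M N f" "submodule A R M"
  shows "submodule (f ` A) R N"
proof -
  interpret M: module R M by fact
  note A = M.submoduleE[OF assms(4)] submodule_zero[OF assms(4)]
  note f = linear_mapD[OF assms(3)]
  show ?thesis
  proof (rule submoduleI_smult[OF assms(2)])
    show "f ` A \<subseteq> carrier N" using A(1) f(1) by auto
    show "\<zero>\<^bsub>N\<^esub> \<in> f ` A" using A(7) linear_map_zero[OF assms(1-3)] by (metis imageI)
    show "x \<oplus>\<^bsub>N\<^esub> y \<in> f ` A" if xy: "x \<in> f ` A" "y \<in> f ` A" for x y
    proof -
      obtain u v where uv: "u \<in> A" "v \<in> A" "x = f u" "y = f v" using xy by blast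
      then have "x \<oplus>\<^bsub>N\<^esub> y = f (u \<oplus>\<^bsub>M\<^esub> v)" using f(2) A(1) by (simp add: subset_iff)
      then show ?thesis using A(5)[OF uv(1,2)] by blast
    qed
    show "r \<odot>\<^bsub>N\<^esub> x \<in> f ` A" if rx: "r \<in> carrier R" "x \<in> f ` A" for r x
    proof -
      obtain u where u: "u \<in> A" "x = f u" using rx by blast
      then have "r \<odot>\<^bsub>N\<^esub> x = f (r \<odot>\<^bsub>M\<^esub> u)" using f(3) A(1) rx by (simp add: subset_iff)
      then show ?thesis using A(4)[OF rx(1) u(1)] by blast
    qed
  qed
qed

lemma submodule_vimage:
  assumes "module R M" "module R N" "linear_map R M N f" "submodule A R N"
  shows "submodule {x \<in> carrier M. f x \<in> A} R M"
proof -
  interpret M: module R M by fact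
  interpret N: module R N by fact
  show ?thesis
    using N.submoduleE[OF assms(4)] submodule_zero[OF assms(4)] linear_mapD[OF assms(3)]
      linear_map_zero[OF assms(1-3)]
    by (intro submoduleI_smult assms) auto
qed

lemma submodule_null:
  assumes "module R M" shows "submodule {\<zero>\<^bsub>M\<^esub>} R M"
proof -
  interpret M: module R M by fact
  show ?thesis by (intro submoduleI_smult assms) auto
qed

lemma submodule_kernel:
  assumes "module R M" "module R N" "linear_map R M N f"
  shows "submodule {x \<in> carrier M. f x = \<zero>\<^bsub>N\<^esub>} R M"
  using submodule_vimage[OF assms submodule_null[OF assms(2)]] by simp

lemma hom_module_simps [simp]:
  "carrier (hom_module R M N) = module_hom R M N"
  "\<zero>\<^bsub>hom_module R M N\<^esub> = (\<lambda>x \<in> carrier M. \<zero>\<^bsub>N\<^esub>)"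
  "f \<oplus>\<^bsub>hom_module R M N\<^esub> g = (\<lambda>x \<in> carrier M. f x \<oplus>\<^bsub>N\<^esub> g x)"
  "r \<odot>\<^bsub>hom_module R M N\<^esub> f = (\<lambda>x \<in> carrier M. r \<odot>\<^bsub>N\<^esub> f x)"
  by (simp_all add: hom_module_def hom_module_via_def)

lemma module_homD:
  assumes "f \<in> module_hom R M N"
  shows "linear_map R M N f" "f \<in> extensional (carrier M)"
  using assms by (simp_all add: module_hom_iff)

lemma module_hom_eqI:
  assumes "f \<in> module_hom R M N" "g \<in> module_hom R M N'" "\<And>x. x \<in> carrier M \<Longrightarrow> f x = g x"
  shows "f = g"
  using assms extensionalityI[of f "carrier M" g] by (simp add: module_hom_iff)

lemma linear_map_eval:
  assumes "x \<in> carrier M"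
  shows "linear_map R (hom_module R M N) N (\<lambda>f. f x)"
  using assms by (auto simp: linear_map_def module_hom_iff)

section \<open>Maps into an injective module\<close>

lemma injective_moduleD: "injective_module R E \<Longrightarrow> module R E"
  by (simp add: injective_module_def)

text \<open>A submodule of \<open>B \<times> E\<close> that is the graph of a partial map is contained in the graph of a
  total one; this packages extension along submodules and factorization through images.\<close>

lemma injective_module_relation:
  assumes E: "injective_module R E" and B: "module R B"
    and G: "\<And>x y. (x, y) \<in> G \<Longrightarrow> x \<in> carrier B \<and> y \<in> carrier E"
    and ne: "G \<noteq> {}"
    and add: "\<And>x y x' y'. (x, y) \<in> G \<Longrightarrow> (x', y') \<in> G \<Longrightarrow> (x \<oplus>\<^bsub>B\<^esub> x', y \<oplus>\<^bsub>E\<^esub> y') \<in> G"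
    and smult: "\<And>r x y. r \<in> carrier R \<Longrightarrow> (x, y) \<in> G \<Longrightarrow> (r \<odot>\<^bsub>B\<^esub> x, r \<odot>\<^bsub>E\<^esub> y) \<in> G"
    and zero: "\<And>y. (\<zero>\<^bsub>B\<^esub>, y) \<in> G \<Longrightarrow> y = \<zero>\<^bsub>E\<^esub>"
  obtains h where "h \<in> module_hom R B E" "\<And>x y. (x, y) \<in> G \<Longrightarrow> h x = y"
proof -
  interpret B: module R B by fact
  interpret E: module R E using E by (rule injective_moduleD)
  have uniq: "y = y'" if xy: "(x, y) \<in> G" "(x, y') \<in> G" for x y y'
  proof -
    note c = G[OF xy(1)] G[OF xy(2)]
    have "(\<ominus>\<^bsub>B\<^esub> x, \<ominus>\<^bsub>E\<^esub> y') \<in> G"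
      using smult[OF _ xy(2), of "\<ominus>\<^bsub>R\<^esub> \<one>\<^bsub>R\<^esub>"] c by (simp add: B.smult_l_minus E.smult_l_minus)
    from add[OF xy(1) this] have "y \<oplus>\<^bsub>E\<^esub> \<ominus>\<^bsub>E\<^esub> y' = \<zero>\<^bsub>E\<^esub>"
      using c by (intro zero) (simp add: B.M.r_neg)
    then show ?thesis using c E.minus_equality[of y "\<ominus>\<^bsub>E\<^esub> y'"] by simp
  qed
  define f where "f = (\<lambda>x \<in> Domain G. THE y. (x, y) \<in> G)"
  have f: "f x = y" if "(x, y) \<in> G" for x y
  proof -
    have "(THE y. (x, y) \<in> G) = y" by (rule the_equality) (use that uniq in blast)+
    then show ?thesis using DomainI[OF that] by (simp add: f_def)
  qed
  obtain x0 y0 where x0: "(x0, y0) \<in> G" using ne by auto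
  have z: "(\<zero>\<^bsub>B\<^esub>, \<zero>\<^bsub>E\<^esub>) \<in> G" using smult[OF B.R.zero_closed x0] G[OF x0] by simp
  have sub: "submodule (Domain G) R B"
  proof (rule submoduleI_smult[OF B])
    show "Domain G \<subseteq> carrier B" using G by auto
    show "\<zero>\<^bsub>B\<^esub> \<in> Domain G" using z by auto
  qed (use add smult in blast)+
  have "f \<in> module_hom R (B\<lparr>carrier := Domain G\<rparr>) E"
    unfolding module_hom_iff
  proof (intro conjI linear_mapI)
    show "f \<in> extensional (carrier (B\<lparr>carrier := Domain G\<rparr>))" by (simp add: f_def)
    fix x assume "x \<in> carrier (B\<lparr>carrier := Domain G\<rparr>)"
    then obtain y where xy: "(x, y) \<in> G" by auto
    show "f x \<in> carrier E" using f[OF xy] G[OF xy] by simp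
    show "f (r \<odot>\<^bsub>B\<lparr>carrier := Domain G\<rparr>\<^esub> x) = r \<odot>\<^bsub>E\<^esub> f x" if "r \<in> carrier R" for r
      using f[OF xy] f[OF smult[OF that xy]] by simp
    fix x' assume "x' \<in> carrier (B\<lparr>carrier := Domain G\<rparr>)"
    then obtain y' where xy': "(x', y') \<in> G" by auto
    show "f (x \<oplus>\<^bsub>B\<lparr>carrier := Domain G\<rparr>\<^esub> x') = f x \<oplus>\<^bsub>E\<^esub> f x'"
      using f[OF xy] f[OF xy'] f[OF add[OF xy xy']] by simp
  qed
  from injective_module_extension[OF E B sub this] f show ?thesis
    by (metis DomainI that)
qed

text \<open>The pairs (\<open>\<phi> x\<close>, \<open>\<psi> x\<close>) over \<open>X\<close> form
  a single-valued relation because of \<open>ker\<close>. Descending \<open>\<psi>\<close> to the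
  image of \<open>\<phi>\<close> and extending it to \<open>N\<close> are thus one application of
  injectivity.\<close>

lemma injective_factor:
  assumes E: "injective_module R E" and M: "module R M" and N: "module R N"
    and X: "submodule X R M"
    and \<phi>: "linear_map R M N \<phi>" and \<psi>: "linear_map R (M\<lparr>carrier := X\<rparr>) E \<psi>"
    and ker: "\<And>x. x \<in> X \<Longrightarrow> \<phi> x = \<zero>\<^bsub>N\<^esub> \<Longrightarrow> \<psi> x = \<zero>\<^bsub>E\<^esub>"
  obtains h where "h \<in> module_hom R N E" "\<And>x. x \<in> X \<Longrightarrow> h (\<phi> x) = \<psi> x"
proof -
  interpret M: module R M by fact
  note Xs = M.submoduleE[OF X]
  note f = linear_mapD[OF \<phi>] and g = linear_mapD[OF \<psi>, simplified]
  let ?G = "(\<lambda>x. (\<phi> x, \<psi> x)) ` X"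
  show thesis
  proof (rule injective_module_relation[OF E N, of ?G])
    show "x \<in> carrier N \<and> y \<in> carrier E" if "(x, y) \<in> ?G" for x y
      using that Xs(1) f(1) g(1) by auto
    show "?G \<noteq> {}" using Xs(2) by simp
    show "(x \<oplus>\<^bsub>N\<^esub> x', y \<oplus>\<^bsub>E\<^esub> y') \<in> ?G" if xy: "(x, y) \<in> ?G" "(x', y') \<in> ?G" for x y x' y'
    proof -
      obtain u v where uv: "u \<in> X" "v \<in> X" "x = \<phi> u" "y = \<psi> u" "x' = \<phi> v" "y' = \<psi> v"
        using xy by blast
      then have "(x \<oplus>\<^bsub>N\<^esub> x', y \<oplus>\<^bsub>E\<^esub> y') = (\<phi> (u \<oplus>\<^bsub>M\<^esub> v), \<psi> (u \<oplus>\<^bsub>M\<^esub> v))"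
        using f(2) g(2) Xs(1) by (simp add: subset_iff)
      then show ?thesis using Xs(5)[OF uv(1,2)] by blast
    qed
    show "(r \<odot>\<^bsub>N\<^esub> x, r \<odot>\<^bsub>E\<^esub> y) \<in> ?G" if rx: "r \<in> carrier R" "(x, y) \<in> ?G" for r x y
    proof -
      obtain u where u: "u \<in> X" "x = \<phi> u" "y = \<psi> u" using rx by blast
      then have "(r \<odot>\<^bsub>N\<^esub> x, r \<odot>\<^bsub>E\<^esub> y) = (\<phi> (r \<odot>\<^bsub>M\<^esub> u), \<psi> (r \<odot>\<^bsub>M\<^esub> u))"
        using f(3) g(3) Xs(1) rx(1) by (simp add: subset_iff)
      then show ?thesis using Xs(4)[OF rx(1) u(1)] by blast
    qed
    show "y = \<zero>\<^bsub>E\<^esub>" if "(\<zero>\<^bsub>N\<^esub>, y) \<in> ?G" for y using that ker by auto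
  qed (use that in blast)
qed

lemma injective_extend:
  assumes "injective_module R E" "module R M" "submodule X R M"
    "linear_map R (M\<lparr>carrier := X\<rparr>) E \<psi>"
  obtains h where "h \<in> module_hom R M E" "\<And>x. x \<in> X \<Longrightarrow> h x = \<psi> x"
proof -
  have m: "module R (M\<lparr>carrier := X\<rparr>)" by (rule submodule_module[OF assms(2,3)])
  have "\<psi> x = \<zero>\<^bsub>E\<^esub>" if "x = \<zero>\<^bsub>M\<^esub>" for x
    using linear_map_zero[OF m injective_moduleD[OF assms(1)] assms(4)] that by simp
  from injective_factor[OF assms(1,2,2,3) linear_map_id assms(4) this] that show thesis by blast
qed

text \<open>The closure form of the fact that a functional vanishing on the common kernel of finitely many
  functionals is a combination of them; \<open>P\<close> plays the role of the span.\<close>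

lemma joint_kernel:
  assumes E: "injective_module R E" and M: "module R M" and X: "submodule X R M"
    and fin: "finite \<Phi>" and \<Phi>: "\<And>\<phi>. \<phi> \<in> \<Phi> \<Longrightarrow> linear_map R M E \<phi>"
    and \<psi>: "linear_map R M E \<psi>"
    and ker: "\<And>x. x \<in> X \<Longrightarrow> (\<And>\<phi>. \<phi> \<in> \<Phi> \<Longrightarrow> \<phi> x = \<zero>\<^bsub>E\<^esub>) \<Longrightarrow> \<psi> x = \<zero>\<^bsub>E\<^esub>"
    and endo: "\<And>\<phi> h. \<phi> \<in> \<Phi> \<Longrightarrow> h \<in> module_hom R E E \<Longrightarrow>
       \<exists>r \<in> carrier R. \<forall>x \<in> X. h (\<phi> x) = r \<odot>\<^bsub>E\<^esub> \<phi> x"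
    and P0: "P (\<lambda>x. \<zero>\<^bsub>E\<^esub>)"
    and Padd: "\<And>f \<phi> r. P f \<Longrightarrow> \<phi> \<in> \<Phi> \<Longrightarrow> r \<in> carrier R \<Longrightarrow> P (\<lambda>x. f x \<oplus>\<^bsub>E\<^esub> r \<odot>\<^bsub>E\<^esub> \<phi> x)"
    and Plin: "\<And>f. P f \<Longrightarrow> linear_map R M E f"
  shows "\<exists>f. P f \<and> (\<forall>x \<in> X. \<psi> x = f x)"
  using fin \<Phi> X ker endo Padd
proof (induction \<Phi> arbitrary: X)
  case empty
  then show ?case using P0 by auto
next
  case (insert \<phi> \<Phi>)
  interpret M: module R M by fact
  interpret E: module R E using E by (rule injective_moduleD)
  note sX = M.submoduleE(1)[OF insert.prems(2)]
  have \<phi>: "linear_map R M E \<phi>" using insert.prems(1) by simp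
  \<comment> \<open>\<open>X\<close> varies in the induction: on the part killed by
    \<open>\<phi>\<close> the remaining functionals still control \<open>\<psi>\<close>, so the
    induction hypothesis provides a combination \<open>f\<close> equal to \<open>\<psi>\<close>
    there.\<close>
  define Y where "Y = X \<inter> {x \<in> carrier M. \<phi> x = \<zero>\<^bsub>E\<^esub>}"
  have Y: "submodule Y R M"
    unfolding Y_def by (intro submodule_Int M insert.prems submodule_kernel[OF M _ \<phi>]) (rule E.module_axioms)
  have "\<exists>f. P f \<and> (\<forall>x\<in>Y. \<psi> x = f x)"
  proof (rule insert.IH[OF _ Y])
    fix \<chi> h assume "\<chi> \<in> \<Phi>" "h \<in> module_hom R E E"
    then have "\<exists>r\<in>carrier R. \<forall>x\<in>X. h (\<chi> x) = r \<odot>\<^bsub>E\<^esub> \<chi> x" using insert.prems(4) by blast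
    then show "\<exists>r\<in>carrier R. \<forall>x\<in>Y. h (\<chi> x) = r \<odot>\<^bsub>E\<^esub> \<chi> x" by (auto simp: Y_def)
  next
    fix x assume "x \<in> Y" "\<And>\<phi>. \<phi> \<in> \<Phi> \<Longrightarrow> \<phi> x = \<zero>\<^bsub>E\<^esub>"
    then show "\<psi> x = \<zero>\<^bsub>E\<^esub>" by (intro insert.prems(3)) (auto simp: Y_def)
  qed (use insert.prems in auto)
  then obtain f where f: "P f" "\<And>x. x \<in> Y \<Longrightarrow> \<psi> x = f x" by blast
  have lin: "linear_map R M E (\<lambda>x. \<psi> x \<ominus>\<^bsub>E\<^esub> f x)"
    by (intro linear_map_diff M E.module_axioms \<psi> Plin f)
  note fc = linear_mapD(1)[OF Plin[OF f(1)]] and \<psi>c = linear_mapD(1)[OF \<psi>]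
    and \<phi>c = linear_mapD(1)[OF \<phi>]
  \<comment> \<open>The difference of \<open>\<psi>\<close> and \<open>f\<close> vanishes on
    \<open>X\<close> wherever \<open>\<phi>\<close> does, hence factors through
    \<open>\<phi>\<close>; \<open>endo\<close> then turns the factor \<open>h\<close> into a
    scalar.\<close>
  obtain h where h: "h \<in> module_hom R E E" "\<And>x. x \<in> X \<Longrightarrow> h (\<phi> x) = \<psi> x \<ominus>\<^bsub>E\<^esub> f x"
  proof (rule injective_factor[OF E M E.module_axioms insert.prems(2) \<phi> linear_map_restrict[OF lin sX]])
    fix x assume x: "x \<in> X" "\<phi> x = \<zero>\<^bsub>E\<^esub>"
    then have "\<psi> x = f x" using f(2) sX by (auto simp: Y_def)
    then show "\<psi> x \<ominus>\<^bsub>E\<^esub> f x = \<zero>\<^bsub>E\<^esub>" using x sX fc by (auto simp: E.minus_eq E.M.r_neg)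
  qed blast
  from insert.prems(4)[OF insertI1 h(1)]
  obtain r where r: "r \<in> carrier R" "\<And>x. x \<in> X \<Longrightarrow> h (\<phi> x) = r \<odot>\<^bsub>E\<^esub> \<phi> x" by blast
  have "\<psi> x = f x \<oplus>\<^bsub>E\<^esub> r \<odot>\<^bsub>E\<^esub> \<phi> x" if x: "x \<in> X" for x
  proof -
    have c: "x \<in> carrier M" using x sX by blast
    have "f x \<oplus>\<^bsub>E\<^esub> r \<odot>\<^bsub>E\<^esub> \<phi> x = \<psi> x \<oplus>\<^bsub>E\<^esub> (\<ominus>\<^bsub>E\<^esub> f x \<oplus>\<^bsub>E\<^esub> f x)"
      using h(2)[OF x] r(2)[OF x] fc[OF c] \<psi>c[OF c] by (simp add: E.minus_eq E.M.a_ac)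
    also have "\<dots> = \<psi> x"
      using fc[OF c] \<psi>c[OF c] by (simp add: E.M.l_neg)
    finally show ?thesis ..
  qed
  moreover have "P (\<lambda>x. f x \<oplus>\<^bsub>E\<^esub> r \<odot>\<^bsub>E\<^esub> \<phi> x)" by (rule insert.prems(5)[OF f(1) insertI1 r(1)])
  ultimately show ?case by blast
qed

section \<open>The injective hull of the residue field\<close>

text \<open>The hypotheses on \<open>R\<close> and \<open>E\<close> in elementwise form, where \<open>e0\<close> generates the socle of \<open>E\<close>.\<close>

locale matlis = cring R + noetherian_ring R
  for R :: "('a, 'r) ring_scheme" (structure) +
  fixes E :: "('a, 'e) module" and e0 :: 'e
  assumes injective: "injective_module R E"
    and max_ideal: "ideal (max_ideal R) R"
    and inverse: "r \<in> carrier R \<Longrightarrow> r \<notin> max_ideal R \<Longrightarrow> \<exists>s \<in> carrier R. s \<otimes> r = \<one>"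
    and one_notin: "\<one> \<notin> max_ideal R"
    and e0: "e0 \<in> carrier E" "e0 \<noteq> \<zero>\<^bsub>E\<^esub>"
    and max_e0: "a \<in> max_ideal R \<Longrightarrow> a \<odot>\<^bsub>E\<^esub> e0 = \<zero>\<^bsub>E\<^esub>"
    and essential: "x \<in> carrier E \<Longrightarrow> x \<noteq> \<zero>\<^bsub>E\<^esub> \<Longrightarrow> \<exists>r \<in> carrier R. r \<odot>\<^bsub>E\<^esub> x = e0"
    and limit: "\<And>r :: nat \<Rightarrow> 'a. (\<And>n. r n \<in> carrier R) \<Longrightarrow>
      (\<And>n. r (Suc n) \<ominus> r n \<in> ideal_power R (max_ideal R) n) \<Longrightarrow>
      \<exists>s \<in> carrier R. \<forall>n. s \<ominus> r n \<in> ideal_power R (max_ideal R) n"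
begin

sublocale E: module R E
  using injective by (rule injective_moduleD)

abbreviation mm :: "'a set" where "mm \<equiv> max_ideal R"

lemma mmD: "a \<in> mm \<Longrightarrow> a \<in> carrier R"
  using ideal.Icarr[OF max_ideal] .

lemma idealI_left:
  assumes "I \<subseteq> carrier R" "\<zero> \<in> I" "\<And>x y. x \<in> I \<Longrightarrow> y \<in> I \<Longrightarrow> x \<oplus> y \<in> I"
    "\<And>r x. r \<in> carrier R \<Longrightarrow> x \<in> I \<Longrightarrow> r \<otimes> x \<in> I"
  shows "ideal I R"
proof (rule idealI[OF ring_axioms])
  have "\<ominus> x \<in> I" if "x \<in> I" for x
    using assms(4)[of "\<ominus> \<one>" x] that assms(1) l_minus[of \<one> x] by auto
  then show "subgroup I (add_monoid R)"
    by (intro add.subgroupI) (use assms in auto)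
  show "x \<otimes> a \<in> I" if "a \<in> I" "x \<in> carrier R" for a x using assms(4) that by blast
  show "a \<otimes> x \<in> I" if "a \<in> I" "x \<in> carrier R" for a x
    using assms(1,4) that m_comm[of a x] by auto
qed

text \<open>The colon ideal (N : t), an annihilator when \<open>N\<close> is zero. Because it is an
  ideal, a condition checked on generators of an ideal holds on all of it by
  \<open>genideal_minimal\<close>.\<close>

lemma colon_ideal:
  assumes "module R T" "submodule N R T" "t \<in> carrier T"
  shows "ideal {a \<in> carrier R. a \<odot>\<^bsub>T\<^esub> t \<in> N} R"
proof -
  interpret T: module R T by fact
  show ?thesis
    using T.submoduleE(4,5)[OF assms(2)] submodule_zero[OF assms(2)] assms(3)
    by (intro idealI_left) (auto simp: T.smult_l_distr T.smult_assoc1)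
qed

text \<open>A nonempty chain of ideals in a noetherian ring contains its own union, and the index of
  that member is where the sequence becomes constant.\<close>

lemma ideal_acc:
  assumes "\<And>n :: nat. ideal (I n) R" "\<And>n. I n \<subseteq> I (Suc n)"
  shows "\<exists>n. \<forall>k \<ge> n. I k = I n"
proof -
  have mono: "I i \<subseteq> I j" if "i \<le> j" for i j by (rule lift_Suc_mono_le[of I, OF assms(2) that])
  have "\<Union>(range I) \<in> range I"
  proof (rule ideal_chain_is_trivial)
    show "subset.chain {I. ideal I R} (range I)"
      unfolding subset_chain_def
    proof (intro conjI ballI)
      show "X \<subseteq> Y \<or> Y \<subseteq> X" if "X \<in> range I" "Y \<in> range I" for X Y
      proof -
        from that obtain i j where "X = I i" "Y = I j" by blast
        then show ?thesis using mono[of i j] mono[of j i] by (cases "i \<le> j") auto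
      qed
    qed (use assms(1) in auto)
  qed simp
  then obtain n where "\<Union>(range I) = I n" by auto
  then have "I k = I n" if "k \<ge> n" for k using mono[OF that] by blast
  then show ?thesis by blast
qed

lemma ideal_power_ideal: "ideal (ideal_power R mm n) R"
  by (induction n) (auto intro: oneideal ideal_prod_is_ideal max_ideal)

lemma ideal_power_carrier: "a \<in> ideal_power R mm n \<Longrightarrow> a \<in> carrier R"
  using ideal.Icarr[OF ideal_power_ideal] .

lemma ideal_power_Suc_subset: "ideal_power R mm (Suc n) \<subseteq> ideal_power R mm n"
  using ideal_prod_inter[OF max_ideal ideal_power_ideal[of n]] by simp

text \<open>The maximal ideal lies in the Jacobson radical: if
  \<open>\<one> \<ominus> r \<otimes> a\<close> were in \<open>mm\<close>, adding
  \<open>r \<otimes> a\<close> would put \<open>\<one>\<close> there. It supplies the step of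
  Nakayama type in \<open>nilpotent_artinian\<close>.\<close>

lemma one_minus_unit:
  assumes "a \<in> mm" "r \<in> carrier R"
  shows "\<exists>s \<in> carrier R. s \<otimes> (\<one> \<ominus> r \<otimes> a) = \<one>"
proof (rule inverse)
  note a = mmD[OF assms(1)]
  show "\<one> \<ominus> r \<otimes> a \<in> carrier R" using assms a by simp
  show "\<one> \<ominus> r \<otimes> a \<notin> mm"
  proof
    assume *: "\<one> \<ominus> r \<otimes> a \<in> mm"
    have "r \<otimes> a \<in> mm" using ideal.I_l_closed[OF max_ideal assms] .
    with * have "(\<one> \<ominus> r \<otimes> a) \<oplus> r \<otimes> a \<in> mm"
      using additive_subgroup.a_closed[OF ideal.axioms(1)[OF max_ideal]] by blast
    moreover have "(\<one> \<ominus> r \<otimes> a) \<oplus> r \<otimes> a = \<one>"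
      using assms a by (simp add: minus_eq a_assoc l_neg)
    ultimately show False using one_notin by simp
  qed
qed

section \<open>Torsion by powers of the maximal ideal\<close>

definition torsion :: "('a, 't) module \<Rightarrow> nat \<Rightarrow> 't set" where
  "torsion T n = {t \<in> carrier T. \<forall>a \<in> ideal_power R mm n. a \<odot>\<^bsub>T\<^esub> t = \<zero>\<^bsub>T\<^esub>}"

lemma torsion_Suc_subset: "torsion T n \<subseteq> torsion T (Suc n)"
  using ideal_power_Suc_subset[of n] by (auto simp: torsion_def)

lemma torsion_mono: "i \<le> j \<Longrightarrow> torsion T i \<subseteq> torsion T j"
  by (rule lift_Suc_mono_le[of "torsion T"]) (rule torsion_Suc_subset)

lemma torsion_submodule:
  assumes "module R T" shows "submodule (torsion T n) R T"
proof -
  interpret T: module R T by fact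
  show ?thesis
  proof (rule submoduleI_smult[OF assms])
    show "r \<odot>\<^bsub>T\<^esub> x \<in> torsion T n" if "r \<in> carrier R" "x \<in> torsion T n" for r x
    proof -
      have "a \<odot>\<^bsub>T\<^esub> (r \<odot>\<^bsub>T\<^esub> x) = r \<odot>\<^bsub>T\<^esub> (a \<odot>\<^bsub>T\<^esub> x)" if "a \<in> carrier R" for a
        using that \<open>r \<in> _\<close> \<open>x \<in> _\<close> by (simp add: torsion_def T.smult_assoc1[symmetric] m_comm)
      then show ?thesis using that ideal_power_carrier by (simp add: torsion_def)
    qed
  qed (auto simp: torsion_def T.smult_r_distr ideal_power_carrier)
qed

lemma torsion_SucI:
  assumes "module R T" "t \<in> carrier T" "\<And>a. a \<in> mm \<Longrightarrow> a \<odot>\<^bsub>T\<^esub> t \<in> torsion T n"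
  shows "t \<in> torsion T (Suc n)"
proof -
  interpret T: module R T by fact
  have "b \<odot>\<^bsub>T\<^esub> t = \<zero>\<^bsub>T\<^esub>" if "b \<in> ideal_prod R mm (ideal_power R mm n)" for b
    using that
  proof (induction rule: ideal_prod.induct)
    case (prod i j)
    note c = mmD[OF prod(1)] ideal_power_carrier[OF prod(2)]
    have "(i \<otimes> j) \<odot>\<^bsub>T\<^esub> t = j \<odot>\<^bsub>T\<^esub> (i \<odot>\<^bsub>T\<^esub> t)"
      using c assms(2) by (simp add: T.smult_assoc1[symmetric] m_comm)
    then show ?case using assms(3)[OF prod(1)] prod(2) by (auto simp: torsion_def)
  next
    case (sum s1 s2)
    have "s1 \<in> carrier R" "s2 \<in> carrier R"
      using sum(1,2) ideal_power_carrier[of _ "Suc n"] by simp_all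
    then show ?case using sum assms(2) by (simp add: T.smult_l_distr)
  qed
  then show ?thesis using assms(2) by (simp add: torsion_def)
qed

text \<open>Among finitely many generators of the maximal ideal, a non-torsion element can successively
  be replaced by multiples that are carried into the torsion part by more and more of them.\<close>

lemma torsion_exhausts:
  assumes T: "module R T"
    and nil: "\<And>a t. a \<in> mm \<Longrightarrow> t \<in> carrier T \<Longrightarrow> \<exists>n :: nat. (a [^] n) \<odot>\<^bsub>T\<^esub> t = \<zero>\<^bsub>T\<^esub>"
    and t: "t \<in> carrier T"
  shows "\<exists>n. t \<in> torsion T n"
proof (rule ccontr)
  interpret T: module R T by fact
  assume bad: "\<nexists>n. t \<in> torsion T n"
  define U where "U = (\<Union>n. torsion T n)"
  have U0: "\<zero>\<^bsub>T\<^esub> \<in> U"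
    using submodule_zero[OF torsion_submodule[OF T, of 0]] by (auto simp: U_def)
  have Us: "r \<odot>\<^bsub>T\<^esub> x \<in> U" if "r \<in> carrier R" "x \<in> U" for r x
    using that T.submoduleE(4)[OF torsion_submodule[OF T]] by (auto simp: U_def)
  obtain A where A: "A \<subseteq> carrier R" "finite A" "mm = Idl A"
    using finetely_gen[OF max_ideal] by blast
  have Amm: "A \<subseteq> mm" using genideal_self[OF A(1)] A(3) by simp
  have "\<exists>x \<in> carrier T. x \<notin> U \<and> (\<forall>a \<in> A. a \<odot>\<^bsub>T\<^esub> x \<in> U)"
    using A(2) Amm
  proof (induction A)
    case empty
    show ?case using t bad by (auto simp: U_def)
  next
    case (insert a A)
    then obtain x where x: "x \<in> carrier T" "x \<notin> U" "\<And>a. a \<in> A \<Longrightarrow> a \<odot>\<^bsub>T\<^esub> x \<in> U" by auto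
    have a: "a \<in> carrier R" using insert.prems mmD by blast
    obtain n :: nat where n: "(a [^] n) \<odot>\<^bsub>T\<^esub> x = \<zero>\<^bsub>T\<^esub>" using nil insert.prems x(1) by blast
    define k where "k = (LEAST n :: nat. (a [^] n) \<odot>\<^bsub>T\<^esub> x \<in> U)"
    have "(a [^] n) \<odot>\<^bsub>T\<^esub> x \<in> U" using n U0 by simp
    then have k: "(a [^] k) \<odot>\<^bsub>T\<^esub> x \<in> U" unfolding k_def by (rule LeastI[of "\<lambda>n. (a [^] n) \<odot>\<^bsub>T\<^esub> x \<in> U"])
    have "k \<noteq> 0" using k x by (intro notI) simp
    then obtain l where l: "k = Suc l" by (cases k) auto
    \<comment> \<open>The last multiple by a power of \<open>a\<close> that is still outside
      \<open>U\<close>: one more factor \<open>a\<close> moves it inside, and the earlier generators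
      still move it inside because scalars commute.\<close>
    define y where "y = (a [^] l) \<odot>\<^bsub>T\<^esub> x"
    have y: "y \<in> carrier T" using a x(1) by (simp add: y_def)
    have "l < k" by (simp add: l)
    then have yU: "y \<notin> U" unfolding y_def k_def by (rule not_less_Least)
    have "a \<odot>\<^bsub>T\<^esub> y \<in> U"
      using k a x(1) by (simp add: y_def l T.smult_assoc1[symmetric] m_comm)
    moreover have "b \<odot>\<^bsub>T\<^esub> y \<in> U" if "b \<in> A" for b
    proof -
      have "b \<in> carrier R" using that insert.prems mmD by blast
      then have "b \<odot>\<^bsub>T\<^esub> y = (a [^] l) \<odot>\<^bsub>T\<^esub> (b \<odot>\<^bsub>T\<^esub> x)"
        using a x(1) by (simp add: y_def T.smult_assoc1[symmetric] m_comm)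
      then show ?thesis using Us[OF _ x(3)[OF that]] a by simp
    qed
    ultimately show ?case using y yU by auto
  qed
  then obtain x where x: "x \<in> carrier T" "x \<notin> U" "\<And>a. a \<in> A \<Longrightarrow> a \<odot>\<^bsub>T\<^esub> x \<in> U" by blast
  have "\<forall>a \<in> A. \<exists>n. a \<odot>\<^bsub>T\<^esub> x \<in> torsion T n" using x(3) unfolding U_def by blast
  from bchoice[OF this] obtain f where f: "\<forall>a \<in> A. a \<odot>\<^bsub>T\<^esub> x \<in> torsion T (f a)" ..
  \<comment> \<open>Finitely many generators carry \<open>x\<close> into one common stage of the
    increasing torsion parts; the inserted 0 covers an empty \<open>A\<close>. The colon ideal then
    contains all of \<open>mm\<close>, so \<open>x\<close> is torsion after all, at stage n +
    1.\<close>
  define n where "n = Max (insert 0 (f ` A))"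
  have "a \<odot>\<^bsub>T\<^esub> x \<in> torsion T n" if "a \<in> A" for a
    using bspec[OF f that] torsion_mono[of "f a" n T] that A(2) by (auto simp: n_def)
  then have "Idl A \<subseteq> {a \<in> carrier R. a \<odot>\<^bsub>T\<^esub> x \<in> torsion T n}"
    by (intro genideal_minimal colon_ideal T torsion_submodule x(1)) (use A(1) in auto)
  then have "x \<in> torsion T (Suc n)"
    using A(3) by (intro torsion_SucI T x(1)) auto
  then show False using x(2) by (auto simp: U_def)
qed

text \<open>The annihilators of a^n x increase and become constant. If a^n x were still nonzero,
  some multiple r a^n x would be \<open>e0\<close>; then \<open>r\<close> annihilates a^(n+1) x,
  since \<open>a\<close> kills \<open>e0\<close>, but does not annihilate a^n x.\<close>

lemma nilpotent_E:
  assumes a: "a \<in> mm" and x: "x \<in> carrier E"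
  shows "\<exists>n :: nat. (a [^] n) \<odot>\<^bsub>E\<^esub> x = \<zero>\<^bsub>E\<^esub>"
proof -
  note ac = mmD[OF a]
  define I where "I n = {r \<in> carrier R. r \<odot>\<^bsub>E\<^esub> ((a [^] n) \<odot>\<^bsub>E\<^esub> x) \<in> {\<zero>\<^bsub>E\<^esub>}}" for n :: nat
  have step: "r \<odot>\<^bsub>E\<^esub> ((a [^] n \<otimes> a) \<odot>\<^bsub>E\<^esub> x) = a \<odot>\<^bsub>E\<^esub> (r \<odot>\<^bsub>E\<^esub> ((a [^] n) \<odot>\<^bsub>E\<^esub> x))"
    if "r \<in> carrier R" for r and n :: nat
    using that ac x by (simp add: E.smult_assoc1[symmetric] m_ac)
  have "\<exists>n. \<forall>k \<ge> n. I k = I n"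
  proof (rule ideal_acc)
    show "ideal (I n) R" for n
      unfolding I_def by (rule colon_ideal) (use ac x in \<open>auto intro: submodule_null E.module_axioms\<close>)
    show "I n \<subseteq> I (Suc n)" for n
      using ac by (auto simp: I_def step)
  qed
  then obtain n where n: "I (Suc n) = I n" by (meson le_SucI order_refl)
  have "(a [^] n) \<odot>\<^bsub>E\<^esub> x = \<zero>\<^bsub>E\<^esub>"
  proof (rule ccontr)
    assume "(a [^] n) \<odot>\<^bsub>E\<^esub> x \<noteq> \<zero>\<^bsub>E\<^esub>"
    with essential obtain r where r: "r \<in> carrier R" "r \<odot>\<^bsub>E\<^esub> ((a [^] n) \<odot>\<^bsub>E\<^esub> x) = e0"
      using ac x by (meson E.smult_closed nat_pow_closed)
    have "r \<in> I (Suc n)" using r max_e0[OF a] by (simp add: I_def step)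
    then have "r \<in> I n" using n by simp
    then show False using r e0 by (simp add: I_def)
  qed
  then show ?thesis by blast
qed

lemma torsion_E: "x \<in> carrier E \<Longrightarrow> \<exists>n. x \<in> torsion E n"
  using torsion_exhausts[OF E.module_axioms nilpotent_E] .

text \<open>The cyclic submodules R a^n t decrease and become constant, so a^n t = r a^(n+1) t. Thus
  1 - ra annihilates a^n t, and 1 - ra is a unit.\<close>

lemma nilpotent_artinian:
  assumes T: "module R T" "artinian R T" and a: "a \<in> mm" and t: "t \<in> carrier T"
  shows "\<exists>n :: nat. (a [^] n) \<odot>\<^bsub>T\<^esub> t = \<zero>\<^bsub>T\<^esub>"
proof -
  interpret T: module R T by fact
  note ac = mmD[OF a]
  define N where "N n = (\<lambda>r. r \<odot>\<^bsub>T\<^esub> ((a [^] n) \<odot>\<^bsub>T\<^esub> t)) ` carrier R" for n :: nat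
  have "submodule (N n) R T" for n
  proof (rule submoduleI_smult[OF T(1)])
    show "N n \<subseteq> carrier T" using ac t by (auto simp: N_def)
    show "\<zero>\<^bsub>T\<^esub> \<in> N n" unfolding N_def by (rule image_eqI[of _ _ \<zero>]) (use ac t in auto)
    show "x \<oplus>\<^bsub>T\<^esub> y \<in> N n" if "x \<in> N n" "y \<in> N n" for x y
      using that ac t by (auto simp: N_def T.smult_l_distr[symmetric])
    show "r \<odot>\<^bsub>T\<^esub> x \<in> N n" if "r \<in> carrier R" "x \<in> N n" for r x
    proof -
      from that obtain s where s: "s \<in> carrier R" "x = s \<odot>\<^bsub>T\<^esub> ((a [^] n) \<odot>\<^bsub>T\<^esub> t)"
        by (auto simp: N_def)
      show ?thesis unfolding N_def
        by (rule image_eqI[of _ _ "r \<otimes> s"]) (use that s ac t in \<open>auto simp: T.smult_assoc1\<close>)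
    qed
  qed
  moreover have "N (Suc n) \<subseteq> N n" for n
  proof
    fix x assume "x \<in> N (Suc n)"
    then obtain r where r: "r \<in> carrier R" "x = r \<odot>\<^bsub>T\<^esub> ((a [^] Suc n) \<odot>\<^bsub>T\<^esub> t)" by (auto simp: N_def)
    show "x \<in> N n" unfolding N_def
      by (rule image_eqI[of _ _ "r \<otimes> a"])
        (use r ac t in \<open>simp_all add: T.smult_assoc1[symmetric] m_ac\<close>)
  qed
  ultimately have "\<exists>n. \<forall>i \<ge> n. N i = N n" using T(2) by (simp add: artinian_def)
  then obtain n where "N (Suc n) = N n" by (meson le_SucI order_refl)
  moreover have "(a [^] n) \<odot>\<^bsub>T\<^esub> t \<in> N n"
    unfolding N_def by (rule image_eqI[of _ _ \<one>]) (use ac t in auto)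
  ultimately obtain r where r: "r \<in> carrier R"
    "(a [^] n) \<odot>\<^bsub>T\<^esub> t = r \<odot>\<^bsub>T\<^esub> ((a [^] Suc n) \<odot>\<^bsub>T\<^esub> t)" by (auto simp: N_def)
  define y where "y = (a [^] n) \<odot>\<^bsub>T\<^esub> t"
  have y: "y \<in> carrier T" using ac t by (simp add: y_def)
  have "r \<odot>\<^bsub>T\<^esub> ((a [^] Suc n) \<odot>\<^bsub>T\<^esub> t) = (r \<otimes> a) \<odot>\<^bsub>T\<^esub> y"
    using r(1) ac t by (simp add: y_def T.smult_assoc1[symmetric] m_ac)
  then have "y = (r \<otimes> a) \<odot>\<^bsub>T\<^esub> y" using r(2) by (simp only: y_def)
  then have "(\<one> \<ominus> r \<otimes> a) \<odot>\<^bsub>T\<^esub> y = \<zero>\<^bsub>T\<^esub>"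
    using r(1) ac y by (simp add: minus_eq T.smult_l_distr T.smult_l_minus T.M.r_neg)
  moreover obtain s where s: "s \<in> carrier R" "s \<otimes> (\<one> \<ominus> r \<otimes> a) = \<one>"
    using one_minus_unit[OF a r(1)] by blast
  moreover have "(s \<otimes> (\<one> \<ominus> r \<otimes> a)) \<odot>\<^bsub>T\<^esub> y = s \<odot>\<^bsub>T\<^esub> ((\<one> \<ominus> r \<otimes> a) \<odot>\<^bsub>T\<^esub> y)"
    using r(1) s(1) ac y by (intro T.smult_assoc1) auto
  ultimately have "(s \<otimes> (\<one> \<ominus> r \<otimes> a)) \<odot>\<^bsub>T\<^esub> y = \<zero>\<^bsub>T\<^esub>" using s(1) by simp
  then have "y = \<zero>\<^bsub>T\<^esub>" using s(2) y by simp
  then show ?thesis by (auto simp: y_def)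
qed

lemma torsion_artinian:
  assumes "module R T" "artinian R T" "t \<in> carrier T"
  shows "\<exists>n. t \<in> torsion T n"
  using torsion_exhausts[OF assms(1) nilpotent_artinian[OF assms(1,2)] assms(3)] .

section \<open>Separating functionals and the socle\<close>

text \<open>\<open>E\<close> is an injective cogenerator: on X + R y the assignment x + r y -> r e0
  is single-valued, and injectivity extends it to \<open>N\<close>.\<close>

lemma separating:
  assumes N: "module R N" and X: "submodule X R N" and y: "y \<in> carrier N" "y \<notin> X"
  obtains h where "h \<in> module_hom R N E" "\<And>x. x \<in> X \<Longrightarrow> h x = \<zero>\<^bsub>E\<^esub>" "h y = e0"
proof -
  interpret N: module R N by fact
  note Xs = N.submoduleE[OF X] submodule_zero[OF X]
  have Xc: "x \<in> carrier N" if "x \<in> X" for x using that Xs(1) by blast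
  define G where "G = {(x \<oplus>\<^bsub>N\<^esub> r \<odot>\<^bsub>N\<^esub> y, r \<odot>\<^bsub>E\<^esub> e0) |x r. x \<in> X \<and> r \<in> carrier R}"
  have GI: "(u, v) \<in> G" if "x \<in> X" "r \<in> carrier R" "u = x \<oplus>\<^bsub>N\<^esub> r \<odot>\<^bsub>N\<^esub> y" "v = r \<odot>\<^bsub>E\<^esub> e0" for x r u v
    using that by (auto simp: G_def)
  show thesis
  proof (rule injective_module_relation[OF injective N, of G])
    show "u \<in> carrier N \<and> v \<in> carrier E" if "(u, v) \<in> G" for u v
      using that Xc y e0 by (auto simp: G_def)
    show "G \<noteq> {}" using GI[OF Xs(7) zero_closed refl refl] by blast
    show "(u \<oplus>\<^bsub>N\<^esub> u', v \<oplus>\<^bsub>E\<^esub> v') \<in> G" if uv: "(u, v) \<in> G" "(u', v') \<in> G" for u v u' v'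
    proof -
      obtain x r x' r' where *: "x \<in> X" "r \<in> carrier R" "x' \<in> X" "r' \<in> carrier R"
        "u = x \<oplus>\<^bsub>N\<^esub> r \<odot>\<^bsub>N\<^esub> y" "v = r \<odot>\<^bsub>E\<^esub> e0" "u' = x' \<oplus>\<^bsub>N\<^esub> r' \<odot>\<^bsub>N\<^esub> y" "v' = r' \<odot>\<^bsub>E\<^esub> e0"
        using uv by (auto simp: G_def)
      show ?thesis
        by (rule GI[OF Xs(5)[OF *(1,3)], of "r \<oplus> r'"])
          (use * y e0 Xc in \<open>simp_all add: N.smult_l_distr E.smult_l_distr N.M.a_ac\<close>)
    qed
    show "(s \<odot>\<^bsub>N\<^esub> u, s \<odot>\<^bsub>E\<^esub> v) \<in> G" if s: "s \<in> carrier R" and uv: "(u, v) \<in> G" for s u v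
    proof -
      obtain x r where *: "x \<in> X" "r \<in> carrier R" "u = x \<oplus>\<^bsub>N\<^esub> r \<odot>\<^bsub>N\<^esub> y" "v = r \<odot>\<^bsub>E\<^esub> e0"
        using uv by (auto simp: G_def)
      show ?thesis
        by (rule GI[OF Xs(4)[OF s *(1)], of "s \<otimes> r"])
          (use * s y e0 Xc in \<open>simp_all add: N.smult_r_distr N.smult_assoc1 E.smult_assoc1\<close>)
    qed
    show "v = \<zero>\<^bsub>E\<^esub>" if z: "(\<zero>\<^bsub>N\<^esub>, v) \<in> G" for v
    proof -
      obtain x r where *: "x \<in> X" "r \<in> carrier R" "\<zero>\<^bsub>N\<^esub> = x \<oplus>\<^bsub>N\<^esub> r \<odot>\<^bsub>N\<^esub> y" "v = r \<odot>\<^bsub>E\<^esub> e0"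
        using z unfolding G_def by blast
      have "r \<odot>\<^bsub>N\<^esub> y = \<ominus>\<^bsub>N\<^esub> x"
        using * Xc y N.minus_equality[of "r \<odot>\<^bsub>N\<^esub> y" x] by (simp add: N.M.a_comm)
      then have ry: "r \<odot>\<^bsub>N\<^esub> y \<in> X" using Xs(3)[OF *(1)] by simp
      \<comment> \<open>A unit \<open>r\<close> with r y in \<open>X\<close> would put
        \<open>y\<close> into \<open>X\<close>. So \<open>r\<close> lies in \<open>mm\<close> and
        kills \<open>e0\<close>, which is why \<open>e0\<close> can be prescribed as the value at
        \<open>y\<close>.\<close>
      have "r \<in> mm"
      proof (rule ccontr)
        assume "r \<notin> mm"
        then obtain s where s: "s \<in> carrier R" "s \<otimes> r = \<one>" using inverse *(2) by blast
        have "y = s \<odot>\<^bsub>N\<^esub> (r \<odot>\<^bsub>N\<^esub> y)" using s *(2) y by (simp add: N.smult_assoc1[symmetric])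
        then show False using Xs(4)[OF s(1) ry] y by simp
      qed
      then show ?thesis using max_e0 *(4) by simp
    qed
  next
    fix h assume h: "h \<in> module_hom R N E" "\<And>u v. (u, v) \<in> G \<Longrightarrow> h u = v"
    have "h x = \<zero>\<^bsub>E\<^esub>" if "x \<in> X" for x
      by (rule h(2), rule GI[OF that zero_closed]) (use that Xc y e0 in auto)
    moreover have "h y = e0"
      by (rule h(2), rule GI[OF Xs(7) one_closed]) (use y e0 in auto)
    ultimately show thesis using that h(1) by blast
  qed
qed

lemma separating_point:
  assumes "module R N" "y \<in> carrier N" "y \<noteq> \<zero>\<^bsub>N\<^esub>"
  obtains h where "h \<in> module_hom R N E" "h y = e0"
  using separating[OF assms(1) submodule_null[OF assms(1)] assms(2)] assms(3) by blast

text \<open>For nonzero \<open>x\<close>, essentiality gives r x = \<open>e0\<close>, and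
  \<open>r\<close> is a unit because an element of \<open>mm\<close> would kill
  \<open>x\<close>.\<close>

lemma socle:
  assumes x: "x \<in> carrier E" and kill: "\<And>a. a \<in> mm \<Longrightarrow> a \<odot>\<^bsub>E\<^esub> x = \<zero>\<^bsub>E\<^esub>"
  shows "\<exists>r \<in> carrier R. x = r \<odot>\<^bsub>E\<^esub> e0"
proof (cases "x = \<zero>\<^bsub>E\<^esub>")
  case True
  then show ?thesis using e0 by (intro bexI[of _ \<zero>]) auto
next
  case False
  then obtain r where r: "r \<in> carrier R" "r \<odot>\<^bsub>E\<^esub> x = e0" using essential x by blast
  then have "r \<notin> mm" using kill e0 by auto
  then obtain s where s: "s \<in> carrier R" "s \<otimes> r = \<one>" using inverse r by blast
  have "x = s \<odot>\<^bsub>E\<^esub> e0" using r s x by (simp add: r(2)[symmetric] E.smult_assoc1[symmetric])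
  then show ?thesis using s by blast
qed

section \<open>Endomorphisms of the injective hull\<close>

text \<open>The induction step of \<open>Hom(E, E) = R\<close>: an endomorphism that is zero on the
  \<open>\<mm>\<^sup>n\<close>-torsion maps the \<open>\<mm>\<^sup>n\<^sup>+\<^sup>1\<close>-torsion into the socle, where endomorphisms are scalars.\<close>

lemma endo_torsion_step:
  assumes g: "linear_map R E E g" and g0: "\<And>x. x \<in> torsion E n \<Longrightarrow> g x = \<zero>\<^bsub>E\<^esub>"
  shows "\<exists>s \<in> ideal_power R mm n. \<forall>x \<in> torsion E (Suc n). g x = s \<odot>\<^bsub>E\<^esub> x"
proof -
  obtain A where A: "A \<subseteq> carrier R" "finite A" "ideal_power R mm n = Idl A"
    using finetely_gen[OF ideal_power_ideal[of n]] by blast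
  have AI: "A \<subseteq> ideal_power R mm n" using genideal_self[OF A(1)] A(3) by simp
  note I = ideal_power_ideal[of n]
  \<comment> \<open>\<open>P\<close> describes combinations of multiplications by the generators of
    m^n: each is multiplication by one element of m^n. Keeping that element in m^n makes the
    approximations in \<open>endo_scalar\<close> converge.\<close>
  define P where "P f \<longleftrightarrow> linear_map R E E f \<and>
    (\<exists>s \<in> ideal_power R mm n. \<forall>x \<in> carrier E. f x = s \<odot>\<^bsub>E\<^esub> x)" for f
  have soc: "\<exists>r \<in> carrier R. a \<odot>\<^bsub>E\<^esub> x = r \<odot>\<^bsub>E\<^esub> e0" if "a \<in> A" "x \<in> torsion E (Suc n)" for a x
  proof (rule socle)
    have x: "x \<in> carrier E" using that by (simp add: torsion_def)
    show "a \<odot>\<^bsub>E\<^esub> x \<in> carrier E" using that A(1) x by auto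
    fix b assume b: "b \<in> mm"
    have "b \<otimes> a \<in> ideal_power R mm (Suc n)" using b that(1) AI by (auto intro: ideal_prod.prod)
    then have "(b \<otimes> a) \<odot>\<^bsub>E\<^esub> x = \<zero>\<^bsub>E\<^esub>" using that(2) unfolding torsion_def by blast
    then show "b \<odot>\<^bsub>E\<^esub> (a \<odot>\<^bsub>E\<^esub> x) = \<zero>\<^bsub>E\<^esub>"
      using mmD[OF b] that A(1) x by (subst E.smult_assoc1[symmetric]) auto
  qed
  \<comment> \<open>The n-th torsion part is the joint kernel of the multiplications by
    \<open>A\<close>, and \<open>g\<close> is zero on it. On the next torsion part their values lie
    in the socle, where endomorphisms are known to be scalars.\<close>
  have "\<exists>f. P f \<and> (\<forall>x \<in> torsion E (Suc n). g x = f x)"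
  proof (rule joint_kernel[OF injective E.module_axioms torsion_submodule[OF E.module_axioms] _ _ g,
        of "(\<lambda>a x. a \<odot>\<^bsub>E\<^esub> x) ` A"])
    show "finite ((\<lambda>a x. a \<odot>\<^bsub>E\<^esub> x) ` A)" using A(2) by simp
    show "linear_map R E E \<phi>" if "\<phi> \<in> (\<lambda>a x. a \<odot>\<^bsub>E\<^esub> x) ` A" for \<phi>
      using that A(1) by (auto intro: linear_map_homothety E.module_axioms)
    show "g x = \<zero>\<^bsub>E\<^esub>" if x: "x \<in> torsion E (Suc n)"
      and k: "\<And>\<phi>. \<phi> \<in> (\<lambda>a x. a \<odot>\<^bsub>E\<^esub> x) ` A \<Longrightarrow> \<phi> x = \<zero>\<^bsub>E\<^esub>" for x
    proof (rule g0)
      have xc: "x \<in> carrier E" using x by (simp add: torsion_def)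
      have "Idl A \<subseteq> {a \<in> carrier R. a \<odot>\<^bsub>E\<^esub> x \<in> {\<zero>\<^bsub>E\<^esub>}}"
        by (intro genideal_minimal colon_ideal submodule_null E.module_axioms xc) (use A(1) k in auto)
      then show "x \<in> torsion E n" using A(3) xc by (auto simp: torsion_def)
    qed
    show "\<exists>r\<in>carrier R. \<forall>x\<in>torsion E (Suc n). h (\<phi> x) = r \<odot>\<^bsub>E\<^esub> \<phi> x"
      if \<phi>: "\<phi> \<in> (\<lambda>a x. a \<odot>\<^bsub>E\<^esub> x) ` A" and h: "h \<in> module_hom R E E" for \<phi> h
    proof -
      obtain a where a: "a \<in> A" "\<phi> = (\<lambda>x. a \<odot>\<^bsub>E\<^esub> x)" using \<phi> by blast
      note hl = linear_mapD[OF module_homD(1)[OF h]]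
      \<comment> \<open>\<open>h\<close> sends the generator \<open>e0\<close> of the socle into the
        socle; by linearity and commutativity the scalar found there serves for every multiple of
        \<open>e0\<close>.\<close>
      have "\<exists>r \<in> carrier R. h e0 = r \<odot>\<^bsub>E\<^esub> e0"
      proof (rule socle)
        show "b \<odot>\<^bsub>E\<^esub> h e0 = \<zero>\<^bsub>E\<^esub>" if "b \<in> mm" for b
          using hl(3)[OF mmD[OF that] e0(1)] max_e0[OF that]
            linear_map_zero[OF E.module_axioms E.module_axioms module_homD(1)[OF h]] by simp
      qed (use hl(1) e0 in blast)
      then obtain r where r: "r \<in> carrier R" "h e0 = r \<odot>\<^bsub>E\<^esub> e0" by blast
      have "h (\<phi> x) = r \<odot>\<^bsub>E\<^esub> \<phi> x" if "x \<in> torsion E (Suc n)" for x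
      proof -
        obtain s where s: "s \<in> carrier R" "a \<odot>\<^bsub>E\<^esub> x = s \<odot>\<^bsub>E\<^esub> e0" using soc[OF a(1) \<open>x \<in> _\<close>] by blast
        then show ?thesis using r e0 hl(3)[OF s(1) e0(1)]
          by (simp add: a(2) E.smult_assoc1[symmetric] m_comm)
      qed
      then show ?thesis using r(1) by blast
    qed
    show "P (\<lambda>x. \<zero>\<^bsub>E\<^esub>)"
      unfolding P_def using additive_subgroup.zero_closed[OF ideal.axioms(1)[OF I]]
      by (intro conjI linear_map_null E.module_axioms bexI[of _ \<zero>]) auto
    show "P (\<lambda>x. f x \<oplus>\<^bsub>E\<^esub> r \<odot>\<^bsub>E\<^esub> \<phi> x)"
      if f: "P f" and \<phi>: "\<phi> \<in> (\<lambda>a x. a \<odot>\<^bsub>E\<^esub> x) ` A" and r: "r \<in> carrier R" for f \<phi> r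
    proof -
      obtain a where a: "a \<in> A" "\<phi> = (\<lambda>x. a \<odot>\<^bsub>E\<^esub> x)" using \<phi> by blast
      have ac: "a \<in> carrier R" using a A(1) by blast
      obtain s where s: "s \<in> ideal_power R mm n" "\<And>x. x \<in> carrier E \<Longrightarrow> f x = s \<odot>\<^bsub>E\<^esub> x"
        using f by (auto simp: P_def)
      have "s \<oplus> r \<otimes> a \<in> ideal_power R mm n"
        using s(1) a(1) AI r by (intro additive_subgroup.a_closed[OF ideal.axioms(1)[OF I]] ideal.I_l_closed[OF I]) auto
      moreover have "f x \<oplus>\<^bsub>E\<^esub> r \<odot>\<^bsub>E\<^esub> \<phi> x = (s \<oplus> r \<otimes> a) \<odot>\<^bsub>E\<^esub> x" if "x \<in> carrier E" for x
        using s that r ac ideal_power_carrier[OF s(1)] by (simp add: a(2) E.smult_l_distr E.smult_assoc1)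
      moreover have "linear_map R E E (\<lambda>x. f x \<oplus>\<^bsub>E\<^esub> r \<odot>\<^bsub>E\<^esub> \<phi> x)"
        using f unfolding a(2) P_def by (intro linear_map_add linear_map_smult linear_map_id E.module_axioms r ac) auto
      ultimately show ?thesis unfolding P_def by blast
    qed
    show "linear_map R E E f" if "P f" for f using that by (simp add: P_def)
  qed
  then obtain f s where fs: "\<And>x. x \<in> torsion E (Suc n) \<Longrightarrow> g x = f x"
    "s \<in> ideal_power R mm n" "\<And>x. x \<in> carrier E \<Longrightarrow> f x = s \<odot>\<^bsub>E\<^esub> x"
    unfolding P_def by blast
  have "g x = s \<odot>\<^bsub>E\<^esub> x" if "x \<in> torsion E (Suc n)" for x
    using fs(1,3) that by (simp add: torsion_def)
  then show ?thesis using fs(2) by blast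
qed

lemma endo_scalar:
  assumes f: "f \<in> module_hom R E E"
  shows "\<exists>r \<in> carrier R. \<forall>x \<in> carrier E. f x = r \<odot>\<^bsub>E\<^esub> x"
proof -
  note fl = module_homD(1)[OF f]
  note fz = linear_map_zero[OF E.module_axioms E.module_axioms fl]
  let ?P = "\<lambda>n r. r \<in> carrier R \<and> (\<forall>x \<in> torsion E n. f x = r \<odot>\<^bsub>E\<^esub> x)"
  have "\<exists>r. \<forall>n. ?P n (r n) \<and> r (Suc n) \<ominus> r n \<in> ideal_power R mm n"
  proof (rule dependent_nat_choice)
    \<comment> \<open>m^0 is the whole ring, so the torsion part of level 0 is zero and any scalar
      can start the recursion.\<close>
    have "x = \<zero>\<^bsub>E\<^esub>" if "x \<in> torsion E 0" for x
      using that E.smult_one[of x] by (auto simp: torsion_def simp del: E.smult_one)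
    moreover have "f \<zero>\<^bsub>E\<^esub> = \<zero> \<odot>\<^bsub>E\<^esub> \<zero>\<^bsub>E\<^esub>" using fz by simp
    ultimately show "\<exists>r. ?P 0 r" by (metis zero_closed)
    fix r n assume r: "?P n r"
    have "linear_map R E E (\<lambda>x. f x \<ominus>\<^bsub>E\<^esub> r \<odot>\<^bsub>E\<^esub> x)"
      by (intro linear_map_diff fl linear_map_homothety E.module_axioms) (use r in simp)
    moreover have "f x \<ominus>\<^bsub>E\<^esub> r \<odot>\<^bsub>E\<^esub> x = \<zero>\<^bsub>E\<^esub>" if "x \<in> torsion E n" for x
      using r that linear_mapD(1)[OF fl] by (auto simp: torsion_def E.minus_eq E.M.r_neg)
    \<comment> \<open>The error of the current scalar on the next torsion part is itself a scalar
      \<open>s\<close> from m^n; \<open>r \<oplus> s\<close> is the next approximation.\<close>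
    ultimately obtain s where s: "s \<in> ideal_power R mm n"
      "\<And>x. x \<in> torsion E (Suc n) \<Longrightarrow> f x \<ominus>\<^bsub>E\<^esub> r \<odot>\<^bsub>E\<^esub> x = s \<odot>\<^bsub>E\<^esub> x"
      using endo_torsion_step[of _ n] by blast
    have sc: "s \<in> carrier R" using ideal_power_carrier s(1) by blast
    have "f x = (r \<oplus> s) \<odot>\<^bsub>E\<^esub> x" if x: "x \<in> torsion E (Suc n)" for x
    proof -
      have xc: "x \<in> carrier E" using x by (simp add: torsion_def)
      note fx = linear_mapD(1)[OF fl xc]
      have "(r \<oplus> s) \<odot>\<^bsub>E\<^esub> x = r \<odot>\<^bsub>E\<^esub> x \<oplus>\<^bsub>E\<^esub> (f x \<ominus>\<^bsub>E\<^esub> r \<odot>\<^bsub>E\<^esub> x)"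
        using r sc xc s(2)[OF x] by (simp add: E.smult_l_distr)
      also have "\<dots> = f x \<oplus>\<^bsub>E\<^esub> (r \<odot>\<^bsub>E\<^esub> x \<oplus>\<^bsub>E\<^esub> \<ominus>\<^bsub>E\<^esub> (r \<odot>\<^bsub>E\<^esub> x))"
        using r fx xc by (simp add: E.minus_eq E.M.a_ac)
      also have "\<dots> = f x" using r fx xc by (simp add: E.M.r_neg)
      finally show ?thesis ..
    qed
    moreover have "(r \<oplus> s) \<ominus> r = s" using r sc by (simp add: minus_eq a_comm[of r s] a_assoc r_neg)
    ultimately show "\<exists>r'. ?P (Suc n) r' \<and> r' \<ominus> r \<in> ideal_power R mm n"
      using r sc s(1) by (intro exI[of _ "r \<oplus> s"]) auto
  qed
  then obtain r where r: "\<And>n. r n \<in> carrier R" "\<And>n x. x \<in> torsion E n \<Longrightarrow> f x = r n \<odot>\<^bsub>E\<^esub> x"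
    "\<And>n. r (Suc n) \<ominus> r n \<in> ideal_power R mm n" by blast
  \<comment> \<open>The sequence is Cauchy, since consecutive terms differ by elements of m^n. If
    m^n kills \<open>x\<close>, then so does \<open>s \<ominus> r n\<close>, and \<open>s\<close>
    acts on \<open>x\<close> as \<open>r n\<close> does, that is, as \<open>f\<close>.\<close>
  obtain s where s: "s \<in> carrier R" "\<And>n. s \<ominus> r n \<in> ideal_power R mm n"
    using limit[of r] r(1,3) by blast
  have "f x = s \<odot>\<^bsub>E\<^esub> x" if x: "x \<in> carrier E" for x
  proof -
    obtain n where n: "x \<in> torsion E n" using torsion_E[OF x] by blast
    have "s = (s \<ominus> r n) \<oplus> r n" using s(1) r(1) by (simp add: minus_eq a_assoc l_neg)
    then have "s \<odot>\<^bsub>E\<^esub> x = ((s \<ominus> r n) \<oplus> r n) \<odot>\<^bsub>E\<^esub> x" by simp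
    also have "\<dots> = (s \<ominus> r n) \<odot>\<^bsub>E\<^esub> x \<oplus>\<^bsub>E\<^esub> r n \<odot>\<^bsub>E\<^esub> x"
      using s(1) r(1) x by (intro E.smult_l_distr) auto
    also have "(s \<ominus> r n) \<odot>\<^bsub>E\<^esub> x = \<zero>\<^bsub>E\<^esub>" using n s(2)[of n] by (simp add: torsion_def)
    finally show ?thesis using r(2)[OF n] r(1) x by simp
  qed
  then show ?thesis using s(1) by blast
qed

end

section \<open>Isomorphic modules\<close>

lemma module_isomorphicI:
  assumes "module R M" "linear_map R M N f" "bij_betw f (carrier M) (carrier N)"
  shows "module_isomorphic R M N"
proof -
  have "bij_betw (restrict f (carrier M)) (carrier M) (carrier N)"
    using assms(3) by (subst bij_betw_cong[of _ _ f]) auto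
  then show ?thesis
    using restrict_module_hom[OF assms(1,2)] unfolding module_isomorphic_def module_iso_def by blast
qed

lemma module_isomorphicE:
  assumes "module R M" "module_isomorphic R M N"
  obtains f g where "linear_map R M N f" "linear_map R N M g"
    "\<And>x. x \<in> carrier M \<Longrightarrow> g (f x) = x" "\<And>y. y \<in> carrier N \<Longrightarrow> f (g y) = y"
proof -
  interpret M: module R M by fact
  from assms(2) obtain f where f: "linear_map R M N f" "bij_betw f (carrier M) (carrier N)"
    by (auto simp: module_isomorphic_def module_iso_def module_hom_iff)
  define g where "g = the_inv_into (carrier M) f"
  have inj: "inj_on f (carrier M)" and surj: "f ` carrier M = carrier N"
    using f(2) by (auto simp: bij_betw_def)
  have gf: "g (f x) = x" if "x \<in> carrier M" for x
    using the_inv_into_f_f[OF inj that] by (simp add: g_def)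
  have ex: "\<exists>x \<in> carrier M. y = f x" if "y \<in> carrier N" for y using that surj by blast
  note fl = linear_mapD[OF f(1)]
  have "linear_map R N M g"
  proof (rule linear_mapI)
    fix y assume "y \<in> carrier N"
    then obtain x where x: "x \<in> carrier M" "y = f x" using ex by blast
    show "g y \<in> carrier M" using x gf by simp
    show "g (r \<odot>\<^bsub>N\<^esub> y) = r \<odot>\<^bsub>M\<^esub> g y" if "r \<in> carrier R" for r
      using fl(3)[OF that x(1), symmetric] x gf that by simp
    fix y' assume "y' \<in> carrier N"
    then obtain x' where x': "x' \<in> carrier M" "y' = f x'" using ex by blast
    show "g (y \<oplus>\<^bsub>N\<^esub> y') = g y \<oplus>\<^bsub>M\<^esub> g y'"
      using fl(2)[OF x(1) x'(1), symmetric] x x' gf by simp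
  qed
  moreover have "f (g y) = y" if "y \<in> carrier N" for y using ex[OF that] gf by auto
  ultimately show thesis using that[OF f(1)] gf by blast
qed

lemma module_isomorphicI_inverse:
  assumes "module R M" "linear_map R M N f" "linear_map R N M g"
    "\<And>x. x \<in> carrier M \<Longrightarrow> g (f x) = x" "\<And>y. y \<in> carrier N \<Longrightarrow> f (g y) = y"
  shows "module_isomorphic R M N"
proof (rule module_isomorphicI[OF assms(1,2)])
  show "bij_betw f (carrier M) (carrier N)"
    by (rule bij_betw_byWitness[of _ g])
      (use assms(4,5) linear_mapD(1)[OF assms(2)] linear_mapD(1)[OF assms(3)] in auto)
qed

lemma module_isomorphic_sym:
  assumes "module R M" "module R N" "module_isomorphic R M N"
  shows "module_isomorphic R N M"
  by (rule module_isomorphicE[OF assms(1,3)]) (rule module_isomorphicI_inverse[OF assms(2)])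

lemma module_isomorphic_trans:
  assumes "module R M" "module R N" "module_isomorphic R M N" "module_isomorphic R N L"
  shows "module_isomorphic R M L"
proof -
  obtain f g where f: "linear_map R M N f" "linear_map R N M g"
    "\<And>x. x \<in> carrier M \<Longrightarrow> g (f x) = x" "\<And>y. y \<in> carrier N \<Longrightarrow> f (g y) = y"
    using module_isomorphicE[OF assms(1,3)] by blast
  obtain f' g' where f': "linear_map R N L f'" "linear_map R L N g'"
    "\<And>x. x \<in> carrier N \<Longrightarrow> g' (f' x) = x" "\<And>y. y \<in> carrier L \<Longrightarrow> f' (g' y) = y"
    using module_isomorphicE[OF assms(2,4)] by blast
  show ?thesis
    by (rule module_isomorphicI_inverse[OF assms(1) linear_map_comp[OF f(1) f'(1)]
          linear_map_comp[OF f'(2) f(2)]])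
      (use f(3,4) f'(3,4) linear_mapD(1)[OF f(1)] linear_mapD(1)[OF f'(2)] in auto)
qed

lemma module_isomorphic_hom:
  assumes M: "module R M" and M': "module R M'" and N: "module R N" and iso: "module_isomorphic R M M'"
  shows "module_isomorphic R (hom_module R M N) (hom_module R M' N)"
proof -
  interpret N: module R N by fact
  interpret M: module R M by fact
  interpret M': module R M' by fact
  obtain f g where f: "linear_map R M M' f" "linear_map R M' M g"
    "\<And>x. x \<in> carrier M \<Longrightarrow> g (f x) = x" "\<And>y. y \<in> carrier M' \<Longrightarrow> f (g y) = y"
    using module_isomorphicE[OF M iso] by blast
  have *: "linear_map R (hom_module R A N) (hom_module R B N) (\<lambda>\<phi>. \<lambda>x \<in> carrier B. \<phi> (u x))"
    if u: "linear_map R B A u" and B: "module R B" for A :: "('a, 'x) module" and B :: "('a, 'y) module" and u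
  proof -
    interpret B: module R B by fact
    show ?thesis
    proof (rule linear_mapI)
      show "(\<lambda>x \<in> carrier B. \<phi> (u x)) \<in> carrier (hom_module R B N)" if "\<phi> \<in> carrier (hom_module R A N)" for \<phi>
        using that restrict_module_hom[OF B linear_map_comp[OF u module_homD(1)]] by simp
    qed (use linear_mapD(1)[OF u] in \<open>simp_all add: restrict_def fun_eq_iff\<close>)
  qed
  show ?thesis
  proof (rule module_isomorphicI_inverse[OF hom_module_is_module[OF M N] *[OF f(2) M'] *[OF f(1) M]])
    show "(\<lambda>x\<in>carrier M. (\<lambda>x\<in>carrier M'. \<phi> (g x)) (f x)) = \<phi>"
      if "\<phi> \<in> carrier (hom_module R M N)" for \<phi>
      using that f(3) linear_mapD(1)[OF f(1)]
      by (intro extensionalityI[of _ "carrier M"]) (auto simp: module_hom_iff)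
    show "(\<lambda>x\<in>carrier M'. (\<lambda>x\<in>carrier M. \<phi> (f x)) (g x)) = \<phi>"
      if "\<phi> \<in> carrier (hom_module R M' N)" for \<phi>
      using that f(4) linear_mapD(1)[OF f(2)]
      by (intro extensionalityI[of _ "carrier M'"]) (auto simp: module_hom_iff)
  qed
qed

lemma finitely_generated_isomorphic:
  assumes M: "module R M" and N: "module R N" and iso: "module_isomorphic R M N"
    and fg: "finitely_generated R M"
  shows "finitely_generated R N"
proof -
  interpret M: module R M by fact
  interpret N: module R N by fact
  obtain f g where f: "linear_map R M N f" "linear_map R N M g"
    "\<And>x. x \<in> carrier M \<Longrightarrow> g (f x) = x" "\<And>y. y \<in> carrier N \<Longrightarrow> f (g y) = y"
    using module_isomorphicE[OF M iso] by blast
  obtain A where A: "finite A" "A \<subseteq> carrier M"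
    "\<And>K. submodule K R M \<Longrightarrow> A \<subseteq> K \<Longrightarrow> K = carrier M"
    using fg by (auto simp: finitely_generated_def)
  have "K = carrier N" if K: "submodule K R N" "f ` A \<subseteq> K" for K
  proof -
    have "{x \<in> carrier M. f x \<in> K} = carrier M"
      by (rule A(3)) (use submodule_vimage[OF M N f(1) K(1)] K(2) A(2) in auto)
    then have "y \<in> K" if "y \<in> carrier N" for y
      using f(4)[OF that] linear_mapD(1)[OF f(2) that] by (metis (mono_tags, lifting) mem_Collect_eq)
    then show ?thesis using N.submoduleE(1)[OF K(1)] by blast
  qed
  moreover have "f ` A \<subseteq> carrier N" using A(2) linear_mapD(1)[OF f(1)] by blast
  ultimately show ?thesis unfolding finitely_generated_def using A(1) by (metis finite_imageI)
qed

lemma artinian_isomorphic: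
  assumes M: "module R M" and N: "module R N" and iso: "module_isomorphic R M N"
    and art: "artinian R M"
  shows "artinian R N"
  unfolding artinian_def
proof (intro allI impI)
  interpret N: module R N by fact
  obtain f g where f: "linear_map R M N f" "linear_map R N M g"
    "\<And>x. x \<in> carrier M \<Longrightarrow> g (f x) = x" "\<And>y. y \<in> carrier N \<Longrightarrow> f (g y) = y"
    using module_isomorphicE[OF M iso] by blast
  fix K :: "nat \<Rightarrow> _"
  assume K: "(\<forall>i. submodule (K i) R N) \<and> (\<forall>i. K (Suc i) \<subseteq> K i)"
  have "submodule (g ` K i) R M" "g ` K (Suc i) \<subseteq> g ` K i" for i
    using K by (simp_all add: submodule_image[OF N M f(2)] image_mono)
  then obtain n where n: "\<And>i. i \<ge> n \<Longrightarrow> g ` K i = g ` K n"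
    using art unfolding artinian_def by meson
  have fg: "f ` g ` K i = K i" for i
  proof -
    have "K i \<subseteq> carrier N" using K N.submoduleE(1) by blast
    then show ?thesis using f(4) by (auto simp: image_image subset_iff)
  qed
  have "K i = K n" if "i \<ge> n" for i using n[OF that] fg by metis
  then show "\<exists>n. \<forall>i \<ge> n. K i = K n" by blast
qed

text \<open>Existence of the scalar is surjectivity of the homothety map and uniqueness its
  injectivity. \<open>homothety_iso_iff\<close> and \<open>completion_homothety_iff\<close> reduce
  the two official conditions to this one, which passes to isomorphic modules and to duals of
  reflexive modules.\<close>

definition homothetic :: "('a, 'r) ring_scheme \<Rightarrow> ('a, 'm) module \<Rightarrow> bool" where
  "homothetic R M \<longleftrightarrow> (\<forall>f \<in> module_hom R M M. \<exists>!r. r \<in> carrier R \<and> (\<forall>x \<in> carrier M. f x = r \<odot>\<^bsub>M\<^esub> x))"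

lemma homotheticD:
  assumes "homothetic R M" "module R M" "linear_map R M M f"
  shows "\<exists>!r. r \<in> carrier R \<and> (\<forall>x \<in> carrier M. f x = r \<odot>\<^bsub>M\<^esub> x)"
  using assms(1)[unfolded homothetic_def, rule_format, OF restrict_module_hom[OF assms(2,3)]]
  by simp

lemma homothetic_isomorphic:
  assumes M: "module R M" and N: "module R N" and iso: "module_isomorphic R M N"
    and h: "homothetic R M"
  shows "homothetic R N"
  unfolding homothetic_def
proof
  obtain f g where f: "linear_map R M N f" "linear_map R N M g"
    "\<And>x. x \<in> carrier M \<Longrightarrow> g (f x) = x" "\<And>y. y \<in> carrier N \<Longrightarrow> f (g y) = y"
    using module_isomorphicE[OF M iso] by blast
  fix k assume k: "k \<in> module_hom R N N"
  note kl = linear_mapD[OF module_homD(1)[OF k]] and fl = linear_mapD[OF f(1)] and gl = linear_mapD[OF f(2)]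
  have "\<exists>!r. r \<in> carrier R \<and> (\<forall>x \<in> carrier M. g (k (f x)) = r \<odot>\<^bsub>M\<^esub> x)"
    by (rule homotheticD[OF h M])
      (intro linear_map_comp[OF _ f(2)] linear_map_comp[OF f(1)] module_homD(1)[OF k])
  moreover have eq: "(\<forall>x \<in> carrier M. g (k (f x)) = r \<odot>\<^bsub>M\<^esub> x) \<longleftrightarrow> (\<forall>y \<in> carrier N. k y = r \<odot>\<^bsub>N\<^esub> y)"
    if r: "r \<in> carrier R" for r
  proof (intro iffI ballI)
    fix y assume *: "\<forall>x \<in> carrier M. g (k (f x)) = r \<odot>\<^bsub>M\<^esub> x" and y: "y \<in> carrier N"
    have "f (g (k (f (g y)))) = f (r \<odot>\<^bsub>M\<^esub> g y)" using * gl(1)[OF y] by simp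
    then show "k y = r \<odot>\<^bsub>N\<^esub> y" using f(4) y kl(1) gl(1) fl(3) r by simp
  next
    fix x assume *: "\<forall>y \<in> carrier N. k y = r \<odot>\<^bsub>N\<^esub> y" and x: "x \<in> carrier M"
    then show "g (k (f x)) = r \<odot>\<^bsub>M\<^esub> x" using fl(1) gl(3) f(3) r by simp
  qed
  ultimately show "\<exists>!r. r \<in> carrier R \<and> (\<forall>y \<in> carrier N. k y = r \<odot>\<^bsub>N\<^esub> y)"
    by (simp only: eq cong: conj_cong)
qed

text \<open>Transport of structure along an injection. It puts modules on the two fixed types over
  which isomorphism classes are formed.\<close>

lemma isomorphic_copy:
  fixes g :: "'m \<Rightarrow> 'u" and M :: "('a, 'm) module"
  assumes M: "module R M" and g: "inj_on g (carrier M)"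
  obtains N :: "('a, 'u) module" where "module R N" "module_isomorphic R M N"
proof -
  interpret M: module R M by fact
  define h where "h = the_inv_into (carrier M) g"
  have h: "h (g x) = x" if "x \<in> carrier M" for x
    using the_inv_into_f_f[OF g that] by (simp add: h_def)
  define N :: "('a, 'u) module" where
    "N = \<lparr>carrier = g ` carrier M, mult = undefined, one = undefined, zero = g \<zero>\<^bsub>M\<^esub>,
      add = (\<lambda>x y. g (h x \<oplus>\<^bsub>M\<^esub> h y)), smult = (\<lambda>r x. g (r \<odot>\<^bsub>M\<^esub> h x))\<rparr>"
  have N: "module R N"
  proof (rule moduleI)
    show "abelian_group N"
    proof (rule abelian_groupI)
      fix x assume "x \<in> carrier N"
      then obtain u where "u \<in> carrier M" "x = g u" by (auto simp: N_def)
      then show "\<exists>y\<in>carrier N. y \<oplus>\<^bsub>N\<^esub> x = \<zero>\<^bsub>N\<^esub>"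
        by (intro bexI[of _ "g (\<ominus>\<^bsub>M\<^esub> u)"]) (auto simp: N_def h M.M.l_neg)
    qed (auto simp: N_def h M.M.a_ac)
  qed (auto simp: N_def h M.smult_l_distr M.smult_r_distr M.smult_assoc1 M.R.is_cring)
  moreover have "module_isomorphic R M N"
    by (rule module_isomorphicI[OF M, of _ g]) (use g h in \<open>auto simp: N_def linear_map_def bij_betw_def\<close>)
  ultimately show thesis by (rule that)
qed

section \<open>Matlis duality\<close>

context matlis
begin

section \<open>Reflexivity of finitely generated modules\<close>

text \<open>Only the surjectivity of evaluation into the double dual is recorded; its injectivity
  holds for every module by \<open>dual_separates\<close>.\<close>

definition reflexive :: "('a, 'm) module \<Rightarrow> bool" where
  "reflexive M \<longleftrightarrow> (\<forall>\<Lambda> \<in> module_hom R (hom_module R M E) E.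
     \<exists>x \<in> carrier M. \<forall>\<phi> \<in> module_hom R M E. \<Lambda> \<phi> = \<phi> x)"

lemma dual_module: "module R M \<Longrightarrow> module R (hom_module R M E)"
  using hom_module_is_module E.module_axioms by blast

lemma dual_separates:
  assumes M: "module R M" and x: "x \<in> carrier M" "y \<in> carrier M"
    and eq: "\<And>\<phi>. \<phi> \<in> module_hom R M E \<Longrightarrow> \<phi> x = \<phi> y"
  shows "x = y"
proof (rule ccontr)
  interpret M: module R M by fact
  assume ne: "x \<noteq> y"
  have c: "x \<ominus>\<^bsub>M\<^esub> y \<in> carrier M" using x by simp
  have "x = (x \<ominus>\<^bsub>M\<^esub> y) \<oplus>\<^bsub>M\<^esub> y" using x by (simp add: M.minus_eq M.M.a_assoc M.M.l_neg)
  then have "x \<ominus>\<^bsub>M\<^esub> y \<noteq> \<zero>\<^bsub>M\<^esub>" using ne x by (intro notI) simp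
  then obtain \<phi> where \<phi>: "\<phi> \<in> module_hom R M E" "\<phi> (x \<ominus>\<^bsub>M\<^esub> y) = e0"
    using separating_point[OF M c] by blast
  have "\<phi> (x \<ominus>\<^bsub>M\<^esub> y) = \<phi> x \<ominus>\<^bsub>E\<^esub> \<phi> y"
    by (rule linear_map_minus[OF M E.module_axioms module_homD(1)[OF \<phi>(1)] x])
  also have "\<dots> = \<zero>\<^bsub>E\<^esub>"
    using eq[OF \<phi>(1)] linear_mapD(1)[OF module_homD(1)[OF \<phi>(1)]] x by (simp add: E.minus_eq E.M.r_neg)
  finally show False using \<phi>(2) e0 by simp
qed

text \<open>Evaluations at generators have zero as their joint kernel on the dual. This is the input
  of \<open>joint_kernel\<close> for reflexivity and of \<open>joint_kernel_stable\<close> for the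
  artinian condition.\<close>

lemma dual_generators:
  assumes M: "module R M" and A: "A \<subseteq> carrier M"
    "\<And>K. submodule K R M \<Longrightarrow> A \<subseteq> K \<Longrightarrow> K = carrier M"
    and \<phi>: "\<phi> \<in> module_hom R M E" "\<And>a. a \<in> A \<Longrightarrow> \<phi> a = \<zero>\<^bsub>E\<^esub>"
  shows "\<phi> = \<zero>\<^bsub>hom_module R M E\<^esub>"
proof -
  have "{x \<in> carrier M. \<phi> x = \<zero>\<^bsub>E\<^esub>} = carrier M"
    by (rule A(2)[OF submodule_kernel[OF M E.module_axioms module_homD(1)[OF \<phi>(1)]]]) (use \<phi> A in auto)
  then show ?thesis
    using \<phi>(1) by (intro extensionalityI[of _ "carrier M"]) (auto simp: module_hom_iff)
qed

text \<open>By \<open>joint_kernel\<close> a functional on the dual is a combination of evaluations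
  at the generators, and this is evaluation at the same combination of the generators;
  \<open>P\<close> records that \<open>f\<close> is an evaluation.\<close>

lemma finitely_generated_reflexive:
  assumes M: "module R M" and fg: "finitely_generated R M"
  shows "reflexive M"
  unfolding reflexive_def
proof
  interpret M: module R M by fact
  let ?D = "hom_module R M E"
  fix \<Lambda> assume \<Lambda>: "\<Lambda> \<in> module_hom R ?D E"
  interpret D: module R ?D by (rule dual_module[OF M])
  obtain A where A: "finite A" "A \<subseteq> carrier M"
    "\<And>K. submodule K R M \<Longrightarrow> A \<subseteq> K \<Longrightarrow> K = carrier M"
    using fg by (auto simp: finitely_generated_def)
  define P where "P f \<longleftrightarrow> linear_map R ?D E f \<and>
    (\<exists>x \<in> carrier M. \<forall>\<phi> \<in> module_hom R M E. f \<phi> = \<phi> x)" for f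
  have "\<exists>f. P f \<and> (\<forall>\<phi> \<in> carrier ?D. \<Lambda> \<phi> = f \<phi>)"
  proof (rule joint_kernel[OF injective D.module_axioms D.carrier_is_submodule _ _ module_homD(1)[OF \<Lambda>],
        of "(\<lambda>x \<phi>. \<phi> x) ` A"])
    show "finite ((\<lambda>x \<phi>. \<phi> x) ` A :: (('b \<Rightarrow> 'e) \<Rightarrow> 'e) set)" using A(1) by simp
    show "linear_map R ?D E \<chi>" if "\<chi> \<in> (\<lambda>x \<phi>. \<phi> x) ` A" for \<chi>
      using that A(2) by (auto intro: linear_map_eval)
    show "\<Lambda> \<phi> = \<zero>\<^bsub>E\<^esub>" if \<phi>: "\<phi> \<in> carrier ?D"
      and k: "\<And>\<chi>. \<chi> \<in> (\<lambda>x \<phi>. \<phi> x) ` A \<Longrightarrow> \<chi> \<phi> = \<zero>\<^bsub>E\<^esub>" for \<phi>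
    proof -
      have "\<phi> = \<zero>\<^bsub>?D\<^esub>" by (rule dual_generators[OF M A(2,3)]) (use \<phi> k in auto)
      then show ?thesis
        using linear_map_zero[OF D.module_axioms E.module_axioms module_homD(1)[OF \<Lambda>]] by simp
    qed
    show "\<exists>r\<in>carrier R. \<forall>\<phi>\<in>carrier ?D. h (\<chi> \<phi>) = r \<odot>\<^bsub>E\<^esub> \<chi> \<phi>"
      if \<chi>: "\<chi> \<in> (\<lambda>x \<phi>. \<phi> x) ` A" and h: "h \<in> module_hom R E E" for \<chi> h
    proof -
      obtain x where x: "x \<in> A" "\<chi> = (\<lambda>\<phi>. \<phi> x)" using \<chi> by blast
      then have "\<chi> \<phi> \<in> carrier E" if "\<phi> \<in> carrier ?D" for \<phi>
        using that A(2) by (auto simp: module_hom_iff linear_map_def)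
      then show ?thesis using endo_scalar[OF h] by blast
    qed
    show "P (\<lambda>\<phi>. \<zero>\<^bsub>E\<^esub>)"
      unfolding P_def using linear_map_zero[OF M E.module_axioms]
      by (intro conjI linear_map_null E.module_axioms bexI[of _ "\<zero>\<^bsub>M\<^esub>"]) (auto simp: module_hom_iff)
    show "P (\<lambda>\<phi>. f \<phi> \<oplus>\<^bsub>E\<^esub> r \<odot>\<^bsub>E\<^esub> \<chi> \<phi>)"
      if f: "P f" and \<chi>: "\<chi> \<in> (\<lambda>x \<phi>. \<phi> x) ` A" and r: "r \<in> carrier R" for f \<chi> r
    proof -
      obtain a where a: "a \<in> A" "\<chi> = (\<lambda>\<phi>. \<phi> a)" using \<chi> by blast
      have ac: "a \<in> carrier M" using a A(2) by blast
      obtain x where x: "x \<in> carrier M" "\<And>\<phi>. \<phi> \<in> module_hom R M E \<Longrightarrow> f \<phi> = \<phi> x"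
        using f by (auto simp: P_def)
      have "f \<phi> \<oplus>\<^bsub>E\<^esub> r \<odot>\<^bsub>E\<^esub> \<chi> \<phi> = \<phi> (x \<oplus>\<^bsub>M\<^esub> r \<odot>\<^bsub>M\<^esub> a)" if "\<phi> \<in> module_hom R M E" for \<phi>
        using linear_mapD(2,3)[OF module_homD(1)[OF that]] x ac r that by (simp add: a(2))
      moreover have "linear_map R ?D E (\<lambda>\<phi>. f \<phi> \<oplus>\<^bsub>E\<^esub> r \<odot>\<^bsub>E\<^esub> \<chi> \<phi>)"
        using f unfolding a(2) P_def
        by (intro linear_map_add linear_map_smult linear_map_eval E.module_axioms r ac) auto
      moreover have "x \<oplus>\<^bsub>M\<^esub> r \<odot>\<^bsub>M\<^esub> a \<in> carrier M" using x(1) ac r by simp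
      ultimately show ?thesis unfolding P_def by blast
    qed
    show "linear_map R ?D E f" if "P f" for f using that by (simp add: P_def)
  qed
  then show "\<exists>x \<in> carrier M. \<forall>\<phi> \<in> module_hom R M E. \<Lambda> \<phi> = \<phi> x" by (auto simp: P_def)
qed

section \<open>Duals of finitely generated and of artinian modules\<close>

text \<open>A submodule of \<open>E\<close> is determined by its annihilator: a point outside is
  separated from it by an endomorphism of \<open>E\<close>, which is a scalar annihilating the
  submodule but not the point. So descending chains of submodules are controlled by ascending chains
  of ideals.\<close>

lemma artinian_E: "artinian R E"
  unfolding artinian_def
proof (intro allI impI)
  fix X :: "nat \<Rightarrow> 'e set"
  assume X: "(\<forall>i. submodule (X i) R E) \<and> (\<forall>i. X (Suc i) \<subseteq> X i)"
  have Xc: "x \<in> carrier E" if "x \<in> X i" for x i using X that E.submoduleE(1) by blast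
  define I where "I i = {r \<in> carrier R. \<forall>x \<in> X i. r \<odot>\<^bsub>E\<^esub> x = \<zero>\<^bsub>E\<^esub>}" for i
  have "\<exists>n. \<forall>k \<ge> n. I k = I n"
  proof (rule ideal_acc)
    show "ideal (I n) R" for n
      by (rule idealI_left) (use Xc in \<open>auto simp: I_def E.smult_l_distr E.smult_assoc1\<close>)
    show "I n \<subseteq> I (Suc n)" for n using X by (auto simp: I_def)
  qed
  then obtain n where n: "\<And>k. k \<ge> n \<Longrightarrow> I k = I n" by blast
  have "X k = X n" if k: "k \<ge> n" for k
  proof
    show "X k \<subseteq> X n" using X k lift_Suc_antimono_le[of X] by blast
    show "X n \<subseteq> X k"
    proof (rule subsetI, rule ccontr)
      fix x assume x: "x \<in> X n" "x \<notin> X k"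
      obtain h where h: "h \<in> module_hom R E E" "\<And>y. y \<in> X k \<Longrightarrow> h y = \<zero>\<^bsub>E\<^esub>" "h x = e0"
        using separating[OF E.module_axioms _ Xc[OF x(1)] x(2)] X by blast
      obtain r where r: "r \<in> carrier R" "\<And>y. y \<in> carrier E \<Longrightarrow> h y = r \<odot>\<^bsub>E\<^esub> y"
        using endo_scalar[OF h(1)] by blast
      have "r \<in> I k" using h(2) r Xc by (simp add: I_def)
      then have "r \<in> I n" using n[OF k] by simp
      then have "r \<odot>\<^bsub>E\<^esub> x = \<zero>\<^bsub>E\<^esub>" using x(1) by (simp add: I_def)
      then show False using h(3) r(2)[OF Xc[OF x(1)]] e0 by simp
    qed
  qed
  then show "\<exists>n. \<forall>i \<ge> n. X i = X n" by blast
qed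

text \<open>Finitely many functionals map \<open>T\<close> to a power of \<open>E\<close>; the
  artinian condition is transferred along this map without forming the power. The induction uses
  that a chain is stationary once its images under one functional and its intersections with the
  kernel of that functional are.\<close>

lemma joint_kernel_stable:
  assumes T: "module R T" and fin: "finite \<Phi>" and \<Phi>: "\<And>\<phi>. \<phi> \<in> \<Phi> \<Longrightarrow> linear_map R T E \<phi>"
    and X: "\<And>i :: nat. submodule (X i) R T" "\<And>i. X (Suc i) \<subseteq> X i"
    and st: "\<exists>n. \<forall>i \<ge> n. X i \<inter> {x. \<forall>\<phi> \<in> \<Phi>. \<phi> x = \<zero>\<^bsub>E\<^esub>} = X n \<inter> {x. \<forall>\<phi> \<in> \<Phi>. \<phi> x = \<zero>\<^bsub>E\<^esub>}"
  shows "\<exists>n. \<forall>i \<ge> n. X i = X n"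
  using fin \<Phi> X st
proof (induction \<Phi> arbitrary: X)
  case empty
  then show ?case by simp
next
  case (insert \<phi> \<Phi>)
  interpret T: module R T by fact
  have \<phi>: "linear_map R T E \<phi>" using insert.prems(1) by simp
  define Y where "Y i = X i \<inter> {x \<in> carrier T. \<phi> x = \<zero>\<^bsub>E\<^esub>}" for i
  have Xc: "x \<in> carrier T" if "x \<in> X i" for x i using T.submoduleE(1)[OF insert.prems(2)] that by blast
  have anti: "X j \<subseteq> X i" if "i \<le> j" for i j
    using lift_Suc_antimono_le[of X, OF insert.prems(3) that] .
  have "\<exists>n. \<forall>i \<ge> n. Y i = Y n"
  proof (rule insert.IH)
    show "submodule (Y i) R T" for i
      unfolding Y_def by (intro submodule_Int T insert.prems submodule_kernel[OF T E.module_axioms \<phi>])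
    show "Y (Suc i) \<subseteq> Y i" for i using insert.prems(3) by (auto simp: Y_def)
    have "Y i \<inter> {x. \<forall>\<phi> \<in> \<Phi>. \<phi> x = \<zero>\<^bsub>E\<^esub>} = X i \<inter> {x. \<forall>\<chi> \<in> insert \<phi> \<Phi>. \<chi> x = \<zero>\<^bsub>E\<^esub>}" for i
      using Xc by (auto simp: Y_def)
    then show "\<exists>n. \<forall>i \<ge> n. Y i \<inter> {x. \<forall>\<phi> \<in> \<Phi>. \<phi> x = \<zero>\<^bsub>E\<^esub>} = Y n \<inter> {x. \<forall>\<phi> \<in> \<Phi>. \<phi> x = \<zero>\<^bsub>E\<^esub>}"
      using insert.prems(4) by simp
  qed (use insert.prems in auto)
  then obtain n where n: "\<And>i. i \<ge> n \<Longrightarrow> Y i = Y n" by blast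
  have "\<exists>n. \<forall>i \<ge> n. \<phi> ` X i = \<phi> ` X n"
    using artinian_E[unfolded artinian_def, rule_format, of "\<lambda>i. \<phi> ` X i"]
      submodule_image[OF T E.module_axioms \<phi> insert.prems(2)] insert.prems(3) by blast
  then obtain m where m: "\<And>i. i \<ge> m \<Longrightarrow> \<phi> ` X i = \<phi> ` X m" by blast
  \<comment> \<open>Beyond both stopping points an element \<open>x\<close> of \<open>X l\<close>
    has the same image as some \<open>y\<close> in \<open>X i\<close>, and their difference lies in
    the kernel part, which no longer changes.\<close>
  define l where "l = max m n"
  have "X i = X l" if i: "i \<ge> l" for i
  proof
    show "X i \<subseteq> X l" by (rule anti[OF i])
    show "X l \<subseteq> X i"
    proof
      fix x assume x: "x \<in> X l"
      have "\<phi> ` X l = \<phi> ` X i" using m[of l] m[of i] i by (simp add: l_def)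
      then obtain y where y: "y \<in> X i" "\<phi> x = \<phi> y" using x by (metis imageE imageI)
      have yl: "y \<in> X l" using y anti[OF i] by blast
      have "\<ominus>\<^bsub>T\<^esub> y \<in> X l" using T.submoduleE(3)[OF insert.prems(2) yl] .
      then have d: "x \<ominus>\<^bsub>T\<^esub> y \<in> X l"
        using T.submoduleE(5)[OF insert.prems(2) x] by (simp add: T.minus_eq)
      have "\<phi> (x \<ominus>\<^bsub>T\<^esub> y) = \<zero>\<^bsub>E\<^esub>"
        using linear_map_minus[OF T E.module_axioms \<phi> Xc[OF x] Xc[OF yl]] y(2)
          linear_mapD(1)[OF \<phi> Xc[OF yl]] by (simp add: E.minus_eq E.M.r_neg)
      then have "x \<ominus>\<^bsub>T\<^esub> y \<in> Y l" using d Xc by (auto simp: Y_def)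
      also have "Y l = Y i" using n[of l] n[of i] i by (simp add: l_def)
      finally have "x \<ominus>\<^bsub>T\<^esub> y \<in> X i" by (simp add: Y_def)
      then have "(x \<ominus>\<^bsub>T\<^esub> y) \<oplus>\<^bsub>T\<^esub> y \<in> X i" using T.submoduleE(5)[OF insert.prems(2)] y(1) by blast
      then show "x \<in> X i" using Xc[OF x] Xc[OF yl] by (simp add: T.minus_eq T.M.a_assoc T.M.l_neg)
    qed
  qed
  then show ?case by blast
qed

lemma dual_artinian:
  assumes M: "module R M" and fg: "finitely_generated R M"
  shows "artinian R (hom_module R M E)"
  unfolding artinian_def
proof (intro allI impI)
  let ?D = "hom_module R M E"
  interpret D: module R ?D by (rule dual_module[OF M])
  fix X :: "nat \<Rightarrow> _"
  assume X: "(\<forall>i. submodule (X i) R ?D) \<and> (\<forall>i. X (Suc i) \<subseteq> X i)"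
  obtain A where A: "finite A" "A \<subseteq> carrier M"
    "\<And>K. submodule K R M \<Longrightarrow> A \<subseteq> K \<Longrightarrow> K = carrier M"
    using fg by (auto simp: finitely_generated_def)
  have z: "X i \<inter> {\<phi>. \<forall>\<chi> \<in> (\<lambda>x \<phi>. \<phi> x) ` A. \<chi> \<phi> = \<zero>\<^bsub>E\<^esub>} = {\<zero>\<^bsub>?D\<^esub>}" for i
  proof -
    have "\<phi> \<in> module_hom R M E" if "\<phi> \<in> X i" for \<phi>
      using X D.submoduleE(1)[of "X i"] that by auto
    moreover have "\<zero>\<^bsub>?D\<^esub> \<in> X i" using X submodule_zero by blast
    ultimately show ?thesis using dual_generators[OF M A(2,3)] A(2) by fastforce
  qed
  show "\<exists>n. \<forall>i \<ge> n. X i = X n"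
    by (rule joint_kernel_stable[OF D.module_axioms, of "(\<lambda>x \<phi>. \<phi> x) ` A"])
      (use A(1,2) X z in \<open>auto intro: linear_map_eval\<close>)
qed

lemma artinian_minimal:
  assumes "artinian R T" "K0 \<in> \<K>" "\<And>K. K \<in> \<K> \<Longrightarrow> submodule K R T"
  obtains K where "K \<in> \<K>" "\<And>K'. K' \<in> \<K> \<Longrightarrow> K' \<subseteq> K \<Longrightarrow> K' = K"
proof (rule ccontr)
  assume "\<not> thesis"
  then have "\<And>K. K \<in> \<K> \<Longrightarrow> \<exists>K'. K' \<in> \<K> \<and> K' \<subset> K" using that by blast
  then have "\<exists>f. \<forall>n :: nat. f n \<in> \<K> \<and> f (Suc n) \<subset> f n"
    using assms(2) by (intro dependent_nat_choice) blast+
  then obtain f :: "nat \<Rightarrow> _" where f: "\<And>n. f n \<in> \<K>" "\<And>n. f (Suc n) \<subset> f n" by blast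
  then have "\<exists>n. \<forall>i \<ge> n. f i = f n"
    using assms(1,3) unfolding artinian_def by (meson less_imp_le psubset_imp_subset)
  then show False using f(2) by (metis le_SucI order_refl psubset_eq)
qed

text \<open>Among the joint kernels of finite families take a minimal one. A nonzero element of it
  could be removed by adjoining a functional from \<open>separating_point\<close>, so it is zero and
  \<open>T\<close> embeds into a finite power of \<open>E\<close>.\<close>

lemma artinian_joint_family:
  assumes T: "module R T" and art: "artinian R T"
  obtains \<Phi> where "finite \<Phi>" "\<Phi> \<subseteq> module_hom R T E"
    "\<And>t. t \<in> carrier T \<Longrightarrow> (\<And>\<phi>. \<phi> \<in> \<Phi> \<Longrightarrow> \<phi> t = \<zero>\<^bsub>E\<^esub>) \<Longrightarrow> t = \<zero>\<^bsub>T\<^esub>"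
proof -
  interpret T: module R T by fact
  define K where "K \<Phi> = {t \<in> carrier T. \<forall>\<phi> \<in> \<Phi>. \<phi> t = \<zero>\<^bsub>E\<^esub>}" for \<Phi> :: "('b \<Rightarrow> 'e) set"
  have sub: "submodule (K \<Phi>) R T" if "\<Phi> \<subseteq> module_hom R T E" for \<Phi>
  proof -
    have *: "linear_map R T E \<phi>" if "\<phi> \<in> \<Phi>" for \<phi> using that \<open>\<Phi> \<subseteq> _\<close> by (auto simp: module_hom_iff)
    have K: "K \<Phi> = carrier T \<inter> (\<Inter>\<phi> \<in> \<Phi>. {t. \<phi> t = \<zero>\<^bsub>E\<^esub>})" by (auto simp: K_def)
    show ?thesis
    proof (rule submoduleI_smult[OF T])
      show "K \<Phi> \<subseteq> carrier T" "\<zero>\<^bsub>T\<^esub> \<in> K \<Phi>"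
        using linear_map_zero[OF T E.module_axioms *] by (auto simp: K_def)
      fix x assume x: "x \<in> K \<Phi>"
      show "x \<oplus>\<^bsub>T\<^esub> y \<in> K \<Phi>" if y: "y \<in> K \<Phi>" for y
        unfolding K
      proof (intro IntI INT_I CollectI)
        fix \<phi> assume \<phi>: "\<phi> \<in> \<Phi>"
        have "\<phi> x = \<zero>\<^bsub>E\<^esub>" "\<phi> y = \<zero>\<^bsub>E\<^esub>" using x y \<phi> by (auto simp: K_def)
        then show "\<phi> (x \<oplus>\<^bsub>T\<^esub> y) = \<zero>\<^bsub>E\<^esub>"
          using linear_mapD(2)[OF *[OF \<phi>], of x y] x y by (simp add: K_def)
      qed (use x y in \<open>simp add: K_def\<close>)
      show "r \<odot>\<^bsub>T\<^esub> x \<in> K \<Phi>" if r: "r \<in> carrier R" for r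
        unfolding K
      proof (intro IntI INT_I CollectI)
        fix \<phi> assume \<phi>: "\<phi> \<in> \<Phi>"
        have "\<phi> x = \<zero>\<^bsub>E\<^esub>" using x \<phi> by (auto simp: K_def)
        then show "\<phi> (r \<odot>\<^bsub>T\<^esub> x) = \<zero>\<^bsub>E\<^esub>"
          using linear_mapD(3)[OF *[OF \<phi>] r, of x] x r by (simp add: K_def)
      qed (use x r in \<open>simp add: K_def\<close>)
    qed
  qed
  let ?F = "{\<Phi>. finite \<Phi> \<and> \<Phi> \<subseteq> module_hom R T E}"
  obtain K0 where K0: "K0 \<in> K ` ?F" "\<And>K'. K' \<in> K ` ?F \<Longrightarrow> K' \<subseteq> K0 \<Longrightarrow> K' = K0"
    by (rule artinian_minimal[OF art, of "K {}" "K ` ?F"]) (use sub in auto)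
  then obtain \<Phi> where \<Phi>: "finite \<Phi>" "\<Phi> \<subseteq> module_hom R T E" "K0 = K \<Phi>" by blast
  have "t = \<zero>\<^bsub>T\<^esub>" if t: "t \<in> carrier T" "\<And>\<phi>. \<phi> \<in> \<Phi> \<Longrightarrow> \<phi> t = \<zero>\<^bsub>E\<^esub>" for t
  proof (rule ccontr)
    assume "t \<noteq> \<zero>\<^bsub>T\<^esub>"
    then obtain \<chi> where \<chi>: "\<chi> \<in> module_hom R T E" "\<chi> t = e0" using separating_point[OF T t(1)] by blast
    have "K (insert \<chi> \<Phi>) = K \<Phi>"
    proof (rule K0(2)[unfolded \<Phi>(3)])
      show "K (insert \<chi> \<Phi>) \<in> K ` ?F" by (rule imageI) (use \<Phi>(1,2) \<chi>(1) in simp)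
      show "K (insert \<chi> \<Phi>) \<subseteq> K \<Phi>" unfolding K_def by blast
    qed
    moreover have "t \<in> K \<Phi>" using t by (simp add: K_def)
    ultimately show False using \<chi>(2) e0 by (auto simp: K_def)
  qed
  then show thesis using that \<Phi>(1,2) by blast
qed

text \<open>A finite family with zero joint kernel generates the dual, since
  \<open>joint_kernel\<close> writes every functional as a combination of its members.\<close>

lemma dual_finitely_generated:
  assumes T: "module R T" and art: "artinian R T"
  shows "finitely_generated R (hom_module R T E)"
proof -
  let ?D = "hom_module R T E"
  interpret T: module R T by fact
  interpret D: module R ?D by (rule dual_module[OF T])
  obtain \<Phi> where \<Phi>: "finite \<Phi>" "\<Phi> \<subseteq> module_hom R T E"
    "\<And>t. t \<in> carrier T \<Longrightarrow> (\<And>\<phi>. \<phi> \<in> \<Phi> \<Longrightarrow> \<phi> t = \<zero>\<^bsub>E\<^esub>) \<Longrightarrow> t = \<zero>\<^bsub>T\<^esub>"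
    using artinian_joint_family[OF assms] by metis
  have "N = carrier ?D" if N: "submodule N R ?D" "\<Phi> \<subseteq> N" for N
  proof
    show "N \<subseteq> carrier ?D" by (rule D.submoduleE(1)[OF N(1)])
    show "carrier ?D \<subseteq> N"
    proof
      fix \<psi> assume \<psi>: "\<psi> \<in> carrier ?D"
      \<comment> \<open>The span is expressed by membership in a given submodule \<open>N\<close>
        that contains \<open>\<Phi>\<close>; restriction makes the combination, formed as a lambda
        term, an extensional function.\<close>
      define P where "P f \<longleftrightarrow> linear_map R T E f \<and> restrict f (carrier T) \<in> N" for f
      have "\<exists>f. P f \<and> (\<forall>t \<in> carrier T. \<psi> t = f t)"
      proof (rule joint_kernel[OF injective T T.carrier_is_submodule \<Phi>(1)])
        show "linear_map R T E \<phi>" if "\<phi> \<in> \<Phi>" for \<phi> using that \<Phi>(2) by (auto simp: module_hom_iff)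
        then have c: "\<phi> t \<in> carrier E" if "\<phi> \<in> \<Phi>" "t \<in> carrier T" for \<phi> t
          using that by (auto simp: linear_map_def)
        show \<psi>l: "linear_map R T E \<psi>" using \<psi> by (simp add: module_hom_iff)
        show "\<psi> t = \<zero>\<^bsub>E\<^esub>" if "t \<in> carrier T" "\<And>\<phi>. \<phi> \<in> \<Phi> \<Longrightarrow> \<phi> t = \<zero>\<^bsub>E\<^esub>" for t
          using \<Phi>(3)[of t] that linear_map_zero[OF T E.module_axioms \<psi>l] by simp
        show "\<exists>r\<in>carrier R. \<forall>t\<in>carrier T. h (\<phi> t) = r \<odot>\<^bsub>E\<^esub> \<phi> t"
          if "\<phi> \<in> \<Phi>" "h \<in> module_hom R E E" for \<phi> h
          using endo_scalar[OF that(2)] c[OF that(1)] by blast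
        show "P (\<lambda>t. \<zero>\<^bsub>E\<^esub>)"
          unfolding P_def using submodule_zero[OF N(1)] by (simp add: linear_map_null E.module_axioms)
        show "P (\<lambda>t. f t \<oplus>\<^bsub>E\<^esub> r \<odot>\<^bsub>E\<^esub> \<phi> t)"
          if f: "P f" and \<phi>: "\<phi> \<in> \<Phi>" and r: "r \<in> carrier R" for f \<phi> r
        proof -
          have "\<phi> \<in> N" using \<phi> N(2) by blast
          then have "r \<odot>\<^bsub>?D\<^esub> \<phi> \<in> N" by (rule D.submoduleE(4)[OF N(1) r])
          then have "restrict f (carrier T) \<oplus>\<^bsub>?D\<^esub> r \<odot>\<^bsub>?D\<^esub> \<phi> \<in> N"
            using f unfolding P_def by (intro D.submoduleE(5)[OF N(1)]) blast+
          moreover have "restrict f (carrier T) \<oplus>\<^bsub>?D\<^esub> r \<odot>\<^bsub>?D\<^esub> \<phi> = restrict (\<lambda>t. f t \<oplus>\<^bsub>E\<^esub> r \<odot>\<^bsub>E\<^esub> \<phi> t) (carrier T)"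
            by (auto simp: fun_eq_iff)
          moreover have "linear_map R T E (\<lambda>t. f t \<oplus>\<^bsub>E\<^esub> r \<odot>\<^bsub>E\<^esub> \<phi> t)"
            using f \<phi> \<Phi>(2) r unfolding P_def
            by (intro linear_map_add linear_map_smult E.module_axioms) (auto simp: module_hom_iff)
          ultimately show ?thesis by (simp add: P_def)
        qed
        show "linear_map R T E f" if "P f" for f using that by (simp add: P_def)
      qed
      then obtain f where f: "restrict f (carrier T) \<in> N" "\<And>t. t \<in> carrier T \<Longrightarrow> \<psi> t = f t"
        by (auto simp: P_def)
      have "\<psi> = restrict f (carrier T)"
        using f(2) \<psi> by (intro extensionalityI[of _ "carrier T"]) (auto simp: module_hom_iff)
      then show "\<psi> \<in> N" using f(1) by simp
    qed
  qed
  then show ?thesis using \<Phi>(1,2) by (auto simp: finitely_generated_def)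
qed

section \<open>The double dual\<close>

lemma eval_hom:
  assumes "module R M" "x \<in> carrier M"
  shows "(\<lambda>\<phi> \<in> carrier (hom_module R M E). \<phi> x) \<in> module_hom R (hom_module R M E) E"
  by (rule restrict_module_hom[OF dual_module[OF assms(1)] linear_map_eval[OF assms(2)]])

lemma linear_map_eval_dual:
  assumes M: "module R M"
  shows "linear_map R M (hom_module R (hom_module R M E) E) (\<lambda>x. \<lambda>\<phi> \<in> module_hom R M E. \<phi> x)"
proof (rule linear_mapI)
  show "(\<lambda>\<phi> \<in> module_hom R M E. \<phi> x) \<in> carrier (hom_module R (hom_module R M E) E)"
    if "x \<in> carrier M" for x using eval_hom[OF M that] by simp
qed (simp_all add: restrict_def fun_eq_iff linear_mapD(2,3)[OF module_homD(1)])

text \<open>A functional \<open>\<Lambda>\<close> on the dual that is no evaluation is separated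
  from all evaluations by some \<open>h\<close> on the double dual. Reflexivity of the dual makes
  \<open>h\<close> evaluation at some \<open>\<phi>\<close>, which then vanishes on
  \<open>M\<close>, so \<open>h\<close> is zero at \<open>\<Lambda>\<close>, a contradiction.
  Artinian modules need not have finitely many generators, but their duals do, and reflexivity is
  inherited from there.\<close>

lemma reflexive_of_dual:
  assumes M: "module R M" and refl: "reflexive (hom_module R M E)"
  shows "reflexive M"
  unfolding reflexive_def
proof
  let ?D = "hom_module R M E"
  let ?DD = "hom_module R ?D E"
  interpret M: module R M by fact
  interpret D: module R ?D by (rule dual_module[OF M])
  interpret DD: module R ?DD by (rule dual_module[OF D.module_axioms])
  let ?ev = "\<lambda>x. \<lambda>\<phi> \<in> module_hom R M E. \<phi> x"
  fix \<Lambda> assume \<Lambda>: "\<Lambda> \<in> module_hom R ?D E"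
  have "\<Lambda> \<in> ?ev ` carrier M"
  proof (rule ccontr)
    assume nin: "\<Lambda> \<notin> ?ev ` carrier M"
    have sub: "submodule (?ev ` carrier M) R ?DD"
      by (rule submodule_image[OF M DD.module_axioms linear_map_eval_dual[OF M] M.carrier_is_submodule])
    have "\<Lambda> \<in> carrier ?DD" using \<Lambda> by simp
    from separating[OF DD.module_axioms sub this nin] obtain h where h: "h \<in> module_hom R ?DD E" "\<And>x. x \<in> ?ev ` carrier M \<Longrightarrow> h x = \<zero>\<^bsub>E\<^esub>" "h \<Lambda> = e0" by blast
    obtain \<phi> where \<phi>: "\<phi> \<in> module_hom R M E" "\<And>\<Lambda>. \<Lambda> \<in> module_hom R ?D E \<Longrightarrow> h \<Lambda> = \<Lambda> \<phi>"
      using refl h(1) by (auto simp: reflexive_def)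
    have "\<phi> x = \<zero>\<^bsub>E\<^esub>" if "x \<in> carrier M" for x
      using h(2)[of "?ev x"] \<phi>(2)[of "?ev x"] eval_hom[OF M that] that \<phi>(1) by simp
    then have "\<phi> = \<zero>\<^bsub>?D\<^esub>"
      using \<phi>(1) by (intro extensionalityI[of _ "carrier M"]) (auto simp: module_hom_iff)
    then have "h \<Lambda> = \<zero>\<^bsub>E\<^esub>"
      using \<phi>(2)[OF \<Lambda>] linear_map_zero[OF D.module_axioms E.module_axioms module_homD(1)[OF \<Lambda>]] by simp
    then show False using h(3) e0 by simp
  qed
  then show "\<exists>x \<in> carrier M. \<forall>\<phi> \<in> module_hom R M E. \<Lambda> \<phi> = \<phi> x" by auto
qed

lemma artinian_reflexive:
  assumes "module R T" "artinian R T"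
  shows "reflexive T"
  using reflexive_of_dual[OF assms(1) finitely_generated_reflexive[OF dual_module[OF assms(1)]
    dual_finitely_generated[OF assms]]] .

lemma reflexive_isomorphic:
  assumes M: "module R M" and refl: "reflexive M"
  shows "module_isomorphic R M (hom_module R (hom_module R M E) E)"
proof (rule module_isomorphicI[OF M linear_map_eval_dual[OF M]])
  let ?ev = "\<lambda>x. \<lambda>\<phi> \<in> module_hom R M E. \<phi> x"
  show "bij_betw ?ev (carrier M) (carrier (hom_module R (hom_module R M E) E))"
    unfolding bij_betw_def
  proof
    show "inj_on ?ev (carrier M)"
    proof (rule inj_onI)
      fix x y assume xy: "x \<in> carrier M" "y \<in> carrier M" and eq: "?ev x = ?ev y"
      show "x = y"
      proof (rule dual_separates[OF M xy])
        show "\<phi> x = \<phi> y" if "\<phi> \<in> module_hom R M E" for \<phi> using fun_cong[OF eq, of \<phi>] that by simp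
      qed
    qed
    have "\<Lambda> \<in> ?ev ` carrier M" if \<Lambda>: "\<Lambda> \<in> module_hom R (hom_module R M E) E" for \<Lambda>
    proof -
      obtain x where x: "x \<in> carrier M" "\<And>\<phi>. \<phi> \<in> module_hom R M E \<Longrightarrow> \<Lambda> \<phi> = \<phi> x"
        using refl \<Lambda> by (auto simp: reflexive_def)
      have "\<Lambda> = ?ev x"
        using x(2) module_homD(2)[OF \<Lambda>] by (intro extensionalityI[of _ "module_hom R M E"]) auto
      then show ?thesis using x(1) by blast
    qed
    then show "?ev ` carrier M = carrier (hom_module R (hom_module R M E) E)"
      using eval_hom[OF M] by auto
  qed
qed

text \<open>By reflexivity an endomorphism \<open>f\<close> of the dual is the transpose of a map
  \<open>g\<close>: for fixed \<open>x\<close>, sending \<open>\<phi>\<close> to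
  \<open>f \<phi> x\<close> is a functional on the dual, hence evaluation at a point
  \<open>g x\<close>. Since functionals separate points, \<open>g\<close> is linear, and it is
  multiplication by \<open>r\<close> exactly when \<open>f\<close> is.\<close>

lemma dual_homothetic:
  assumes M: "module R M" and refl: "reflexive M" and hom: "homothetic R M"
  shows "homothetic R (hom_module R M E)"
  unfolding homothetic_def
proof
  let ?D = "hom_module R M E"
  interpret M: module R M by fact
  interpret D: module R ?D by (rule dual_module[OF M])
  fix f assume f: "f \<in> module_hom R ?D ?D"
  note fl = linear_mapD[OF module_homD(1)[OF f], simplified]
  have "\<exists>y \<in> carrier M. \<forall>\<phi> \<in> module_hom R M E. f \<phi> x = \<phi> y" if x: "x \<in> carrier M" for x
  proof -
    have "(\<lambda>\<phi> \<in> carrier ?D. f \<phi> x) \<in> module_hom R ?D E"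
      by (intro restrict_module_hom D.module_axioms linear_map_comp[OF module_homD(1)[OF f] linear_map_eval[OF x]])
    then show ?thesis using refl by (fastforce simp: reflexive_def)
  qed
  then have "\<forall>x \<in> carrier M. \<exists>y. y \<in> carrier M \<and> (\<forall>\<phi> \<in> module_hom R M E. f \<phi> x = \<phi> y)" by blast
  from bchoice[OF this] obtain g where
    g: "\<And>x. x \<in> carrier M \<Longrightarrow> g x \<in> carrier M"
      "\<And>x \<phi>. x \<in> carrier M \<Longrightarrow> \<phi> \<in> module_hom R M E \<Longrightarrow> f \<phi> x = \<phi> (g x)" by blast
  have E: "linear_map R M E (f \<phi>)" "linear_map R M E \<phi>" if "\<phi> \<in> module_hom R M E" for \<phi>
    using fl(1)[OF that] that by (simp_all add: module_hom_iff)
  have "linear_map R M M g"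
  proof (rule linear_mapI)
    fix x assume x: "x \<in> carrier M"
    show "g (x \<oplus>\<^bsub>M\<^esub> y) = g x \<oplus>\<^bsub>M\<^esub> g y" if y: "y \<in> carrier M" for y
    proof (rule dual_separates[OF M])
      fix \<phi> assume \<phi>: "\<phi> \<in> module_hom R M E"
      show "\<phi> (g (x \<oplus>\<^bsub>M\<^esub> y)) = \<phi> (g x \<oplus>\<^bsub>M\<^esub> g y)"
        using g(2)[OF _ \<phi>, of "x \<oplus>\<^bsub>M\<^esub> y"] g(2)[OF x \<phi>] g(2)[OF y \<phi>] x y g(1)
          linear_mapD(2)[OF E(1)[OF \<phi>]] linear_mapD(2)[OF E(2)[OF \<phi>]] by simp
    qed (use x y g(1) in auto)
    show "g (r \<odot>\<^bsub>M\<^esub> x) = r \<odot>\<^bsub>M\<^esub> g x" if r: "r \<in> carrier R" for r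
    proof (rule dual_separates[OF M])
      fix \<phi> assume \<phi>: "\<phi> \<in> module_hom R M E"
      show "\<phi> (g (r \<odot>\<^bsub>M\<^esub> x)) = \<phi> (r \<odot>\<^bsub>M\<^esub> g x)"
        using g(2)[OF _ \<phi>, of "r \<odot>\<^bsub>M\<^esub> x"] g(2)[OF x \<phi>] x r g(1)
          linear_mapD(3)[OF E(1)[OF \<phi>]] linear_mapD(3)[OF E(2)[OF \<phi>]] by simp
    qed (use x r g(1) in auto)
  qed (rule g(1))
  then have ex1: "\<exists>!r. r \<in> carrier R \<and> (\<forall>x \<in> carrier M. g x = r \<odot>\<^bsub>M\<^esub> x)"
    by (rule homotheticD[OF hom M])
  have eq: "(\<forall>\<phi> \<in> carrier ?D. f \<phi> = r \<odot>\<^bsub>?D\<^esub> \<phi>) \<longleftrightarrow> (\<forall>x \<in> carrier M. g x = r \<odot>\<^bsub>M\<^esub> x)"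
    if r: "r \<in> carrier R" for r
  proof (intro iffI ballI)
    fix x assume *: "\<forall>\<phi> \<in> carrier ?D. f \<phi> = r \<odot>\<^bsub>?D\<^esub> \<phi>" and x: "x \<in> carrier M"
    show "g x = r \<odot>\<^bsub>M\<^esub> x"
    proof (rule dual_separates[OF M])
      fix \<phi> assume \<phi>: "\<phi> \<in> module_hom R M E"
      have "\<phi> (g x) = (r \<odot>\<^bsub>?D\<^esub> \<phi>) x" using g(2)[OF x \<phi>] * \<phi> by simp
      then show "\<phi> (g x) = \<phi> (r \<odot>\<^bsub>M\<^esub> x)" using x r linear_mapD(3)[OF E(2)[OF \<phi>]] by simp
    qed (use x r g in auto)
  next
    fix \<phi> assume *: "\<forall>x \<in> carrier M. g x = r \<odot>\<^bsub>M\<^esub> x" and \<phi>: "\<phi> \<in> carrier ?D"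
    show "f \<phi> = r \<odot>\<^bsub>?D\<^esub> \<phi>"
      by (rule extensionalityI[of _ "carrier M"])
        (use \<phi> * r fl(1)[of \<phi>] g(2)[of _ \<phi>] linear_mapD(3)[OF E(2)[of \<phi>]] in \<open>auto dest: module_homD(2)\<close>)
  qed
  then show "\<exists>!r. r \<in> carrier R \<and> (\<forall>\<phi> \<in> carrier ?D. f \<phi> = r \<odot>\<^bsub>?D\<^esub> \<phi>)"
    using ex1 by (simp only: eq cong: conj_cong)
qed

end

section \<open>Vanishing of Ext into a dual module\<close>

text \<open>Inside the n-th free module F_n this is the image of F_(n+1), so it is syzygy number n +
  1 of \<open>M\<close>; F_0 modulo \<open>syzygies R M 0\<close> is \<open>M\<close>
  itself.\<close>

abbreviation syzygies ::
  "('a, 'r) ring_scheme \<Rightarrow> ('a, 'm) module \<Rightarrow> nat \<Rightarrow> (('a, 'm) res_gen \<Rightarrow> 'a) set" where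
  "syzygies R M n \<equiv> res_kernel R M n (res_basis R M n)"

lemma res_module_module: "module R M \<Longrightarrow> module R (res_module R M n)"
  unfolding res_module_def by (rule free_module_is_module) (rule module.axioms(1))

lemma syzygies_submodule:
  assumes M: "module R M"
  shows "submodule (syzygies R M n) R (res_module R M n)"
proof -
  let ?F = "free_module R UNIV"
  interpret M: plain_module R M using M by (rule plain_module.intro)
  interpret U: module R ?F by (rule free_module_is_module) (rule M.R.is_cring)
  note K = M.submodule_res_kernel[of n]
  show ?thesis
    using U.submoduleE(4,5)[OF K] submodule_zero[OF K]
    by (intro submoduleI_smult res_module_module M)
      (auto simp: res_module_def free_module_def res_kernel_def[of R M n "res_basis R M n"])
qed

lemma res_boundary_mem:
  assumes "module R M" "c \<in> carrier (res_module R M (Suc n))"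
  shows "res_boundary R c \<in> syzygies R M n"
  using plain_module.res_boundary_image[OF plain_module.intro[OF assms(1)], of n] assms(2) by blast

lemma res_boundary_linear:
  fixes M :: "('a, 'm) module"
  assumes M: "module R M"
  shows "linear_map R (res_module R M (Suc n)) (res_module R M n) (res_boundary R)"
proof -
  interpret M: plain_module R M using M by (rule plain_module.intro)
  let ?F = "free_module R (UNIV :: ('a, 'm) res_gen set)"
  interpret U: plain_module R ?F
    by (intro plain_module.intro free_module_is_module) (rule M.R.is_cring)
  have v: "syz_chain R \<in> res_basis R M (Suc n) \<rightarrow> carrier ?F"
    using M.syz_chain_res_basis[of n] U.submoduleE(1)[OF M.submodule_res_kernel[of n]] by blast
  show ?thesis
  proof (rule linear_mapI)
    fix x assume x: "x \<in> carrier (res_module R M (Suc n))"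
    show "res_boundary R x \<in> carrier (res_module R M n)"
      using res_boundary_mem[OF M x] by (auto simp: res_kernel_def res_module_def)
    note x' = x[unfolded res_module_def]
    show "res_boundary R (x \<oplus>\<^bsub>res_module R M (Suc n)\<^esub> y) = res_boundary R x \<oplus>\<^bsub>res_module R M n\<^esub> res_boundary R y"
      if y: "y \<in> carrier (res_module R M (Suc n))" for y
      using U.lin_ext_add[OF x' y[unfolded res_module_def] v]
      by (simp add: res_module_def res_boundary_def free_module_def)
    show "res_boundary R (r \<odot>\<^bsub>res_module R M (Suc n)\<^esub> x) = r \<odot>\<^bsub>res_module R M n\<^esub> res_boundary R x"
      if r: "r \<in> carrier R" for r
      using U.lin_ext_smult[OF r x' v] by (simp add: res_module_def res_boundary_def free_module_def)
  qed
qed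

lemma res_boundary_kernel:
  assumes "c \<in> carrier (res_module R M (Suc n))"
  shows "res_boundary R c = \<zero>\<^bsub>res_module R M n\<^esub> \<longleftrightarrow> c \<in> syzygies R M (Suc n)"
  using assms by (simp add: res_kernel_def res_module_def free_module_def)

lemma res_augmentation_linear:
  assumes M: "module R M"
  shows "linear_map R (res_module R M 0) M (res_augmentation R M)"
proof -
  interpret M: plain_module R M using M by (rule plain_module.intro)
  have v: "elt \<in> res_basis R M 0 \<rightarrow> carrier M" by auto
  show ?thesis
    unfolding res_augmentation_def res_module_def
    by (intro linear_mapI M.lin_ext_closed[OF _ v] M.lin_ext_add[OF _ _ v] M.lin_ext_smult[OF _ _ v])
qed

lemma res_augmentation_kernel:
  assumes "c \<in> carrier (res_module R M 0)"
  shows "res_augmentation R M c = \<zero>\<^bsub>M\<^esub> \<longleftrightarrow> c \<in> syzygies R M 0"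
  using assms by (simp add: res_kernel_def res_module_def)

section \<open>Ext as an extension problem\<close>

text \<open>A coset B + k equals \<open>B\<close> exactly when \<open>k\<close> lies in
  \<open>B\<close>; as \<open>K\<close> contains zero, at least one coset is present.\<close>

lemma quotient_module_trivial:
  assumes C: "module R C" and B: "submodule B R C" and K: "K \<subseteq> carrier C" "\<zero>\<^bsub>C\<^esub> \<in> K"
  shows "carrier (quotient_module (C\<lparr>carrier := K\<rparr>) B) = {\<zero>\<^bsub>quotient_module (C\<lparr>carrier := K\<rparr>) B\<^esub>} \<longleftrightarrow> K \<subseteq> B"
proof -
  interpret C: module R C by fact
  let ?C = "C\<lparr>carrier := K\<rparr>"
  note Bs = C.submoduleE[OF B] submodule_zero[OF B]
  have coset: "B +>\<^bsub>?C\<^esub> k = (\<lambda>b. b \<oplus>\<^bsub>C\<^esub> k) ` B" for k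
    by (auto simp: a_r_coset_def' )
  have carr: "carrier (quotient_module ?C B) = (\<lambda>k. (\<lambda>b. b \<oplus>\<^bsub>C\<^esub> k) ` B) ` K"
    by (auto simp: quotient_module_def A_RCOSETS_def' coset)
  have z: "\<zero>\<^bsub>quotient_module ?C B\<^esub> = B" by (simp add: quotient_module_def)
  show ?thesis
    unfolding carr z
  proof
    assume eq: "(\<lambda>k. (\<lambda>b. b \<oplus>\<^bsub>C\<^esub> k) ` B) ` K = {B}"
    show "K \<subseteq> B"
    proof
      fix k assume k: "k \<in> K"
      have "(\<lambda>b. b \<oplus>\<^bsub>C\<^esub> k) ` B \<in> {B}" unfolding eq[symmetric] by (rule imageI[OF k])
      moreover have "\<zero>\<^bsub>C\<^esub> \<oplus>\<^bsub>C\<^esub> k \<in> (\<lambda>b. b \<oplus>\<^bsub>C\<^esub> k) ` B" by (rule imageI[OF Bs(7)])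
      ultimately show "k \<in> B" using k K(1) by auto
    qed
  next
    assume KB: "K \<subseteq> B"
    have "(\<lambda>b. b \<oplus>\<^bsub>C\<^esub> k) ` B = B" if k: "k \<in> K" for k
    proof
      have kB: "k \<in> B" using k KB by blast
      show "(\<lambda>b. b \<oplus>\<^bsub>C\<^esub> k) ` B \<subseteq> B" using Bs(5) kB by blast
      show "B \<subseteq> (\<lambda>b. b \<oplus>\<^bsub>C\<^esub> k) ` B"
      proof
        fix b assume b: "b \<in> B"
        show "b \<in> (\<lambda>b. b \<oplus>\<^bsub>C\<^esub> k) ` B"
        proof (rule image_eqI)
          show "b \<oplus>\<^bsub>C\<^esub> \<ominus>\<^bsub>C\<^esub> k \<in> B" using Bs(3,5) b kB by blast
          show "b = b \<oplus>\<^bsub>C\<^esub> \<ominus>\<^bsub>C\<^esub> k \<oplus>\<^bsub>C\<^esub> k"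
            using subsetD[OF Bs(1) b] subsetD[OF Bs(1) kB] by (simp add: C.M.a_assoc C.M.l_neg)
        qed
      qed
    qed
    then show "(\<lambda>k. (\<lambda>b. b \<oplus>\<^bsub>C\<^esub> k) ` B) ` K = {B}" using K(2) by auto
  qed
qed

definition Ext_vanishes ::
  "('a, 'r) ring_scheme \<Rightarrow> nat \<Rightarrow> ('a, 'm) module \<Rightarrow> ('a, 'n) module \<Rightarrow> bool" where
  "Ext_vanishes R n M L \<longleftrightarrow> carrier (Ext R n M L) = {\<zero>\<^bsub>Ext R n M L\<^esub>}"

text \<open>\<open>s\<close> is any choice of preimages under \<open>d\<close>. It need not be
  linear, but by \<open>ker\<close> the value of \<open>f\<close> is independent of the choice, so
  \<open>f\<close> after \<open>s\<close> is linear on the image.\<close>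

lemma linear_map_descend:
  assumes A: "module R A" and B: "module R B" and L: "module R L"
    and d: "linear_map R A B d" and f: "linear_map R A L f"
    and ker: "\<And>a. a \<in> carrier A \<Longrightarrow> d a = \<zero>\<^bsub>B\<^esub> \<Longrightarrow> f a = \<zero>\<^bsub>L\<^esub>"
    and s: "\<And>z. z \<in> d ` carrier A \<Longrightarrow> s z \<in> carrier A \<and> d (s z) = z"
  shows "linear_map R (B\<lparr>carrier := d ` carrier A\<rparr>) L (\<lambda>z. f (s z))"
    and "\<And>a. a \<in> carrier A \<Longrightarrow> f (s (d a)) = f a"
proof -
  interpret A: module R A by fact
  interpret B: module R B by fact
  interpret L: module R L by fact
  note dl = linear_mapD[OF d] and fl = linear_mapD[OF f]
  have eq: "f a = f b" if ab: "a \<in> carrier A" "b \<in> carrier A" "d a = d b" for a b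
  proof -
    have "d (a \<ominus>\<^bsub>A\<^esub> b) = \<zero>\<^bsub>B\<^esub>"
      using linear_map_minus[OF A B d ab(1,2)] ab dl(1) by (simp add: B.minus_eq B.M.r_neg)
    then have z: "f a \<ominus>\<^bsub>L\<^esub> f b = \<zero>\<^bsub>L\<^esub>"
      using linear_map_minus[OF A L f ab(1,2)] ker[of "a \<ominus>\<^bsub>A\<^esub> b"] ab(1,2) by simp
    have "f a = (f a \<ominus>\<^bsub>L\<^esub> f b) \<oplus>\<^bsub>L\<^esub> f b"
      using fl(1) ab(1,2) by (simp add: L.minus_eq L.M.a_assoc L.M.l_neg)
    then show ?thesis using z fl(1) ab(2) by simp
  qed
  show *: "f (s (d a)) = f a" if "a \<in> carrier A" for a
    using s[of "d a"] that by (intro eq) auto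
  show "linear_map R (B\<lparr>carrier := d ` carrier A\<rparr>) L (\<lambda>z. f (s z))"
  proof (rule linear_mapI)
    fix z assume "z \<in> carrier (B\<lparr>carrier := d ` carrier A\<rparr>)"
    then obtain a where a: "a \<in> carrier A" "z = d a" by auto
    show "f (s z) \<in> carrier L" using a * fl(1) by simp
    show "f (s (r \<odot>\<^bsub>B\<lparr>carrier := d ` carrier A\<rparr>\<^esub> z)) = r \<odot>\<^bsub>L\<^esub> f (s z)" if r: "r \<in> carrier R" for r
      using *[of "r \<odot>\<^bsub>A\<^esub> a"] *[OF a(1)] a r dl(3) fl(3) by simp
    fix y assume "y \<in> carrier (B\<lparr>carrier := d ` carrier A\<rparr>)"
    then obtain b where b: "b \<in> carrier A" "y = d b" by auto
    show "f (s (z \<oplus>\<^bsub>B\<lparr>carrier := d ` carrier A\<rparr>\<^esub> y)) = f (s z) \<oplus>\<^bsub>L\<^esub> f (s y)"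
      using *[of "a \<oplus>\<^bsub>A\<^esub> b"] *[OF a(1)] *[OF b(1)] a b dl(2) fl(2) by simp
  qed
qed

text \<open>A cocycle of degree n + 1 vanishes on the kernel of F_(n+1) -> F_n, so it amounts to a
  map on the image, the syzygies in F_n; it is a coboundary exactly when that map extends to F_n.
  Later arguments see Ext only through this extension problem.\<close>

lemma Ext_vanishes_iff:
  fixes M :: "('a, 'm) module" and L :: "('a, 'n) module"
  assumes M: "module R M" and L: "module R L"
  shows "Ext_vanishes R (Suc n) M L \<longleftrightarrow>
    (\<forall>h. linear_map R ((res_module R M n)\<lparr>carrier := syzygies R M n\<rparr>) L h \<longrightarrow>
      (\<exists>g. linear_map R (res_module R M n) L g \<and> (\<forall>z \<in> syzygies R M n. g z = h z)))"
proof -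
  interpret M: plain_module R M using M by (rule plain_module.intro)
  interpret L: module R L by fact
  let ?F = "res_module R M" and ?Z = "syzygies R M" and ?d = "res_boundary R"
  let ?C = "ext_cochains R M L (Suc n)" and ?K = "ext_cocycles R M L (Suc n)"
    and ?B = "ext_coboundaries R M L (Suc n)"
  note F = res_module_module[OF M] and d = res_boundary_linear[OF M]
  note im = M.res_boundary_image
  have C: "?C = hom_module R (?F (Suc n)) L" by (simp add: ext_cochains_def)
  have mC: "module R (hom_module R (?F k) L)" for k by (rule hom_module_is_module[OF F L])
  have cob: "ext_coboundary R M k f = (\<lambda>c \<in> carrier (?F (Suc k)). f (?d c))" for k and f :: "_ \<Rightarrow> 'n"
    by (simp add: ext_coboundary_def)
  have B: "?B = ext_coboundary R M n ` module_hom R (?F n) L" by (simp add: ext_cochains_def)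
  have lin: "linear_map R (hom_module R (?F n) L) (hom_module R (?F (Suc n)) L) (ext_coboundary R M n)"
  proof (rule linear_mapI)
    show "ext_coboundary R M n f \<in> carrier (hom_module R (?F (Suc n)) L)"
      if "f \<in> carrier (hom_module R (?F n) L)" for f
      using that by (simp add: cob restrict_module_hom F linear_map_comp[OF d] module_homD(1))
  qed (use linear_mapD(1)[OF d] in \<open>simp_all add: cob restrict_def fun_eq_iff\<close>)
  have subB: "submodule ?B R ?C"
    using submodule_image[OF mC mC lin module.carrier_is_submodule[OF mC]] unfolding B C hom_module_simps(1) .
  have K: "?K = {f \<in> module_hom R (?F (Suc n)) L. \<forall>z \<in> ?Z (Suc n). f z = \<zero>\<^bsub>L\<^esub>}"
  proof -
    have "(\<lambda>c \<in> carrier (?F (Suc (Suc n))). f (?d c)) = (\<lambda>c \<in> carrier (?F (Suc (Suc n))). \<zero>\<^bsub>L\<^esub>) \<longleftrightarrow>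
      (\<forall>z \<in> ?Z (Suc n). f z = \<zero>\<^bsub>L\<^esub>)" for f
      by (auto simp: restrict_def fun_eq_iff im[of "Suc n", symmetric] simp del: res_basis.simps)
    then show ?thesis by (simp add: ext_cocycles_def ext_cochains_def cob del: res_basis.simps)
  qed
  have vanish: "Ext_vanishes R (Suc n) M L \<longleftrightarrow> ?K \<subseteq> ?B"
    unfolding Ext_vanishes_def Ext_def
  proof (rule quotient_module_trivial[OF _ subB])
    show "module R ?C" using mC by (simp add: C)
    show "?K \<subseteq> carrier ?C" by (auto simp: K C)
    show "\<zero>\<^bsub>?C\<^esub> \<in> ?K"
    proof -
      have "\<zero>\<^bsub>?C\<^esub> \<in> module_hom R (?F (Suc n)) L"
        using submodule_zero[OF module.carrier_is_submodule[OF mC]] by (simp add: C)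
      moreover have "?Z (Suc n) \<subseteq> carrier (?F (Suc n))"
        using module.submoduleE(1)[OF F syzygies_submodule[OF M]] .
      ultimately show ?thesis by (auto simp: K C)
    qed
  qed
  show ?thesis
    unfolding vanish
  proof (intro iffI allI impI)
    fix h assume KB: "?K \<subseteq> ?B" and h: "linear_map R ((?F n)\<lparr>carrier := ?Z n\<rparr>) L h"
    have dZ: "linear_map R (?F (Suc n)) ((?F n)\<lparr>carrier := ?Z n\<rparr>) ?d"
      by (rule linear_map_corestrict[OF d]) (use im[of n] in simp)
    have mZ: "module R ((?F n)\<lparr>carrier := ?Z n\<rparr>)" by (rule submodule_module[OF F syzygies_submodule[OF M]])
    define f where "f = (\<lambda>c \<in> carrier (?F (Suc n)). h (?d c))"
    have "f \<in> ?K"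
    proof -
      have "f \<in> module_hom R (?F (Suc n)) L"
        unfolding f_def by (rule restrict_module_hom[OF F linear_map_comp[OF dZ h]])
      moreover have "f z = \<zero>\<^bsub>L\<^esub>" if z: "z \<in> ?Z (Suc n)" for z
      proof -
        have zc: "z \<in> carrier (?F (Suc n))"
          using module.submoduleE(1)[OF F syzygies_submodule[OF M]] z by blast
        then have "?d z = \<zero>\<^bsub>?F n\<^esub>" using res_boundary_kernel z by blast
        then show ?thesis using linear_map_zero[OF mZ L h] zc by (simp add: f_def)
      qed
      ultimately show ?thesis unfolding K by blast
    qed
    then obtain g where g: "g \<in> module_hom R (?F n) L" "f = ext_coboundary R M n g"
      using KB unfolding B by blast
    have "g z = h z" if z: "z \<in> ?Z n" for z
    proof -
      obtain c where c: "c \<in> carrier (?F (Suc n))" "z = ?d c" using z im[of n] by blast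
      have "f c = g z" using g(2) c by (simp add: cob)
      then show ?thesis using c by (simp add: f_def)
    qed
    then show "\<exists>g. linear_map R (?F n) L g \<and> (\<forall>z \<in> ?Z n. g z = h z)" using module_homD(1)[OF g(1)] by blast
  next
    assume ext: "\<forall>h. linear_map R ((?F n)\<lparr>carrier := ?Z n\<rparr>) L h \<longrightarrow>
      (\<exists>g. linear_map R (?F n) L g \<and> (\<forall>z \<in> ?Z n. g z = h z))"
    show "?K \<subseteq> ?B"
    proof
      fix f assume "f \<in> ?K"
      then have f: "f \<in> module_hom R (?F (Suc n)) L" "\<And>z. z \<in> ?Z (Suc n) \<Longrightarrow> f z = \<zero>\<^bsub>L\<^esub>"
        unfolding K by blast+
      have ker: "f c = \<zero>\<^bsub>L\<^esub>" if "c \<in> carrier (?F (Suc n))" "?d c = \<zero>\<^bsub>?F n\<^esub>" for c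
        using f(2) res_boundary_kernel that by blast
      note des = linear_map_descend[OF F F L d module_homD(1)[OF f(1)] ker,
          of "inv_into (carrier (?F (Suc n))) ?d", unfolded im[of n]]
      have s: "inv_into (carrier (?F (Suc n))) ?d z \<in> carrier (?F (Suc n)) \<and>
          ?d (inv_into (carrier (?F (Suc n))) ?d z) = z" if "z \<in> ?Z n" for z
        using that im[of n] by (metis f_inv_into_f inv_into_into)
      obtain g where g: "linear_map R (?F n) L g"
        "\<And>z. z \<in> ?Z n \<Longrightarrow> g z = f (inv_into (carrier (?F (Suc n))) ?d z)"
        using ext des(1) s by blast
      let ?g = "restrict g (carrier (?F n))"
      have "f = ext_coboundary R M n ?g"
      proof (rule module_hom_eqI[OF f(1)])
        show "ext_coboundary R M n ?g \<in> module_hom R (?F (Suc n)) L"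
          using linear_mapD(1)[OF lin, of ?g] restrict_module_hom[OF F g(1)] by simp
        show "f c = ext_coboundary R M n ?g c" if c: "c \<in> carrier (?F (Suc n))" for c
          using des(2)[OF _ _ _ c] s g(2)[OF res_boundary_mem[OF M c]] linear_mapD(1)[OF d c] c
          by (simp add: cob)
      qed
      then show "f \<in> ?B" using restrict_module_hom[OF F g(1)] unfolding B by blast
    qed
  qed
qed

section \<open>Bilinear maps in place of tensor products\<close>

definition bilinear_map :: "('a, 'r) ring_scheme \<Rightarrow> ('a, 'm) module \<Rightarrow> ('a, 'n) module
     \<Rightarrow> ('a, 'l) module \<Rightarrow> ('m \<Rightarrow> 'n \<Rightarrow> 'l) \<Rightarrow> bool" where
  "bilinear_map R A B L \<beta> \<longleftrightarrow> (\<forall>a \<in> carrier A. linear_map R B L (\<beta> a)) \<and>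
     (\<forall>b \<in> carrier B. linear_map R A L (\<lambda>a. \<beta> a b))"

lemma bilinear_mapD:
  assumes "bilinear_map R A B L \<beta>"
  shows "a \<in> carrier A \<Longrightarrow> linear_map R B L (\<beta> a)" "b \<in> carrier B \<Longrightarrow> linear_map R A L (\<lambda>a. \<beta> a b)"
  using assms by (simp_all add: bilinear_map_def)

lemma bilinear_map_swap: "bilinear_map R A B L \<beta> \<Longrightarrow> bilinear_map R B A L (\<lambda>b a. \<beta> a b)"
  by (simp add: bilinear_map_def)

lemma bilinear_map_restrict:
  "bilinear_map R A B L \<beta> \<Longrightarrow> Z \<subseteq> carrier A \<Longrightarrow> bilinear_map R (A\<lparr>carrier := Z\<rparr>) B L \<beta>"
  by (auto simp: bilinear_map_def intro: linear_map_restrict)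

lemma bilinear_map_comp:
  assumes "bilinear_map R A B L \<beta>" "linear_map R A' A f"
  shows "bilinear_map R A' B L (\<lambda>a. \<beta> (f a))"
  using assms linear_map_comp[OF assms(2) bilinear_mapD(2)[OF assms(1)]] linear_mapD(1)[OF assms(2)]
  by (simp add: bilinear_map_def)

lemma bilinear_map_diff:
  assumes "module R A" "module R B" "module R L" "bilinear_map R A B L \<beta>" "bilinear_map R A B L \<gamma>"
  shows "bilinear_map R A B L (\<lambda>a b. \<beta> a b \<ominus>\<^bsub>L\<^esub> \<gamma> a b)"
  using assms linear_map_diff[OF assms(1,3)] linear_map_diff[OF assms(2,3)]
  by (simp add: bilinear_map_def)

lemma bilinear_map_descend:
  assumes A: "module R A" and B: "module R B" and L: "module R L"
    and d: "linear_map R A B d" and \<beta>: "bilinear_map R A C L \<beta>"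
    and ker: "\<And>a c. a \<in> carrier A \<Longrightarrow> d a = \<zero>\<^bsub>B\<^esub> \<Longrightarrow> c \<in> carrier C \<Longrightarrow> \<beta> a c = \<zero>\<^bsub>L\<^esub>"
  obtains \<gamma> where "bilinear_map R (B\<lparr>carrier := d ` carrier A\<rparr>) C L \<gamma>"
    "\<And>a c. a \<in> carrier A \<Longrightarrow> c \<in> carrier C \<Longrightarrow> \<gamma> (d a) c = \<beta> a c"
proof -
  define s where "s = inv_into (carrier A) d"
  have s: "s z \<in> carrier A \<and> d (s z) = z" if "z \<in> d ` carrier A" for z
    using that by (simp add: s_def f_inv_into_f inv_into_into)
  note des = linear_map_descend[OF A B L d bilinear_mapD(2)[OF \<beta>] ker s]
  show thesis
  proof
    show "bilinear_map R (B\<lparr>carrier := d ` carrier A\<rparr>) C L (\<lambda>z c. \<beta> (s z) c)"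
      unfolding bilinear_map_def using des(1) bilinear_mapD(1)[OF \<beta>] s by simp
    show "\<beta> (s (d a)) c = \<beta> a c" if "a \<in> carrier A" "c \<in> carrier C" for a c
      using des(2) that by simp
  qed
qed

lemma free_linear_eqI:
  assumes L: "module R L" and f: "linear_map R (free_module R X) L \<phi>" and g: "linear_map R (free_module R X) L \<psi>"
    and eq: "\<And>b. b \<in> X \<Longrightarrow> \<phi> (\<lambda>x. if x = b then \<one>\<^bsub>R\<^esub> else \<zero>\<^bsub>R\<^esub>) = \<psi> (\<lambda>x. if x = b then \<one>\<^bsub>R\<^esub> else \<zero>\<^bsub>R\<^esub>)"
    and k: "k \<in> carrier (free_module R X)"
  shows "\<phi> k = \<psi> k"
proof -
  interpret L: plain_module R L using L by (rule plain_module.intro)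
  let ?F = "free_module R X"
  interpret F: module R ?F by (rule free_module_is_module) (rule L.R.is_cring)
  have "\<phi> k = \<psi> k" if "finite A" "k \<in> carrier ?F" "{x. k x \<noteq> \<zero>\<^bsub>R\<^esub>} \<subseteq> A" for A k
    using that
  proof (induction A arbitrary: k)
    case empty
    then have "k = \<zero>\<^bsub>?F\<^esub>" by (auto simp: free_module_def)
    then show ?case
      using linear_map_zero[OF F.module_axioms L f] linear_map_zero[OF F.module_axioms L g] by simp
  next
    case (insert b A)
    note c = L.supp_free[OF insert.prems(1)]
    define k' where "k' = k(b := \<zero>\<^bsub>R\<^esub>)"
    have sub: "{x. k' x \<noteq> \<zero>\<^bsub>R\<^esub>} \<subseteq> {x. k x \<noteq> \<zero>\<^bsub>R\<^esub>}" by (auto simp: k'_def)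
    then have k': "k' \<in> carrier ?F"
      using insert.prems(1) finite_subset[OF sub] by (auto simp: free_module_def k'_def)
    have IH: "\<phi> k' = \<psi> k'" using insert.prems(2) by (intro insert.IH[OF k']) (auto simp: k'_def)
    show ?case
    proof (cases "b \<in> X")
      case False
      then have "k' = k" using insert.prems(1) by (auto simp: k'_def free_module_def)
      then show ?thesis using IH by simp
    next
      case True
      let ?\<delta> = "\<lambda>x. if x = b then \<one>\<^bsub>R\<^esub> else \<zero>\<^bsub>R\<^esub>"
      have \<delta>: "?\<delta> \<in> carrier ?F" using True by (auto simp: free_module_def)
      have k: "k = k' \<oplus>\<^bsub>?F\<^esub> k b \<odot>\<^bsub>?F\<^esub> ?\<delta>"
        using c(3) by (auto simp: free_module_def k'_def fun_eq_iff)
      have \<delta>': "k b \<odot>\<^bsub>?F\<^esub> ?\<delta> \<in> carrier ?F" using \<delta> c(3) by blast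
      have "\<phi> k = \<phi> k' \<oplus>\<^bsub>L\<^esub> k b \<odot>\<^bsub>L\<^esub> \<phi> ?\<delta>"
        by (subst k) (simp only: linear_mapD(2)[OF f k' \<delta>'] linear_mapD(3)[OF f c(3) \<delta>])
      moreover have "\<psi> k = \<psi> k' \<oplus>\<^bsub>L\<^esub> k b \<odot>\<^bsub>L\<^esub> \<psi> ?\<delta>"
        by (subst k) (simp only: linear_mapD(2)[OF g k' \<delta>'] linear_mapD(3)[OF g c(3) \<delta>])
      ultimately show ?thesis using IH eq[OF True] by simp
    qed
  qed
  then show ?thesis using L.supp_free(1)[OF k] k by blast
qed

text \<open>The dual form of flatness of a free module F: restriction of bilinear maps from F x G to
  F x Z is surjective. For each basis element the partial map on \<open>Z\<close> extends to
  \<open>G\<close> by injectivity, and freeness extends the choices linearly.\<close>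

lemma bilinear_free_extend:
  assumes E: "injective_module R E" and G: "module R G" and Z: "submodule Z R G"
    and \<beta>: "bilinear_map R (free_module R X) (G\<lparr>carrier := Z\<rparr>) E \<beta>"
  obtains \<gamma> where "bilinear_map R (free_module R X) G E \<gamma>"
    "\<And>f z. f \<in> carrier (free_module R X) \<Longrightarrow> z \<in> Z \<Longrightarrow> \<gamma> f z = \<beta> f z"
proof -
  interpret E: module R E using E by (rule injective_moduleD)
  let ?F = "free_module R X" and ?H = "hom_module R G E"
  interpret H: plain_module R ?H
    by (intro plain_module.intro hom_module_is_module G E.module_axioms)
  let ?\<delta> = "\<lambda>b x. if x = b then \<one>\<^bsub>R\<^esub> else \<zero>\<^bsub>R\<^esub>"
  have \<delta>: "?\<delta> b \<in> carrier ?F" if "b \<in> X" for b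
    using that by (auto simp: free_module_def)
  have "\<forall>b \<in> X. \<exists>h. h \<in> module_hom R G E \<and> (\<forall>z \<in> Z. h z = \<beta> (?\<delta> b) z)"
  proof
    fix b assume "b \<in> X"
    from injective_extend[OF E G Z bilinear_mapD(1)[OF \<beta> \<delta>[OF this]]]
    show "\<exists>h. h \<in> module_hom R G E \<and> (\<forall>z \<in> Z. h z = \<beta> (?\<delta> b) z)" by metis
  qed
  from bchoice[OF this] obtain v where
    "\<forall>b \<in> X. v b \<in> module_hom R G E \<and> (\<forall>z \<in> Z. v b z = \<beta> (?\<delta> b) z)" ..
  then have v: "\<And>b. b \<in> X \<Longrightarrow> v b \<in> module_hom R G E"
    "\<And>b z. b \<in> X \<Longrightarrow> z \<in> Z \<Longrightarrow> v b z = \<beta> (?\<delta> b) z" by simp_all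
  have vH: "v \<in> X \<rightarrow> carrier ?H" using v(1) by simp
  define \<gamma> where "\<gamma> = lin_ext R ?H v"
  have \<gamma>: "linear_map R ?F ?H \<gamma>"
    unfolding \<gamma>_def
    by (intro linear_mapI H.lin_ext_closed[OF _ vH] H.lin_ext_add[OF _ _ vH] H.lin_ext_smult[OF _ _ vH])
  have ev: "linear_map R ?F E (\<lambda>f. \<gamma> f x)" if "x \<in> carrier G" for x
    by (rule linear_map_comp[OF \<gamma> linear_map_eval[OF that]])
  have "bilinear_map R ?F G E \<gamma>"
    unfolding bilinear_map_def using ev linear_mapD(1)[OF \<gamma>] by (simp add: module_hom_iff)
  moreover have "\<gamma> f z = \<beta> f z" if f: "f \<in> carrier ?F" and z: "z \<in> Z" for f z
  proof (rule free_linear_eqI[OF E.module_axioms ev _ _ f])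
    show "z \<in> carrier G" using module.submoduleE(1)[OF G Z] z by blast
    show "linear_map R ?F E (\<lambda>f. \<beta> f z)" using bilinear_mapD(2)[OF \<beta>] z by simp
    show "\<gamma> (?\<delta> b) z = \<beta> (?\<delta> b) z" if b: "b \<in> X" for b
      using v(2)[OF b z] H.lin_ext_delta(2)[OF b vH] by (simp add: \<gamma>_def)
  qed
  ultimately show thesis by (rule that)
qed

text \<open>\<open>Tor\<^sub>1(F/Z, G/Z')\<^sup>\<or> = 0\<close>, expressed for free \<open>F\<close> without tensor products.\<close>

definition tor_dual_vanishes ::
  "('a, 'r) ring_scheme \<Rightarrow> ('a, 'e) module \<Rightarrow> ('a, 'f) module \<Rightarrow> 'f set
     \<Rightarrow> ('a, 'g) module \<Rightarrow> 'g set \<Rightarrow> bool" where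
  "tor_dual_vanishes R E F Z G Z' \<longleftrightarrow>
    (\<forall>\<beta>. bilinear_map R (F\<lparr>carrier := Z\<rparr>) G E \<beta> \<and> (\<forall>z \<in> Z. \<forall>z' \<in> Z'. \<beta> z z' = \<zero>\<^bsub>E\<^esub>) \<longrightarrow>
      (\<exists>\<gamma>. bilinear_map R F G E \<gamma> \<and> (\<forall>z \<in> Z. \<forall>g \<in> carrier G. \<gamma> z g = \<beta> z g) \<and>
        (\<forall>f \<in> carrier F. \<forall>z' \<in> Z'. \<gamma> f z' = \<zero>\<^bsub>E\<^esub>)))"

text \<open>The symmetry of Tor_1. Extend \<open>\<beta>\<close> to some \<open>\<gamma>\<close> on
  F x G; restricted to Z x G it vanishes along \<open>Z'\<close>, so the hypothesis gives
  \<open>\<delta>\<close> that agrees with \<open>\<gamma>\<close> on Z x G and vanishes on F x Z'.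
  The difference of \<open>\<gamma>\<close> and \<open>\<delta>\<close> still extends
  \<open>\<beta>\<close> and vanishes along \<open>Z\<close>.\<close>

lemma tor_dual_swap:
  assumes E: "injective_module R E" and F: "F = free_module R X" and G: "module R G"
    and Z: "submodule Z R F" and Z': "submodule Z' R G"
    and hyp: "tor_dual_vanishes R E F Z G Z'"
  shows "tor_dual_vanishes R E G Z' F Z"
  unfolding tor_dual_vanishes_def
proof (intro allI impI)
  interpret E: module R E using E by (rule injective_moduleD)
  interpret G: module R G by (rule G)
  have mF: "module R F" unfolding F by (rule free_module_is_module[OF module.axioms(1)[OF G]])
  interpret F: module R F by (rule mF)
  fix \<beta> assume "bilinear_map R (G\<lparr>carrier := Z'\<rparr>) F E \<beta> \<and> (\<forall>z\<in>Z'. \<forall>z'\<in>Z. \<beta> z z' = \<zero>\<^bsub>E\<^esub>)"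
  then have \<beta>: "bilinear_map R F (G\<lparr>carrier := Z'\<rparr>) E (\<lambda>f z. \<beta> z f)"
    and \<beta>0: "\<And>z z'. z \<in> Z' \<Longrightarrow> z' \<in> Z \<Longrightarrow> \<beta> z z' = \<zero>\<^bsub>E\<^esub>"
    using bilinear_map_swap by blast+
  have Zc: "Z \<subseteq> carrier F" "Z' \<subseteq> carrier G" using F.submoduleE(1)[OF Z] G.submoduleE(1)[OF Z'] .
  obtain \<gamma> where \<gamma>: "bilinear_map R F G E \<gamma>" "\<And>f z. f \<in> carrier F \<Longrightarrow> z \<in> Z' \<Longrightarrow> \<gamma> f z = \<beta> z f"
    using bilinear_free_extend[OF E G Z', of X "\<lambda>f z. \<beta> z f"] \<beta> unfolding F by blast
  have "\<exists>\<delta>. bilinear_map R F G E \<delta> \<and> (\<forall>z\<in>Z. \<forall>g\<in>carrier G. \<delta> z g = \<gamma> z g) \<and>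
      (\<forall>f\<in>carrier F. \<forall>z'\<in>Z'. \<delta> f z' = \<zero>\<^bsub>E\<^esub>)"
    by (rule hyp[unfolded tor_dual_vanishes_def, rule_format])
      (use bilinear_map_restrict[OF \<gamma>(1) Zc(1)] \<gamma>(2) \<beta>0 Zc in auto)
  then obtain \<delta> where \<delta>: "bilinear_map R F G E \<delta>" "\<And>z g. z \<in> Z \<Longrightarrow> g \<in> carrier G \<Longrightarrow> \<delta> z g = \<gamma> z g"
    "\<And>f z'. f \<in> carrier F \<Longrightarrow> z' \<in> Z' \<Longrightarrow> \<delta> f z' = \<zero>\<^bsub>E\<^esub>" by blast
  let ?\<epsilon> = "\<lambda>g f. \<gamma> f g \<ominus>\<^bsub>E\<^esub> \<delta> f g"
  have c: "\<gamma> f g \<in> carrier E" if "f \<in> carrier F" "g \<in> carrier G" for f g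
    using linear_mapD(1)[OF bilinear_mapD(1)[OF \<gamma>(1) that(1)] that(2)] .
  have "bilinear_map R G F E ?\<epsilon>"
    by (intro bilinear_map_swap[OF bilinear_map_diff] F.module_axioms G E.module_axioms \<gamma> \<delta>)
  moreover have "?\<epsilon> z f = \<beta> z f" if "z \<in> Z'" "f \<in> carrier F" for z f
    using \<gamma>(2)[OF that(2,1)] \<delta>(3)[OF that(2,1)] c[of f z] that Zc by (auto simp: E.minus_eq)
  moreover have "?\<epsilon> g z = \<zero>\<^bsub>E\<^esub>" if "g \<in> carrier G" "z \<in> Z" for g z
    using \<delta>(2)[OF that(2,1)] c[of z g] that Zc by (auto simp: E.minus_eq E.M.r_neg)
  ultimately show "\<exists>\<epsilon>. bilinear_map R G F E \<epsilon> \<and> (\<forall>z\<in>Z'. \<forall>g\<in>carrier F. \<epsilon> z g = \<beta> z g) \<and>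
      (\<forall>f\<in>carrier G. \<forall>z'\<in>Z. \<epsilon> f z' = \<zero>\<^bsub>E\<^esub>)" by blast
qed

text \<open>Both sides express \<open>Tor\<^sub>2(F/Z, G/Z') = 0\<close> when \<open>F1 \<rightarrow> Z\<close> and \<open>G1 \<rightarrow> Z'\<close> are free covers
  with kernels \<open>Z1\<close> and \<open>Z1'\<close>.\<close>

lemma tor_dual_shift:
  assumes E: "injective_module R E" and F: "F = free_module R X"
    and F1: "module R F1" and G: "module R G" and G1: "module R G1"
    and Z: "submodule Z R F" and Z': "submodule Z' R G"
    and d: "linear_map R F1 F d" "d ` carrier F1 = Z"
      "\<And>c. c \<in> carrier F1 \<Longrightarrow> d c = \<zero>\<^bsub>F\<^esub> \<longleftrightarrow> c \<in> Z1" and Z1: "Z1 \<subseteq> carrier F1"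
    and d': "linear_map R G1 G d'" "d' ` carrier G1 = Z'"
      "\<And>c. c \<in> carrier G1 \<Longrightarrow> d' c = \<zero>\<^bsub>G\<^esub> \<longleftrightarrow> c \<in> Z1'" and Z1': "Z1' \<subseteq> carrier G1"
    and hyp: "tor_dual_vanishes R E F Z G1 Z1'"
  shows "tor_dual_vanishes R E G Z' F1 Z1"
  unfolding tor_dual_vanishes_def
proof (intro allI impI)
  interpret E: module R E using E by (rule injective_moduleD)
  interpret G: module R G by (rule G)
  have mF: "module R F" unfolding F by (rule free_module_is_module[OF module.axioms(1)[OF G]])
  interpret F: module R F by (rule mF)
  let ?Z = "F\<lparr>carrier := Z\<rparr>" and ?Z' = "G\<lparr>carrier := Z'\<rparr>"
  have mZ: "module R ?Z" and mZ': "module R ?Z'"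
    using submodule_module[OF mF Z] submodule_module[OF G Z'] .
  have Zc: "Z \<subseteq> carrier F" "Z' \<subseteq> carrier G" using F.submoduleE(1)[OF Z] G.submoduleE(1)[OF Z'] .
  have d'Z: "linear_map R G1 ?Z' d'" by (rule linear_map_corestrict[OF d'(1)]) (simp add: d'(2))
  have dZ: "d c \<in> Z" if "c \<in> carrier F1" for c using that d(2) by blast
  have d'Zm: "d' c \<in> Z'" if "c \<in> carrier G1" for c using that d'(2) by blast
  fix \<beta> assume "bilinear_map R ?Z' F1 E \<beta> \<and> (\<forall>z\<in>Z'. \<forall>z'\<in>Z1. \<beta> z z' = \<zero>\<^bsub>E\<^esub>)"
  then have \<beta>: "bilinear_map R F1 ?Z' E (\<lambda>f z. \<beta> z f)"
    and \<beta>0: "\<And>z z'. z \<in> Z' \<Longrightarrow> z' \<in> Z1 \<Longrightarrow> \<beta> z z' = \<zero>\<^bsub>E\<^esub>"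
    using bilinear_map_swap by blast+
  \<comment> \<open>\<open>\<beta>\<close> vanishes along the kernel \<open>Z1\<close> of F1 -> Z,
    so it becomes a bilinear map on Z x Z'; pulled back along G1 -> Z' it vanishes along
    \<open>Z1'\<close>, which is the situation of the hypothesis.\<close>
  obtain \<beta>1 where \<beta>1: "bilinear_map R ?Z ?Z' E \<beta>1"
    "\<And>c z. c \<in> carrier F1 \<Longrightarrow> z \<in> Z' \<Longrightarrow> \<beta>1 (d c) z = \<beta> z c"
    by (rule bilinear_map_descend[OF F1 mF E.module_axioms d(1) \<beta>])
      (use d(2,3) \<beta>0 in auto)
  let ?\<beta>2 = "\<lambda>z g. \<beta>1 z (d' g)"
  have "bilinear_map R ?Z G1 E ?\<beta>2"
    using bilinear_map_swap[OF bilinear_map_comp[OF bilinear_map_swap[OF \<beta>1(1)] d'Z]] .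
  moreover have "?\<beta>2 z z' = \<zero>\<^bsub>E\<^esub>" if z: "z \<in> Z" "z' \<in> Z1'" for z z'
  proof -
    have "d' z' = \<zero>\<^bsub>?Z'\<^esub>" using z(2) Z1' d'(3) by auto
    then show ?thesis
      using linear_map_zero[OF mZ' E.module_axioms bilinear_mapD(1)[OF \<beta>1(1)], of z] z(1) by simp
  qed
  ultimately have "\<exists>\<delta>. bilinear_map R F G1 E \<delta> \<and> (\<forall>z\<in>Z. \<forall>g\<in>carrier G1. \<delta> z g = ?\<beta>2 z g) \<and>
      (\<forall>f\<in>carrier F. \<forall>z'\<in>Z1'. \<delta> f z' = \<zero>\<^bsub>E\<^esub>)"
    by (intro hyp[unfolded tor_dual_vanishes_def, rule_format]) auto
  then obtain \<delta> where \<delta>: "bilinear_map R F G1 E \<delta>"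
    "\<And>z g. z \<in> Z \<Longrightarrow> g \<in> carrier G1 \<Longrightarrow> \<delta> z g = \<beta>1 z (d' g)"
    "\<And>f z'. f \<in> carrier F \<Longrightarrow> z' \<in> Z1' \<Longrightarrow> \<delta> f z' = \<zero>\<^bsub>E\<^esub>" by blast
  \<comment> \<open>The extension \<open>\<delta>\<close> vanishes along \<open>Z1'\<close> and so
    descends from \<open>G1\<close> to \<open>Z'\<close>. As \<open>F\<close> is free, it then
    extends from F x Z' to F x G, and composing with \<open>d\<close> gives the map wanted.\<close>
  obtain \<delta>1 where \<delta>1: "bilinear_map R ?Z' F E \<delta>1"
    "\<And>g f. g \<in> carrier G1 \<Longrightarrow> f \<in> carrier F \<Longrightarrow> \<delta>1 (d' g) f = \<delta> f g"
    by (rule bilinear_map_descend[OF G1 G E.module_axioms d'(1) bilinear_map_swap[OF \<delta>(1)]])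
      (use d'(2,3) \<delta>(3) in auto)
  obtain \<epsilon> where \<epsilon>: "bilinear_map R F G E \<epsilon>" "\<And>f z. f \<in> carrier F \<Longrightarrow> z \<in> Z' \<Longrightarrow> \<epsilon> f z = \<delta>1 z f"
    using bilinear_free_extend[OF E G Z', of X "\<lambda>f z. \<delta>1 z f"] bilinear_map_swap[OF \<delta>1(1)]
    unfolding F by blast
  let ?\<gamma> = "\<lambda>g c. \<epsilon> (d c) g"
  have "bilinear_map R G F1 E ?\<gamma>"
    using bilinear_map_swap[OF bilinear_map_comp[OF \<epsilon>(1) d(1)]] .
  moreover have "?\<gamma> z c = \<beta> z c" if z: "z \<in> Z'" and c: "c \<in> carrier F1" for z c
  proof -
    obtain g where g: "g \<in> carrier G1" "z = d' g" using z d'(2) by blast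
    have "\<epsilon> (d c) z = \<delta> (d c) g" using \<epsilon>(2)[of "d c" z] \<delta>1(2)[of g "d c"] z g dZ[OF c] Zc(1) by auto
    also have "\<dots> = \<beta> z c" using \<delta>(2)[OF dZ[OF c] g(1)] \<beta>1(2)[OF c z] g by simp
    finally show ?thesis .
  qed
  moreover have "?\<gamma> g c = \<zero>\<^bsub>E\<^esub>" if "g \<in> carrier G" "c \<in> Z1" for g c
  proof -
    have "d c = \<zero>\<^bsub>F\<^esub>" using that(2) Z1 d(3) by blast
    then show ?thesis using linear_map_zero[OF mF E.module_axioms bilinear_mapD(2)[OF \<epsilon>(1) that(1)]] by simp
  qed
  ultimately show "\<exists>\<gamma>. bilinear_map R G F1 E \<gamma> \<and> (\<forall>z\<in>Z'. \<forall>g\<in>carrier F1. \<gamma> z g = \<beta> z g) \<and>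
      (\<forall>f\<in>carrier G. \<forall>z'\<in>Z1. \<gamma> f z' = \<zero>\<^bsub>E\<^esub>)" by blast
qed

section \<open>Symmetry of Ext into a dual module\<close>

text \<open>This is the vanishing of Tor_1 of syzygy number p of \<open>M\<close> and syzygy number
  q of \<open>N\<close>, number 0 being the module itself; it stands for Tor_(p+q+1)(M, N).\<close>

abbreviation syz_tor where
  "syz_tor R E M N p q \<equiv>
    tor_dual_vanishes R E (res_module R M p) (syzygies R M p) (res_module R N q) (syzygies R N q)"

lemma syz_tor_swap:
  assumes "injective_module R E" "module R M" "module R N" "syz_tor R E M N p q"
  shows "syz_tor R E N M q p"
  using tor_dual_swap[OF assms(1) res_module_def res_module_module[OF assms(3)]
    syzygies_submodule[OF assms(2)] syzygies_submodule[OF assms(3)] assms(4)] .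

lemma syz_tor_shift:
  assumes E: "injective_module R E" and M: "module R M" and N: "module R N"
    and hyp: "syz_tor R E M N (Suc p) q"
  shows "syz_tor R E M N p (Suc q)"
proof (rule tor_dual_shift[OF E res_module_def _ _ _ syzygies_submodule syzygies_submodule
      res_boundary_linear _ res_boundary_kernel _ res_boundary_linear _ res_boundary_kernel])
  \<comment> \<open>\<open>tor_dual_shift\<close> exchanges the two resolutions, so the hypothesis
    is swapped to match it.\<close>
  show "syz_tor R E N M q (Suc p)" by (rule syz_tor_swap[OF E M N hyp])
  show "syzygies R N (Suc q) \<subseteq> carrier (res_module R N (Suc q))"
    "syzygies R M (Suc p) \<subseteq> carrier (res_module R M (Suc p))"
    by (rule module.submoduleE(1)[OF res_module_module[OF N] syzygies_submodule[OF N]])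
      (rule module.submoduleE(1)[OF res_module_module[OF M] syzygies_submodule[OF M]])
  show "res_boundary R ` carrier (res_module R M (Suc p)) = syzygies R M p"
    "res_boundary R ` carrier (res_module R N (Suc q)) = syzygies R N q"
    by (rule plain_module.res_boundary_image[OF plain_module.intro[OF M]])
      (rule plain_module.res_boundary_image[OF plain_module.intro[OF N]])
qed (use M N in \<open>auto intro: res_module_module\<close>)

lemma syz_tor_total:
  assumes "injective_module R E" "module R M" "module R N"
  shows "syz_tor R E M N p q \<Longrightarrow> syz_tor R E M N 0 (p + q)"
proof (induction p arbitrary: q)
  case (Suc p)
  from Suc.IH[OF syz_tor_shift[OF assms Suc.prems]] show ?case by simp
qed simp

text \<open>The adjunction of Hom and tensor in bilinear form. As \<open>N\<close> is the free
  module \<open>?G\<close> modulo its syzygies, a map into Hom(N, E) is a bilinear map with second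
  argument in \<open>?G\<close> that vanishes along those syzygies; this turns the extension problem
  of \<open>Ext_vanishes_iff\<close> into that of \<open>tor_dual_vanishes\<close>.\<close>

lemma Ext_dual_vanishes_iff:
  assumes E: "injective_module R E" and M: "module R M" and N: "module R N"
  shows "Ext_vanishes R (Suc n) M (hom_module R N E) \<longleftrightarrow> syz_tor R E M N n 0"
proof -
  interpret E: module R E using E by (rule injective_moduleD)
  interpret N: plain_module R N using N by (rule plain_module.intro)
  let ?F = "res_module R M n" and ?Z = "syzygies R M n" and ?D = "hom_module R N E"
  let ?G = "res_module R N 0" and ?Z' = "syzygies R N 0" and ?a = "res_augmentation R N"
  note F = res_module_module[OF M] and G = res_module_module[OF N]
  note a = res_augmentation_linear[OF N]
  note im = N.res_augmentation_image
  have Z'c: "?Z' \<subseteq> carrier ?G" using module.submoduleE(1)[OF G syzygies_submodule[OF N]] .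
  have mZ: "module R (?F\<lparr>carrier := ?Z\<rparr>)" by (rule submodule_module[OF F syzygies_submodule[OF M]])
  have uncurry: "bilinear_map R A ?G E (\<lambda>f g. h f (?a g)) \<and>
      (\<forall>f \<in> carrier A. \<forall>z' \<in> ?Z'. h f (?a z') = \<zero>\<^bsub>E\<^esub>)"
    if h: "linear_map R A ?D h" for A :: "('a, 'f) module" and h
  proof -
    have "linear_map R N E (h f)" if "f \<in> carrier A" for f
      using linear_mapD(1)[OF h that] by (simp add: module_hom_iff)
    moreover have "linear_map R A E (\<lambda>f. h f x)" if "x \<in> carrier N" for x
      by (rule linear_map_comp[OF h linear_map_eval[OF that]])
    ultimately have b: "bilinear_map R A N E h" by (simp add: bilinear_map_def)
    have "h f (?a z') = \<zero>\<^bsub>E\<^esub>" if "f \<in> carrier A" "z' \<in> ?Z'" for f z'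
    proof -
      have "?a z' = \<zero>\<^bsub>N\<^esub>" using res_augmentation_kernel that(2) Z'c by blast
      then show ?thesis using linear_map_zero[OF N E.module_axioms bilinear_mapD(1)[OF b that(1)]] by simp
    qed
    then show ?thesis using bilinear_map_swap[OF bilinear_map_comp[OF bilinear_map_swap[OF b] a]] by blast
  qed
  have curry: "\<exists>h. linear_map R A ?D h \<and> (\<forall>f \<in> carrier A. \<forall>g \<in> carrier ?G. h f (?a g) = \<beta> f g)"
    if A: "module R A" and \<beta>: "bilinear_map R A ?G E \<beta>"
      and \<beta>0: "\<And>f z'. f \<in> carrier A \<Longrightarrow> z' \<in> ?Z' \<Longrightarrow> \<beta> f z' = \<zero>\<^bsub>E\<^esub>" for A :: "('a, 'f) module" and \<beta>
  proof -
    obtain \<gamma> where \<gamma>: "bilinear_map R (N\<lparr>carrier := ?a ` carrier ?G\<rparr>) A E \<gamma>"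
      "\<And>g f. g \<in> carrier ?G \<Longrightarrow> f \<in> carrier A \<Longrightarrow> \<gamma> (?a g) f = \<beta> f g"
      by (rule bilinear_map_descend[OF G N E.module_axioms a bilinear_map_swap[OF \<beta>]])
        (use \<beta>0 res_augmentation_kernel in blast)+
    have \<gamma>N: "bilinear_map R N A E \<gamma>" using \<gamma>(1) by (simp add: im)
    let ?h = "\<lambda>f. \<lambda>x \<in> carrier N. \<gamma> x f"
    have "linear_map R A ?D ?h"
    proof (rule linear_mapI)
      show "?h f \<in> carrier ?D" if "f \<in> carrier A" for f
        using restrict_module_hom[OF N bilinear_mapD(2)[OF \<gamma>N that]] by simp
      show "?h (f \<oplus>\<^bsub>A\<^esub> g) = ?h f \<oplus>\<^bsub>?D\<^esub> ?h g" if "f \<in> carrier A" "g \<in> carrier A" for f g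
        using linear_mapD(2)[OF bilinear_mapD(1)[OF \<gamma>N] that] by (simp add: restrict_def fun_eq_iff)
      show "?h (r \<odot>\<^bsub>A\<^esub> f) = r \<odot>\<^bsub>?D\<^esub> ?h f" if "r \<in> carrier R" "f \<in> carrier A" for r f
        using linear_mapD(3)[OF bilinear_mapD(1)[OF \<gamma>N] that] by (simp add: restrict_def fun_eq_iff)
    qed
    moreover have "?h f (?a g) = \<beta> f g" if "f \<in> carrier A" "g \<in> carrier ?G" for f g
      using \<gamma>(2)[OF that(2,1)] linear_mapD(1)[OF a that(2)] by simp
    ultimately show ?thesis by (intro exI[of _ ?h]) blast
  qed
  show ?thesis
    unfolding Ext_vanishes_iff[OF M hom_module_is_module[OF N E.module_axioms]]
  proof
    assume ext: "\<forall>h. linear_map R (?F\<lparr>carrier := ?Z\<rparr>) ?D h \<longrightarrow>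
      (\<exists>g. linear_map R ?F ?D g \<and> (\<forall>z \<in> ?Z. g z = h z))"
    show "syz_tor R E M N n 0"
      unfolding tor_dual_vanishes_def
    proof (intro allI impI, elim conjE)
      fix \<beta> assume \<beta>: "bilinear_map R (?F\<lparr>carrier := ?Z\<rparr>) ?G E \<beta>" "\<forall>z\<in>?Z. \<forall>z'\<in>?Z'. \<beta> z z' = \<zero>\<^bsub>E\<^esub>"
      have "\<exists>h. linear_map R (?F\<lparr>carrier := ?Z\<rparr>) ?D h \<and> (\<forall>z \<in> ?Z. \<forall>g \<in> carrier ?G. h z (?a g) = \<beta> z g)"
        using curry[OF mZ \<beta>(1)] \<beta>(2) by simp
      then obtain h where h: "linear_map R (?F\<lparr>carrier := ?Z\<rparr>) ?D h"
        "\<And>z g. z \<in> ?Z \<Longrightarrow> g \<in> carrier ?G \<Longrightarrow> h z (?a g) = \<beta> z g" by blast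
      obtain k where k: "linear_map R ?F ?D k" "\<And>z. z \<in> ?Z \<Longrightarrow> k z = h z" using ext h(1) by blast
      show "\<exists>\<gamma>. bilinear_map R ?F ?G E \<gamma> \<and> (\<forall>z\<in>?Z. \<forall>g\<in>carrier ?G. \<gamma> z g = \<beta> z g) \<and>
          (\<forall>f\<in>carrier ?F. \<forall>z'\<in>?Z'. \<gamma> f z' = \<zero>\<^bsub>E\<^esub>)"
        using uncurry[OF k(1)] k(2) h(2) by (intro exI[of _ "\<lambda>f g. k f (?a g)"]) simp
    qed
  next
    assume tor: "syz_tor R E M N n 0"
    show "\<forall>h. linear_map R (?F\<lparr>carrier := ?Z\<rparr>) ?D h \<longrightarrow>
      (\<exists>g. linear_map R ?F ?D g \<and> (\<forall>z \<in> ?Z. g z = h z))"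
    proof (intro allI impI)
      fix h assume h: "linear_map R (?F\<lparr>carrier := ?Z\<rparr>) ?D h"
      have "\<exists>\<gamma>. bilinear_map R ?F ?G E \<gamma> \<and> (\<forall>z\<in>?Z. \<forall>g\<in>carrier ?G. \<gamma> z g = h z (?a g)) \<and>
          (\<forall>f\<in>carrier ?F. \<forall>z'\<in>?Z'. \<gamma> f z' = \<zero>\<^bsub>E\<^esub>)"
        by (rule tor[unfolded tor_dual_vanishes_def, rule_format]) (use uncurry[OF h] in simp)
      then obtain \<gamma> where \<gamma>: "bilinear_map R ?F ?G E \<gamma>"
        "\<And>z g. z \<in> ?Z \<Longrightarrow> g \<in> carrier ?G \<Longrightarrow> \<gamma> z g = h z (?a g)"
        "\<And>f z'. f \<in> carrier ?F \<Longrightarrow> z' \<in> ?Z' \<Longrightarrow> \<gamma> f z' = \<zero>\<^bsub>E\<^esub>" by blast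
      obtain k where k: "linear_map R ?F ?D k"
        "\<And>f g. f \<in> carrier ?F \<Longrightarrow> g \<in> carrier ?G \<Longrightarrow> k f (?a g) = \<gamma> f g"
        using curry[OF F \<gamma>(1,3)] by blast
      have "k z = h z" if z: "z \<in> ?Z" for z
      proof (rule module_hom_eqI)
        have zc: "z \<in> carrier ?F" using module.submoduleE(1)[OF F syzygies_submodule[OF M]] z by blast
        show "k z \<in> module_hom R N E" "h z \<in> module_hom R N E"
          using linear_mapD(1)[OF k(1) zc] linear_mapD(1)[OF h] z by simp_all
        fix x assume "x \<in> carrier N"
        then obtain g where g: "g \<in> carrier ?G" "x = ?a g" using im by blast
        show "k z x = h z x" using k(2)[OF zc g(1)] \<gamma>(2)[OF z g(1)] g(2) by simp
      qed
      then show "\<exists>g. linear_map R ?F ?D g \<and> (\<forall>z \<in> ?Z. g z = h z)" using k(1) by blast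
    qed
  qed
qed

theorem Ext_dual_symmetric:
  assumes E: "injective_module R E" and M: "module R M" and N: "module R N"
    and v: "Ext_vanishes R (Suc n) M (hom_module R N E)"
  shows "Ext_vanishes R (Suc n) N (hom_module R M E)"
proof -
  have "syz_tor R E M N n 0" using v Ext_dual_vanishes_iff[OF E M N] by blast
  \<comment> \<open>The degree moves from (n, 0) to (0, n); the swap brings it back to (n, 0) with
    \<open>M\<close> and \<open>N\<close> exchanged.\<close>
  from syz_tor_swap[OF E M N syz_tor_total[OF E M N this]]
  show ?thesis using Ext_dual_vanishes_iff[OF E N M] by simp
qed

text \<open>Invariance in the second argument is direct, because the resolution of \<open>M\<close>
  stays fixed. The first argument is dealt with through duality in
  \<open>Ext_rigid_isomorphic\<close>.\<close>

lemma Ext_vanishes_isomorphic: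
  assumes M: "module R M" and L: "module R L" and L': "module R L'"
    and iso: "module_isomorphic R L L'" and v: "Ext_vanishes R (Suc n) M L"
  shows "Ext_vanishes R (Suc n) M L'"
  unfolding Ext_vanishes_iff[OF M L']
proof (intro allI impI)
  let ?F = "res_module R M n" and ?Z = "syzygies R M n"
  obtain f g where f: "linear_map R L L' f" "linear_map R L' L g"
    "\<And>x. x \<in> carrier L \<Longrightarrow> g (f x) = x" "\<And>y. y \<in> carrier L' \<Longrightarrow> f (g y) = y"
    using module_isomorphicE[OF L iso] by blast
  fix h assume h: "linear_map R (?F\<lparr>carrier := ?Z\<rparr>) L' h"
  have "\<exists>k. linear_map R ?F L k \<and> (\<forall>z \<in> ?Z. k z = g (h z))"
    by (rule v[unfolded Ext_vanishes_iff[OF M L], rule_format]) (rule linear_map_comp[OF h f(2)])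
  then obtain k where k: "linear_map R ?F L k" "\<And>z. z \<in> ?Z \<Longrightarrow> k z = g (h z)" by blast
  have "f (k z) = h z" if "z \<in> ?Z" for z
    using k(2)[OF that] f(4) linear_mapD(1)[OF h] that by simp
  then show "\<exists>k. linear_map R ?F L' k \<and> (\<forall>z \<in> ?Z. k z = h z)"
    using linear_map_comp[OF k(1) f(1)] by blast
qed

section \<open>The defining conditions in elementwise form\<close>

definition Ext_rigid :: "('a, 'r) ring_scheme \<Rightarrow> ('a, 'm) module \<Rightarrow> bool" where
  "Ext_rigid R M \<longleftrightarrow> (\<forall>n. Ext_vanishes R (Suc n) M M)"

lemma Ext_rigid_iff: "Ext_rigid R M \<longleftrightarrow> (\<forall>i > 0. carrier (Ext R i M M) = {\<zero>\<^bsub>Ext R i M M\<^esub>})"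
  unfolding Ext_rigid_def Ext_vanishes_def by (metis Suc_pred zero_less_Suc)

lemma bij_betw_ex1_iff:
  assumes "\<And>x. x \<in> A \<Longrightarrow> f x \<in> B"
  shows "bij_betw f A B \<longleftrightarrow> (\<forall>y \<in> B. \<exists>!x. x \<in> A \<and> y = f x)"
proof
  assume "bij_betw f A B"
  then show "\<forall>y \<in> B. \<exists>!x. x \<in> A \<and> y = f x" by (auto simp: bij_betw_def inj_on_def)
next
  assume *: "\<forall>y \<in> B. \<exists>!x. x \<in> A \<and> y = f x"
  have "inj_on f A" by (rule inj_onI) (use * assms in blast)
  moreover have "f ` A = B" using * assms by blast
  ultimately show "bij_betw f A B" by (simp add: bij_betw_def)
qed

lemma homothety_iso_iff:
  assumes M: "module R M"
  shows "homothety R (smult M) M \<in> module_iso R (regular_module R) (hom_module R M M) \<longleftrightarrow> homothetic R M"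
proof -
  interpret M: module R M by fact
  let ?h = "homothety R (smult M) M"
  have h: "?h r = (\<lambda>x \<in> carrier M. r \<odot>\<^bsub>M\<^esub> x)" if "r \<in> carrier R" for r
    using that by (simp add: homothety_def)
  have mem: "?h r \<in> module_hom R M M" if "r \<in> carrier R" for r
    unfolding h[OF that] by (rule restrict_module_hom[OF M linear_map_homothety[OF M that]])
  have hom: "?h \<in> module_hom R (regular_module R) (hom_module R M M)"
    unfolding module_hom_iff
  proof (intro conjI linear_mapI)
    show "?h \<in> extensional (carrier (regular_module R))" by (simp add: homothety_def regular_module_def)
  qed (use mem in \<open>auto simp: regular_module_def h M.smult_l_distr M.smult_assoc1 fun_eq_iff\<close>)
  have eq: "f = ?h r \<longleftrightarrow> (\<forall>x \<in> carrier M. f x = r \<odot>\<^bsub>M\<^esub> x)"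
    if f: "f \<in> module_hom R M M" and r: "r \<in> carrier R" for f r
    using module_hom_eqI[OF f mem[OF r]] by (auto simp: h[OF r])
  have "bij_betw ?h (carrier R) (module_hom R M M) \<longleftrightarrow>
      (\<forall>f \<in> module_hom R M M. \<exists>!r. r \<in> carrier R \<and> f = ?h r)"
    by (rule bij_betw_ex1_iff) (use mem in simp)
  also have "\<dots> \<longleftrightarrow> homothetic R M"
    unfolding homothetic_def by (intro ball_cong refl) (simp add: eq cong: conj_cong)
  finally show ?thesis using hom by (simp add: module_iso_def regular_module_def)
qed

lemma semidualizing_iff:
  "semidualizing R C \<longleftrightarrow> module R C \<and> finitely_generated R C \<and> homothetic R C \<and> Ext_rigid R C"
  using homothety_iso_iff[of R C] by (auto simp: semidualizing_def Ext_rigid_iff)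

section \<open>Transport along duality, isomorphism and completion\<close>

context matlis
begin

lemma Ext_rigid_dual:
  assumes M: "module R M" and refl: "reflexive M" and rigid: "Ext_rigid R M"
  shows "Ext_rigid R (hom_module R M E)"
  unfolding Ext_rigid_def
proof
  fix n
  note D = dual_module[OF M]
  have "Ext_vanishes R (Suc n) M (hom_module R (hom_module R M E) E)"
    using rigid Ext_vanishes_isomorphic[OF M M dual_module[OF D] reflexive_isomorphic[OF M refl]]
    by (simp add: Ext_rigid_def)
  then show "Ext_vanishes R (Suc n) (hom_module R M E) (hom_module R M E)"
    by (rule Ext_dual_symmetric[OF injective M D])
qed

text \<open>The resolutions of \<open>M\<close> and \<open>N\<close> are not compared. Writing D for
  the dual, rigidity passes to D M; replacing the second copy by D N and applying the symmetry gives
  vanishing of Ext(N, D D M), and D D M is isomorphic to \<open>M\<close>, hence to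
  \<open>N\<close>.\<close>

lemma Ext_rigid_isomorphic:
  assumes M: "module R M" and N: "module R N" and iso: "module_isomorphic R M N"
    and refl: "reflexive M" and rigid: "Ext_rigid R M"
  shows "Ext_rigid R N"
  unfolding Ext_rigid_def
proof
  fix n
  note DM = dual_module[OF M] and DN = dual_module[OF N]
  note DDM = dual_module[OF DM]
  have "Ext_vanishes R (Suc n) (hom_module R M E) (hom_module R M E)"
    using Ext_rigid_dual[OF M refl rigid] by (simp add: Ext_rigid_def)
  then have "Ext_vanishes R (Suc n) (hom_module R M E) (hom_module R N E)"
    by (rule Ext_vanishes_isomorphic[OF DM DM DN module_isomorphic_hom[OF M N E.module_axioms iso]])
  then have "Ext_vanishes R (Suc n) N (hom_module R (hom_module R M E) E)"
    by (rule Ext_dual_symmetric[OF injective DM N])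
  moreover have "module_isomorphic R (hom_module R (hom_module R M E) E) N"
    by (rule module_isomorphic_trans[OF DDM M module_isomorphic_sym[OF M DDM reflexive_isomorphic[OF M refl]] iso])
  ultimately show "Ext_vanishes R (Suc n) N N" using Ext_vanishes_isomorphic[OF N DDM N] by blast
qed

text \<open>The definite description is well posed: at every level n whose power m^n kills
  \<open>t\<close>, all representatives act on \<open>t\<close> as \<open>r\<close> does, and
  \<open>torsion_artinian\<close> supplies such a level.\<close>

lemma completion_smult_eq:
  assumes T: "module R T" and art: "artinian R T" and r: "r \<in> carrier R" and t: "t \<in> carrier T"
  shows "completion_smult R T (\<lambda>n. ideal_power R mm n +> r) t = r \<odot>\<^bsub>T\<^esub> t"
proof -
  interpret T: module R T by fact
  have *: "s \<odot>\<^bsub>T\<^esub> t = r \<odot>\<^bsub>T\<^esub> t" if s: "s \<in> ideal_power R mm n +> r"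
    and n: "\<forall>a \<in> ideal_power R mm n. a \<odot>\<^bsub>T\<^esub> t = \<zero>\<^bsub>T\<^esub>" for s n
  proof -
    obtain a where a: "a \<in> ideal_power R mm n" "s = a \<oplus> r" using s by (auto simp: a_r_coset_def')
    then show ?thesis using n r t ideal_power_carrier[OF a(1)] by (simp add: T.smult_l_distr)
  qed
  obtain n where n: "t \<in> torsion T n" using torsion_artinian[OF T art t] by blast
  have "r \<in> ideal_power R mm n +> r"
    using additive_subgroup.zero_closed[OF ideal.axioms(1)[OF ideal_power_ideal[of n]]] r
    by (force simp: a_r_coset_def')
  with n have "\<exists>n. \<exists>s \<in> ideal_power R mm n +> r.
      (\<forall>a \<in> ideal_power R mm n. a \<odot>\<^bsub>T\<^esub> t = \<zero>\<^bsub>T\<^esub>) \<and> r \<odot>\<^bsub>T\<^esub> t = s \<odot>\<^bsub>T\<^esub> t"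
    by (auto simp: torsion_def)
  then show ?thesis unfolding completion_smult_def
    by (rule the_equality) (use * in blast)
qed

text \<open>For complete \<open>R\<close> the canonical map \<open>\<Phi>\<close> is a bijection
  onto the completion, and \<open>\<Phi> r\<close> acts on \<open>T\<close> as \<open>r\<close>.
  Precomposing the completed homothety map with \<open>\<Phi>\<close> therefore gives the homothety
  map of \<open>R\<close>.\<close>

lemma completion_homothety_iff:
  assumes compl: "max_ideal_complete R" and T: "module R T" and art: "artinian R T"
  shows "homothety (completion R) (completion_smult R T) T \<in>
      module_iso (completion R) (regular_module (completion R)) (hom_module_via R T T (completion_smult R T))
    \<longleftrightarrow> homothetic R T"
proof -
  interpret T: module R T by fact
  define \<Phi> where "\<Phi> = (\<lambda>r n. ideal_power R mm n +> r)"
  let ?C = "completion R" and ?H = "hom_module_via R T T (completion_smult R T)"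
  let ?h = "homothety ?C (completion_smult R T) T"
  have \<Phi>: "\<Phi> \<in> ring_hom R ?C" "bij_betw \<Phi> (carrier R) (carrier ?C)"
    using compl by (auto simp: max_ideal_complete_def ring_iso_def \<Phi>_def)
  have ex: "\<exists>r \<in> carrier R. \<xi> = \<Phi> r" if "\<xi> \<in> carrier ?C" for \<xi>
    using that \<Phi>(2) by (auto simp: bij_betw_def)
  have \<Phi>c: "\<Phi> r \<in> carrier ?C" if "r \<in> carrier R" for r using ring_hom_closed[OF \<Phi>(1) that] .
  have sm: "completion_smult R T (\<Phi> r) t = r \<odot>\<^bsub>T\<^esub> t" if "r \<in> carrier R" "t \<in> carrier T" for r t
    unfolding \<Phi>_def by (rule completion_smult_eq[OF T art that])
  have h: "?h (\<Phi> r) = (\<lambda>x \<in> carrier T. r \<odot>\<^bsub>T\<^esub> x)" if "r \<in> carrier R" for r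
    using \<Phi>c[OF that] sm[OF that] by (auto simp: homothety_def fun_eq_iff)
  have mem: "?h (\<Phi> r) \<in> module_hom R T T" if "r \<in> carrier R" for r
    unfolding h[OF that] by (rule restrict_module_hom[OF T linear_map_homothety[OF T that]])
  have hom: "?h \<in> module_hom ?C (regular_module ?C) ?H"
    unfolding module_hom_iff
  proof (intro conjI linear_mapI)
    show "?h \<in> extensional (carrier (regular_module ?C))" by (simp add: homothety_def regular_module_def)
    fix \<xi> assume "\<xi> \<in> carrier (regular_module ?C)"
    then obtain r where r: "r \<in> carrier R" "\<xi> = \<Phi> r" using ex by (auto simp: regular_module_def)
    show "?h \<xi> \<in> carrier ?H" using mem[OF r(1)] by (simp add: hom_module_via_def r)
    show "?h (\<xi> \<oplus>\<^bsub>regular_module ?C\<^esub> \<eta>) = ?h \<xi> \<oplus>\<^bsub>?H\<^esub> ?h \<eta>"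
      if \<eta>: "\<eta> \<in> carrier (regular_module ?C)" for \<eta>
    proof -
      obtain s where s: "s \<in> carrier R" "\<eta> = \<Phi> s" using ex \<eta> by (auto simp: regular_module_def)
      have "\<xi> \<oplus>\<^bsub>regular_module ?C\<^esub> \<eta> = \<Phi> (r \<oplus> s)"
        using ring_hom_add[OF \<Phi>(1) r(1) s(1)] by (simp add: regular_module_def r s)
      then have "?h (\<xi> \<oplus>\<^bsub>regular_module ?C\<^esub> \<eta>) = (\<lambda>x \<in> carrier T. (r \<oplus> s) \<odot>\<^bsub>T\<^esub> x)"
        using h[of "r \<oplus> s"] r(1) s(1) by simp
      moreover have "?h \<xi> = (\<lambda>x \<in> carrier T. r \<odot>\<^bsub>T\<^esub> x)" "?h \<eta> = (\<lambda>x \<in> carrier T. s \<odot>\<^bsub>T\<^esub> x)"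
        using h[OF r(1)] h[OF s(1)] by (simp_all only: r(2) s(2))
      ultimately show ?thesis
        using r(1) s(1) by (auto simp: hom_module_via_def T.smult_l_distr fun_eq_iff)
    qed
    show "?h (\<eta> \<odot>\<^bsub>regular_module ?C\<^esub> \<xi>) = \<eta> \<odot>\<^bsub>?H\<^esub> ?h \<xi>" if \<eta>: "\<eta> \<in> carrier ?C" for \<eta>
    proof -
      obtain s where s: "s \<in> carrier R" "\<eta> = \<Phi> s" using ex \<eta> by blast
      have "\<eta> \<odot>\<^bsub>regular_module ?C\<^esub> \<xi> = \<Phi> (s \<otimes> r)"
        using ring_hom_mult[OF \<Phi>(1) s(1) r(1)] by (simp add: regular_module_def r s)
      then have "?h (\<eta> \<odot>\<^bsub>regular_module ?C\<^esub> \<xi>) = (\<lambda>x \<in> carrier T. (s \<otimes> r) \<odot>\<^bsub>T\<^esub> x)"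
        using h[of "s \<otimes> r"] r(1) s(1) by simp
      moreover have "?h \<xi> = (\<lambda>x \<in> carrier T. r \<odot>\<^bsub>T\<^esub> x)"
        using h[OF r(1)] by (simp only: r(2))
      ultimately show ?thesis
        using r(1) s(1) unfolding s(2) by (auto simp: hom_module_via_def T.smult_assoc1 sm fun_eq_iff)
    qed
  qed
  have eq: "f = ?h (\<Phi> r) \<longleftrightarrow> (\<forall>x \<in> carrier T. f x = r \<odot>\<^bsub>T\<^esub> x)"
    if f: "f \<in> module_hom R T T" and r: "r \<in> carrier R" for f r
    using module_hom_eqI[OF f mem[OF r]] by (auto simp: h[OF r])
  have "bij_betw ?h (carrier ?C) (module_hom R T T) \<longleftrightarrow>
      bij_betw (?h \<circ> \<Phi>) (carrier R) (module_hom R T T)"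
    using bij_betw_comp_iff[OF \<Phi>(2)] by blast
  also have "\<dots> \<longleftrightarrow> (\<forall>f \<in> module_hom R T T. \<exists>!r. r \<in> carrier R \<and> f = ?h (\<Phi> r))"
    using bij_betw_ex1_iff[of "carrier R" "?h \<circ> \<Phi>" "module_hom R T T"] mem by simp
  also have "\<dots> \<longleftrightarrow> homothetic R T"
    unfolding homothetic_def by (intro ball_cong refl) (simp add: eq cong: conj_cong)
  finally show ?thesis using hom by (simp add: module_iso_def regular_module_def hom_module_via_def)
qed

lemma quasidualizing_iff:
  assumes "max_ideal_complete R"
  shows "quasidualizing R T \<longleftrightarrow> module R T \<and> artinian R T \<and> homothetic R T \<and> Ext_rigid R T"
  using completion_homothety_iff[OF assms, of T] by (auto simp: quasidualizing_def Ext_rigid_iff)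

lemma semidualizing_dual:
  assumes "max_ideal_complete R" "semidualizing R C"
  shows "quasidualizing R (hom_module R C E)"
proof -
  have C: "module R C" "finitely_generated R C" "homothetic R C" "Ext_rigid R C"
    using assms(2) by (simp_all add: semidualizing_iff)
  note refl = finitely_generated_reflexive[OF C(1,2)]
  show ?thesis
    unfolding quasidualizing_iff[OF assms(1)]
    using dual_module[OF C(1)] dual_artinian[OF C(1,2)] dual_homothetic[OF C(1) refl C(3)]
      Ext_rigid_dual[OF C(1) refl C(4)] by blast
qed

lemma quasidualizing_dual:
  assumes "max_ideal_complete R" "quasidualizing R T"
  shows "semidualizing R (hom_module R T E)"
proof -
  have T: "module R T" "artinian R T" "homothetic R T" "Ext_rigid R T"
    using assms(2) by (simp_all add: quasidualizing_iff[OF assms(1)])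
  note refl = artinian_reflexive[OF T(1,2)]
  show ?thesis
    unfolding semidualizing_iff
    using dual_module[OF T(1)] dual_finitely_generated[OF T(1,2)] dual_homothetic[OF T(1) refl T(3)]
      Ext_rigid_dual[OF T(1) refl T(4)] by blast
qed

lemma semidualizing_reflexive: "semidualizing R C \<Longrightarrow> reflexive C"
  by (simp add: semidualizing_iff finitely_generated_reflexive)

lemma quasidualizing_reflexive: "max_ideal_complete R \<Longrightarrow> quasidualizing R T \<Longrightarrow> reflexive T"
  by (simp add: quasidualizing_iff artinian_reflexive)

lemma semidualizing_isomorphic:
  assumes "semidualizing R C" "module R C'" "module_isomorphic R C C'"
  shows "semidualizing R C'"
proof -
  have C: "module R C" "finitely_generated R C" "homothetic R C" "Ext_rigid R C"
    using assms(1) by (simp_all add: semidualizing_iff)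
  show ?thesis
    unfolding semidualizing_iff
    using finitely_generated_isomorphic[OF C(1) assms(2,3) C(2)] homothetic_isomorphic[OF C(1) assms(2,3) C(3)]
      Ext_rigid_isomorphic[OF C(1) assms(2,3) semidualizing_reflexive[OF assms(1)] C(4)] assms(2) by blast
qed

lemma quasidualizing_isomorphic:
  assumes "max_ideal_complete R" "quasidualizing R T" "module R T'" "module_isomorphic R T T'"
  shows "quasidualizing R T'"
proof -
  have T: "module R T" "artinian R T" "homothetic R T" "Ext_rigid R T"
    using assms(2) by (simp_all add: quasidualizing_iff[OF assms(1)])
  show ?thesis
    unfolding quasidualizing_iff[OF assms(1)]
    using artinian_isomorphic[OF T(1) assms(3,4) T(2)] homothetic_isomorphic[OF T(1) assms(3,4) T(3)]
      Ext_rigid_isomorphic[OF T(1) assms(3,4) quasidualizing_reflexive[OF assms(1,2)] T(4)] assms(3) by blast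
qed

section \<open>Copies on the types of the isomorphism classes\<close>

text \<open>An element is encoded by the set of its coefficient vectors with respect to the generators.\<close>

lemma finitely_generated_copy:
  fixes C :: "('a, 'c) module"
  assumes C: "module R C" and fg: "finitely_generated R C"
  obtains C' :: "('a, (nat \<Rightarrow> 'a) set) module" where "module R C'" "module_isomorphic R C C'"
proof -
  interpret C: plain_module R C using C by (rule plain_module.intro)
  obtain A where A: "finite A" "A \<subseteq> carrier C"
    "\<And>K. submodule K R C \<Longrightarrow> A \<subseteq> K \<Longrightarrow> K = carrier C"
    using fg by (auto simp: finitely_generated_def)
  obtain xs where xs: "set xs = A" using finite_list[OF A(1)] by blast
  let ?X = "{..<length xs}"
  let ?F = "free_module R ?X"
  interpret F: module R ?F by (rule free_module_is_module) (rule is_cring)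
  have v: "(!) xs \<in> ?X \<rightarrow> carrier C" using A(2) xs by auto
  let ?l = "lin_ext R C ((!) xs)"
  have l: "linear_map R ?F C ?l"
    by (intro linear_mapI C.lin_ext_closed[OF _ v] C.lin_ext_add[OF _ _ v] C.lin_ext_smult[OF _ _ v])
  have surj: "?l ` carrier ?F = carrier C"
  proof (rule A(3)[OF submodule_image[OF F.module_axioms C l F.carrier_is_submodule]])
    show "A \<subseteq> ?l ` carrier ?F"
    proof
      fix a assume "a \<in> A"
      then obtain i where i: "i \<in> ?X" "a = xs ! i" using xs by (auto simp: in_set_conv_nth)
      show "a \<in> ?l ` carrier ?F" using C.lin_ext_delta[OF i(1) v] i(2) by (metis image_eqI)
    qed
  qed
  define g where "g c = {k \<in> carrier ?F. ?l k = c}" for c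
  have "inj_on g (carrier C)"
  proof (rule inj_onI)
    fix x y assume x: "x \<in> carrier C" and eq: "g x = g y"
    have "x \<in> ?l ` carrier ?F" using x by (simp only: surj)
    then obtain k where "k \<in> carrier ?F" "x = ?l k" ..
    then have "k \<in> g x" by (simp add: g_def)
    then show "x = y" unfolding eq using \<open>x = ?l k\<close> by (simp add: g_def)
  qed
  then show thesis using isomorphic_copy[OF C, of g] that by blast
qed

text \<open>An element is encoded by its values under the finite separating family of
  \<open>artinian_joint_family\<close>, an embedding into a power of \<open>E\<close>; positions
  past the list hold the constant \<open>undefined\<close> and carry no information.\<close>

lemma artinian_copy:
  fixes T :: "('a, 't) module"
  assumes T: "module R T" and art: "artinian R T"
  obtains T' :: "('a, nat \<Rightarrow> 'e) module" where "module R T'" "module_isomorphic R T T'"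
proof -
  interpret T: module R T by fact
  obtain \<Phi> where \<Phi>: "finite \<Phi>" "\<Phi> \<subseteq> module_hom R T E"
    "\<And>t. t \<in> carrier T \<Longrightarrow> (\<And>\<phi>. \<phi> \<in> \<Phi> \<Longrightarrow> \<phi> t = \<zero>\<^bsub>E\<^esub>) \<Longrightarrow> t = \<zero>\<^bsub>T\<^esub>"
    using artinian_joint_family[OF assms] by metis
  obtain \<phi>s where \<phi>s: "set \<phi>s = \<Phi>" using finite_list[OF \<Phi>(1)] by blast
  define g where "g t i = (if i < length \<phi>s then (\<phi>s ! i) t else undefined)" for t i
  have "inj_on g (carrier T)"
  proof (rule inj_onI)
    fix x y assume x: "x \<in> carrier T" and y: "y \<in> carrier T" and eq: "g x = g y"
    have "\<phi> (x \<ominus>\<^bsub>T\<^esub> y) = \<zero>\<^bsub>E\<^esub>" if \<phi>: "\<phi> \<in> \<Phi>" for \<phi>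
    proof -
      obtain i where i: "i < length \<phi>s" "\<phi> = \<phi>s ! i" using \<phi> \<phi>s by (metis in_set_conv_nth)
      have "\<phi> x = \<phi> y" using fun_cong[OF eq, of i] i by (simp add: g_def)
      moreover have l: "linear_map R T E \<phi>" using \<phi> \<Phi>(2) module_homD(1) by blast
      ultimately show ?thesis
        using linear_map_minus[OF T E.module_axioms l x y] linear_mapD(1)[OF l y]
        by (simp add: E.minus_eq E.M.r_neg)
    qed
    then have "x \<ominus>\<^bsub>T\<^esub> y = \<zero>\<^bsub>T\<^esub>" using \<Phi>(3) x y by simp
    moreover have "x = (x \<ominus>\<^bsub>T\<^esub> y) \<oplus>\<^bsub>T\<^esub> y" using x y by (simp add: T.minus_eq T.M.a_assoc T.M.l_neg)
    ultimately show "x = y" using y by simp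
  qed
  then show thesis using isomorphic_copy[OF T, of g] that by blast
qed

end

section \<open>Complete local rings\<close>

lemma local_ring_max_ideal:
  assumes "local_ring R"
  shows "maximalideal (max_ideal R) R" "maximalideal m R \<Longrightarrow> m = max_ideal R"
proof -
  have ex: "\<exists>!m. maximalideal m R" using assms by (simp add: local_ring_def)
  show "maximalideal (max_ideal R) R" unfolding max_ideal_def by (rule theI'[OF ex])
  then show "maximalideal m R \<Longrightarrow> m = max_ideal R" using ex by blast
qed

text \<open>Zorn's lemma applies because a nonempty chain of ideals contains its union, so the union
  of a chain of proper ideals is again proper.\<close>

lemma (in noetherian_ring) proper_ideal_maximal:
  assumes I: "ideal I R" "I \<noteq> carrier R"
  obtains J where "maximalideal J R" "I \<subseteq> J"
proof -
  let ?S = "{J. ideal J R \<and> I \<subseteq> J \<and> J \<noteq> carrier R}"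
  have "\<exists>J\<in>?S. \<forall>X\<in>?S. J \<subseteq> X \<longrightarrow> X = J"
  proof (rule subset_Zorn_nonempty)
    show "?S \<noteq> {}" using I by blast
    show "\<Union>\<C> \<in> ?S" if "\<C> \<noteq> {}" "subset.chain ?S \<C>" for \<C>
    proof -
      have "subset.chain {J. ideal J R} \<C>" using that(2) by (auto simp: subset_chain_def)
      then have "\<Union>\<C> \<in> \<C>" by (rule ideal_chain_is_trivial[OF that(1)])
      then show ?thesis using that(2) by (auto simp: subset_chain_def)
    qed
  qed
  then obtain J where "J \<in> ?S" and max: "\<forall>X\<in>?S. J \<subseteq> X \<longrightarrow> X = J" ..
  then have J: "ideal J R" "I \<subseteq> J" "J \<noteq> carrier R" by simp_all
  have "maximalideal J R"
  proof (rule maximalidealI[OF J(1)])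
    show "K = J \<or> K = carrier R" if K: "ideal K R" "J \<subseteq> K" for K
    proof (cases "K = carrier R")
      case False
      then have "K \<in> ?S" using K J(2) by auto
      then show ?thesis using max K(2) by blast
    qed simp
  qed (use J(3) in simp)
  then show thesis using that J(2) by blast
qed

text \<open>\<open>e0\<close> is the image of the residue class of 1, so its multiples form the
  embedded copy of the residue field. Later arguments see the injective hull only through the
  elementwise facts derived here.\<close>

lemma matlis_intro:
  fixes R :: "('a, 'r) ring_scheme" and E :: "('a, 'e) module"
  assumes noeth: "noetherian_ring R" and loc: "local_ring R" and compl: "max_ideal_complete R"
    and hull: "injective_hull R (residue_field_module R) E"
  obtains e0 where "matlis R E e0"
proof -
  interpret noetherian_ring R by fact
  interpret cring R using loc by (simp add: local_ring_def)
  have inj: "injective_module R E" using hull by (simp add: injective_hull_def)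
  interpret E: module R E using inj by (rule injective_moduleD)
  let ?m = "max_ideal R" and ?k = "residue_field_module R"
  note mx = local_ring_max_ideal[OF loc]
  interpret m: maximalideal ?m R by (rule mx(1))
  note m = m.is_ideal
  have one: "\<one>\<^bsub>R\<^esub> \<notin> ?m" using m.one_imp_carrier m.I_notcarr by auto
  \<comment> \<open>A non-unit generates a proper ideal, which lies in some maximal ideal, hence in
    \<open>?m\<close>.\<close>
  have unit: "\<exists>s \<in> carrier R. s \<otimes>\<^bsub>R\<^esub> r = \<one>\<^bsub>R\<^esub>" if r: "r \<in> carrier R" "r \<notin> ?m" for r
  proof -
    have "PIdl\<^bsub>R\<^esub> r = carrier R"
    proof (rule ccontr)
      assume "PIdl\<^bsub>R\<^esub> r \<noteq> carrier R"
      then obtain J where J: "maximalideal J R" "PIdl\<^bsub>R\<^esub> r \<subseteq> J"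
        using proper_ideal_maximal[OF cgenideal_ideal[OF r(1)]] by blast
      then show False using mx(2)[OF J(1)] cgenideal_self[OF r(1)] r(2) by blast
    qed
    then have "\<one>\<^bsub>R\<^esub> \<in> PIdl\<^bsub>R\<^esub> r" by simp
    then show ?thesis by (force simp: cgenideal_def)
  qed
  have coset: "?m +>\<^bsub>regular_module R\<^esub> r = ?m +>\<^bsub>R\<^esub> r" for r
    by (simp add: a_r_coset_def' regular_module_def)
  have kc: "carrier ?k = (\<lambda>r. ?m +>\<^bsub>R\<^esub> r) ` carrier R"
    by (auto simp: residue_field_module_def quotient_module_def A_RCOSETS_def' coset) (auto simp: regular_module_def)
  \<comment> \<open>The action on cosets is a union over the representatives of the class of 1; each
    of them yields the class of \<open>r\<close>, and there is at least one.\<close>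
  have ks: "r \<odot>\<^bsub>?k\<^esub> (?m +>\<^bsub>R\<^esub> \<one>\<^bsub>R\<^esub>) = ?m +>\<^bsub>R\<^esub> r" if r: "r \<in> carrier R" for r
  proof -
    have "?m +>\<^bsub>R\<^esub> (r \<otimes>\<^bsub>R\<^esub> x) = ?m +>\<^bsub>R\<^esub> r" if x: "x \<in> ?m +>\<^bsub>R\<^esub> \<one>\<^bsub>R\<^esub>" for x
    proof -
      obtain a where a: "a \<in> ?m" "x = a \<oplus>\<^bsub>R\<^esub> \<one>\<^bsub>R\<^esub>" using x by (auto simp: a_r_coset_def')
      have ac: "a \<in> carrier R" using m.Icarr[OF a(1)] .
      have "r \<otimes>\<^bsub>R\<^esub> x = r \<otimes>\<^bsub>R\<^esub> a \<oplus>\<^bsub>R\<^esub> r" using a ac r by (simp add: r_distr)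
      then have "r \<otimes>\<^bsub>R\<^esub> x \<in> ?m +>\<^bsub>R\<^esub> r"
        using m.I_l_closed[OF a(1) r] by (auto simp: a_r_coset_def')
      from m.a_repr_independence'[OF this r] show ?thesis by (rule sym)
    qed
    moreover have "\<one>\<^bsub>R\<^esub> \<in> ?m +>\<^bsub>R\<^esub> \<one>\<^bsub>R\<^esub>" using m.a_rcos_self by simp
    ultimately show ?thesis
      by (auto simp: residue_field_module_def quotient_module_def coset) (auto simp: regular_module_def)
  qed
  obtain j where j: "j \<in> module_hom R ?k E" "inj_on j (carrier ?k)"
    "\<And>N. submodule N R E \<Longrightarrow> N \<noteq> {\<zero>\<^bsub>E\<^esub>} \<Longrightarrow> N \<inter> j ` carrier ?k \<noteq> {\<zero>\<^bsub>E\<^esub>}"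
    using hull unfolding injective_hull_def by blast
  define e0 where "e0 = j (?m +>\<^bsub>R\<^esub> \<one>\<^bsub>R\<^esub>)"
  have k1: "?m +>\<^bsub>R\<^esub> \<one>\<^bsub>R\<^esub> \<in> carrier ?k" unfolding kc by blast
  have e0: "e0 \<in> carrier E" unfolding e0_def by (rule linear_mapD(1)[OF module_homD(1)[OF j(1)] k1])
  have je: "j (?m +>\<^bsub>R\<^esub> r) = r \<odot>\<^bsub>E\<^esub> e0" if "r \<in> carrier R" for r
    using linear_mapD(3)[OF module_homD(1)[OF j(1)] that k1] ks[OF that] by (simp add: e0_def)
  have cos0: "?m +>\<^bsub>R\<^esub> a = ?m +>\<^bsub>R\<^esub> \<zero>\<^bsub>R\<^esub>" if "a \<in> ?m" for a
    using m.a_rcos_const[OF that] m.a_rcos_const[OF m.zero_closed] by simp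
  have max_e0: "a \<odot>\<^bsub>E\<^esub> e0 = \<zero>\<^bsub>E\<^esub>" if a: "a \<in> ?m" for a
    using je[OF m.Icarr[OF a]] je[OF zero_closed] cos0[OF a] e0 by simp
  have e0nz: "e0 \<noteq> \<zero>\<^bsub>E\<^esub>"
  proof
    assume "e0 = \<zero>\<^bsub>E\<^esub>"
    then have "j (?m +>\<^bsub>R\<^esub> \<one>\<^bsub>R\<^esub>) = j (?m +>\<^bsub>R\<^esub> \<zero>\<^bsub>R\<^esub>)" using je[OF zero_closed] by (simp add: e0_def[symmetric])
    then have "?m +>\<^bsub>R\<^esub> \<one>\<^bsub>R\<^esub> = ?m +>\<^bsub>R\<^esub> \<zero>\<^bsub>R\<^esub>"
      using inj_onD[OF j(2) _ k1] kc by blast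
    then have "\<one>\<^bsub>R\<^esub> \<in> ?m" using m.a_rcos_self[OF one_closed] m.a_rcos_const[OF m.zero_closed] by simp
    then show False using one by simp
  qed
  have ess: "\<exists>r \<in> carrier R. r \<odot>\<^bsub>E\<^esub> x = e0" if x: "x \<in> carrier E" "x \<noteq> \<zero>\<^bsub>E\<^esub>" for x
  proof -
    let ?N = "(\<lambda>r. r \<odot>\<^bsub>E\<^esub> x) ` carrier R"
    have lin: "linear_map R (regular_module R) E (\<lambda>r. r \<odot>\<^bsub>E\<^esub> x)"
      using x(1) by (auto simp: linear_map_def regular_module_def E.smult_l_distr E.smult_assoc1)
    have N: "submodule ?N R E"
      using submodule_image[OF regular_module_is_module[OF is_cring] E.module_axioms lin
          module.carrier_is_submodule[OF regular_module_is_module[OF is_cring]]]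
      by (simp add: regular_module_def)
    have "x \<in> ?N" using x(1) by (intro image_eqI[of _ _ "\<one>\<^bsub>R\<^esub>"]) auto
    then have ne: "?N \<inter> j ` carrier ?k \<noteq> {\<zero>\<^bsub>E\<^esub>}" using x(2) by (intro j(3)[OF N]) blast
    have "\<zero>\<^bsub>E\<^esub> \<in> ?N" using submodule_zero[OF N] .
    moreover have "\<zero>\<^bsub>E\<^esub> \<in> j ` carrier ?k"
      using je[OF zero_closed] e0 kc by (metis E.smult_l_null imageI zero_closed)
    \<comment> \<open>Both sets contain zero, so an intersection other than {0} has a nonzero
      element. It is r x and also s e0 with \<open>s\<close> a unit, which makes \<open>e0\<close> a
      multiple of \<open>x\<close>.\<close>
    ultimately obtain y where y: "y \<in> ?N" "y \<in> j ` carrier ?k" "y \<noteq> \<zero>\<^bsub>E\<^esub>" using ne by blast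
    obtain r where r: "r \<in> carrier R" "y = r \<odot>\<^bsub>E\<^esub> x" using y(1) by blast
    obtain s where s: "s \<in> carrier R" "y = s \<odot>\<^bsub>E\<^esub> e0" using y(2) je kc by auto
    have "s \<notin> ?m" using s y(3) max_e0 by blast
    then obtain t where t: "t \<in> carrier R" "t \<otimes>\<^bsub>R\<^esub> s = \<one>\<^bsub>R\<^esub>" using unit s(1) by blast
    have "(t \<otimes>\<^bsub>R\<^esub> r) \<odot>\<^bsub>E\<^esub> x = t \<odot>\<^bsub>E\<^esub> y" using t r x(1) by (simp add: E.smult_assoc1)
    also have "\<dots> = (t \<otimes>\<^bsub>R\<^esub> s) \<odot>\<^bsub>E\<^esub> e0" using t(1) s e0 by (simp add: E.smult_assoc1)
    also have "\<dots> = e0" using t(2) e0 by simp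
    finally show ?thesis using t(1) r(1) by blast
  qed
  have ip: "ideal (ideal_power R ?m n) R" for n
    by (induction n) (auto intro: oneideal ideal_prod_is_ideal m)
  have lim: "\<exists>s \<in> carrier R. \<forall>n. s \<ominus>\<^bsub>R\<^esub> r n \<in> ideal_power R ?m n"
    if r: "\<And>n. r n \<in> carrier R" "\<And>n. r (Suc n) \<ominus>\<^bsub>R\<^esub> r n \<in> ideal_power R ?m n" for r
  proof -
    have as: "abelian_subgroup (ideal_power R ?m n) R" for n
      by (rule abelian_subgroupI3[OF ideal.axioms(1)[OF ip]]) (rule is_abelian_group)
    \<comment> \<open>The classes of \<open>r n\<close> are compatible and form an element of the
      inverse limit; a preimage under the completion map is the limit of the sequence.\<close>
    define \<xi> where "\<xi> n = ideal_power R ?m n +>\<^bsub>R\<^esub> r n" for n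
    have "\<xi> \<in> carrier (completion R)"
    proof -
      have "\<xi> n \<in> carrier (R Quot ideal_power R ?m n)" for n
        using r(1) by (auto simp: \<xi>_def FactRing_def A_RCOSETS_def')
      moreover have "\<xi> (Suc n) \<subseteq> \<xi> n" for n
      proof
        fix x assume "x \<in> \<xi> (Suc n)"
        then obtain a where a: "a \<in> ideal_power R ?m (Suc n)" "x = a \<oplus>\<^bsub>R\<^esub> r (Suc n)"
          by (auto simp: \<xi>_def a_r_coset_def')
        have "a \<in> ideal_power R ?m n" using a(1) ideal_prod_inter[OF m ip[of n]] by auto
        then have "a \<oplus>\<^bsub>R\<^esub> (r (Suc n) \<ominus>\<^bsub>R\<^esub> r n) \<in> ideal_power R ?m n"
          using additive_subgroup.a_closed[OF ideal.axioms(1)[OF ip]] r(2) by blast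
        moreover have "x = (a \<oplus>\<^bsub>R\<^esub> (r (Suc n) \<ominus>\<^bsub>R\<^esub> r n)) \<oplus>\<^bsub>R\<^esub> r n"
          using r(1) ideal.Icarr[OF ip a(1)] by (simp add: a(2) minus_eq a_assoc l_neg)
        ultimately show "x \<in> \<xi> n" by (auto simp: \<xi>_def a_r_coset_def')
      qed
      ultimately show ?thesis by (simp add: completion_def)
    qed
    then obtain s where s: "s \<in> carrier R" "\<xi> = (\<lambda>n. ideal_power R ?m n +>\<^bsub>R\<^esub> s)"
      using compl by (auto simp: max_ideal_complete_def ring_iso_def bij_betw_def)
    have "s \<ominus>\<^bsub>R\<^esub> r n \<in> ideal_power R ?m n" for n
    proof -
      have "s \<in> ideal_power R ?m n +>\<^bsub>R\<^esub> r n"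
        using fun_cong[OF s(2), of n] abelian_subgroup.a_rcos_self[OF as s(1)] by (simp add: \<xi>_def)
      then show ?thesis using abelian_subgroup.a_rcos_module_minus[OF as ring_axioms r(1) s(1)] by blast
    qed
    then show ?thesis using s(1) by blast
  qed
  have "matlis R E e0"
    by unfold_locales (use inj m unit one e0 e0nz max_e0 ess lim in auto)
  then show thesis by (rule that)
qed

section \<open>Isomorphism classes\<close>

lemma iso_class_eq:
  assumes M: "module R M" and N: "module R N" and iso: "module_isomorphic R M N"
  shows "iso_class R M = iso_class R N"
  using module_isomorphic_trans[OF N M module_isomorphic_sym[OF M N iso]]
    module_isomorphic_trans[OF M N iso] by (auto simp: iso_class_def)

text \<open>All members of the class have isomorphic duals, so every class in the union is the same.
  The copy \<open>M'\<close> makes the union nonempty when \<open>M\<close> itself lives on another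
  type.\<close>

lemma matlis_class_iso_class:
  fixes M' :: "('a, 'u) module"
  assumes M: "module R M" and E: "module R E" and M': "module R M'" "module_isomorphic R M M'"
  shows "matlis_class R E (iso_class R M :: ('a, 'u) module set) = iso_class R (matlis_dual R E M)"
proof -
  have "iso_class R (matlis_dual R E N) = iso_class R (matlis_dual R E M)"
    if "N \<in> iso_class R M" for N :: "('a, 'u) module"
  proof -
    have N: "module R N" "module_isomorphic R M N" using that by (simp_all add: iso_class_def)
    show ?thesis
      unfolding matlis_dual_def
      using iso_class_eq[OF hom_module_is_module[OF M E] hom_module_is_module[OF N(1) E]
          module_isomorphic_hom[OF M N(1) E N(2)], symmetric] .
  qed
  moreover have "M' \<in> iso_class R M" using M' by (simp add: iso_class_def)
  ultimately show ?thesis unfolding matlis_class_def by blast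
qed

theorem theorem1:
  fixes R :: "('a, 'r) ring_scheme" and E :: "('a, 'e) module"
  assumes "noetherian_ring R" and "local_ring R" and "max_ideal_complete R"
    and "injective_hull R (residue_field_module R) E"
  shows
    "let S = (semidualizing_classes R :: ('a, (nat \<Rightarrow> 'a) set) module set set);
         Q = (quasidualizing_classes R :: ('a, nat \<Rightarrow> 'e) module set set);
         D = (matlis_class R E :: ('a, (nat \<Rightarrow> 'a) set) module set \<Rightarrow> ('a, nat \<Rightarrow> 'e) module set);
         D' = (matlis_class R E :: ('a, nat \<Rightarrow> 'e) module set \<Rightarrow> ('a, (nat \<Rightarrow> 'a) set) module set)
     in (\<forall>C :: ('a, 'c) module. semidualizing R C \<longrightarrow>
           iso_class R C \<in> S \<and> quasidualizing R (matlis_dual R E C) \<and>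
           iso_class R (matlis_dual R E C) \<in> Q \<and>
           D (iso_class R C) = iso_class R (matlis_dual R E C)) \<and>
        (\<forall>T :: ('a, 't) module. quasidualizing R T \<longrightarrow>
           iso_class R T \<in> Q \<and> semidualizing R (matlis_dual R E T) \<and>
           iso_class R (matlis_dual R E T) \<in> S \<and>
           D' (iso_class R T) = iso_class R (matlis_dual R E T)) \<and>
        bij_betw D S Q \<and> bij_betw D' Q S \<and>
        (\<forall>X \<in> S. D' (D X) = X) \<and> (\<forall>Y \<in> Q. D (D' Y) = Y)"
proof -
  obtain e0 where "matlis R E e0" using matlis_intro[OF assms] .
  then interpret matlis R E e0 .
  define S where "S = (semidualizing_classes R :: ('a, (nat \<Rightarrow> 'a) set) module set set)"
  define Q where "Q = (quasidualizing_classes R :: ('a, nat \<Rightarrow> 'e) module set set)"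
  define D where "D = (matlis_class R E :: ('a, (nat \<Rightarrow> 'a) set) module set \<Rightarrow> ('a, nat \<Rightarrow> 'e) module set)"
  define D' where "D' = (matlis_class R E :: ('a, nat \<Rightarrow> 'e) module set \<Rightarrow> ('a, (nat \<Rightarrow> 'a) set) module set)"
  \<comment> \<open>The type \<open>'x\<close> is arbitrary: the fact is applied to the given
    modules, to the representatives on the fixed type, and to Matlis duals, which live on function
    types.\<close>
  have S: "iso_class R C \<in> S \<and> quasidualizing R (matlis_dual R E C) \<and>
      D (iso_class R C) = iso_class R (matlis_dual R E C)"
    if C: "semidualizing R C" for C :: "('a, 'x) module"
  proof -
    have m: "module R C" "finitely_generated R C" using C by (simp_all add: semidualizing_iff)
    obtain C' :: "('a, (nat \<Rightarrow> 'a) set) module" where C': "module R C'" "module_isomorphic R C C'"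
      using finitely_generated_copy[OF m] by blast
    have "semidualizing R C'" by (rule semidualizing_isomorphic[OF C C'])
    then have "iso_class R C \<in> S"
      using iso_class_eq[OF m(1) C'] by (auto simp: S_def semidualizing_classes_def)
    then show ?thesis
      using semidualizing_dual[OF assms(3) C] matlis_class_iso_class[OF m(1) E.module_axioms C']
      by (simp add: D_def matlis_dual_def)
  qed
  have Q: "iso_class R T \<in> Q \<and> semidualizing R (matlis_dual R E T) \<and>
      D' (iso_class R T) = iso_class R (matlis_dual R E T)"
    if T: "quasidualizing R T" for T :: "('a, 'y) module"
  proof -
    have m: "module R T" "artinian R T" using T by (simp_all add: quasidualizing_def)
    obtain T' :: "('a, nat \<Rightarrow> 'e) module" where T': "module R T'" "module_isomorphic R T T'"
      using artinian_copy[OF m] by blast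
    have "quasidualizing R T'" by (rule quasidualizing_isomorphic[OF assms(3) T T'])
    then have "iso_class R T \<in> Q"
      using iso_class_eq[OF m(1) T'] by (auto simp: Q_def quasidualizing_classes_def)
    then show ?thesis
      using quasidualizing_dual[OF assms(3) T] matlis_class_iso_class[OF m(1) E.module_axioms T']
      by (simp add: D'_def matlis_dual_def)
  qed
  have DD: "D X \<in> Q \<and> D' (D X) = X" if X: "X \<in> S" for X
  proof -
    obtain C :: "('a, (nat \<Rightarrow> 'a) set) module" where C: "X = iso_class R C" "semidualizing R C"
      using X by (auto simp: S_def semidualizing_classes_def)
    have m: "module R C" using C(2) by (simp add: semidualizing_iff)
    have "iso_class R (matlis_dual R E (matlis_dual R E C)) = iso_class R C"
      unfolding matlis_dual_def
      by (rule iso_class_eq[OF m dual_module[OF dual_module[OF m]]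
            reflexive_isomorphic[OF m semidualizing_reflexive[OF C(2)]], symmetric])
    then show ?thesis using S[OF C(2)] Q[of "matlis_dual R E C"] C(1) by simp
  qed
  have D'D: "D' Y \<in> S \<and> D (D' Y) = Y" if Y: "Y \<in> Q" for Y
  proof -
    obtain T :: "('a, nat \<Rightarrow> 'e) module" where T: "Y = iso_class R T" "quasidualizing R T"
      using Y by (auto simp: Q_def quasidualizing_classes_def)
    have m: "module R T" using T(2) by (simp add: quasidualizing_def)
    have "iso_class R (matlis_dual R E (matlis_dual R E T)) = iso_class R T"
      unfolding matlis_dual_def
      by (rule iso_class_eq[OF m dual_module[OF dual_module[OF m]]
            reflexive_isomorphic[OF m quasidualizing_reflexive[OF assms(3) T(2)]], symmetric])
    then show ?thesis using Q[OF T(2)] S[of "matlis_dual R E T"] T(1) by simp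
  qed
  have bij: "bij_betw D S Q" "bij_betw D' Q S"
    by (rule bij_betw_byWitness[of _ D'], use DD D'D in auto)
      (rule bij_betw_byWitness[of _ D], use DD D'D in auto)
  have C: "iso_class R C \<in> S \<and> quasidualizing R (matlis_dual R E C) \<and>
      iso_class R (matlis_dual R E C) \<in> Q \<and> D (iso_class R C) = iso_class R (matlis_dual R E C)"
    if "semidualizing R C" for C :: "('a, 'c) module"
    using S[OF that] Q[of "matlis_dual R E C"] by simp
  have T: "iso_class R T \<in> Q \<and> semidualizing R (matlis_dual R E T) \<and>
      iso_class R (matlis_dual R E T) \<in> S \<and> D' (iso_class R T) = iso_class R (matlis_dual R E T)"
    if "quasidualizing R T" for T :: "('a, 't) module"
    using Q[OF that] S[of "matlis_dual R E T"] by simp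
  show ?thesis
    unfolding Let_def S_def[symmetric] Q_def[symmetric] D_def[symmetric] D'_def[symmetric]
    using bij C T DD D'D by simp
qed

end
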